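(* Let $\beta>0$, and write $N_0:=\mathrm{card}\{n\ge0: X_n=0\}$. (1) If $h_c(\beta)<h<0$ and $\mathbf{E}(\log\tau_1)<\infty$, then the random walk in sparse random environment is transient (that is, $\mathbb{E}\mathbf{E}[\mathcal{P}_{\beta,h}^{\omega,\tau}(N_0<\infty)]=1$), so $\mathcal{E}_{\beta,h}^{\omega,\tau}(N_0)$ is finite $\mathbf{P}\otimes\mathbb{P}$-a.s., but $\mathbf{E}\,\mathcal{E}_{\beta,h,\varepsilon}^{\omega,\tau}(N_0)$ is infinite $\mathbb{P}$-a.s. for every $0\le\varepsilon<f(\beta,h)$. (2) If $h_c^{\mathrm a}(\beta)<h\le h_c(\beta)$, then $\mathbf{E}\,\mathcal{E}_{\beta,h,\varepsilon}^{\omega,\tau}(N_0)$ is finite $\mathbb{P}$-a.s. for every $\varepsilon>0$. The result also holds for $\varepsilon=0$ if $\mathbf{E}(\tau_1)$ is finite and $h<h_c(\beta)$. However, $\mathbb{E}\mathbf{E}\,\mathcal{E}_{\beta,h,\varepsilon}^{\omega,\tau}(N_0)$ is infinite for every $0\le\varepsilon<f(0,h-h_c^{\mathrm a}(\beta))$. (3) If $h\le h_c^{\mathrm a}(\beta)$, then $\mathbb{E}\mathbf{E}\,\mathcal{E}_{\beta,h,\varepsilon}^{\omega,\tau}(N_0)$ is finite for every $\varepsilon>0$. The result also holds for $\varepsilon=0$ if $\mathbf{E}(\tau_1)$ is finite and $h<h_c^{\mathrm a}(\beta)$.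
   Context: $\mathbb{N}_0$ and $\mathbb{N}$ denote the non-negative and the positive integers. Random walk in a potential. Given a real sequence $V=(V_i)_{i\in\mathbb{Z}}$ with $V_0=0$, put $\Delta V_i:=V_i-V_{i-1}$. The random walk in potential $V$ is the Markov chain $X=(X_n)_{n\ge0}$ on $\mathbb{Z}$ started at $X_0=0$ with nearest-neighbour transition probabilities $p(i,i+1)=1-p(i,i-1)=\frac{1}{1+e^{\Delta V_i}}$, $i\in\mathbb{Z}$. Throughout, $V$ is assumed symmetric with respect to $-1/2$, i.e. $V_i=V_{-i-1}$ for all $i\geq 0$ (so $V_{-1}=0$); hence $V$ is determined by $(\Delta V_i)_{i\ge1}$. Its law is $\mathcal{P}_V$. Randomness. $\tau=\{\tau_i\}_{i\ge0}\subset\mathbb{N}_0$ is a renewal process: $\tau_0=0$ and the increments $(\tau_i-\tau_{i-1})_{i\ge1}$ are i.i.d. $\mathbb{N}$-valued random variables; its law and expectation are $\mathbf{P},\mathbf{E}$, and $\mathbf{P}(\tau_1=n)=L(n)n^{-(1+\alpha)}$, $n\in\mathbb{N}$, with $\alpha\ge0$ and $L$ slowly varying. $\omega=(\omega_i)_{i\ge1}$ is a sequence of i.i.d. real random variables, independent of $\tau$, with law and expectation $\mathbb{P},\mathbb{E}$, such that $\mathbb{E}(\omega_1)=0$ and $\mathbb{E}(e^{\beta\omega_1})<\infty$ for all $\beta\ge0$. Random walk in sparse random environment (RWsRE). For $h\in\mathbb{R}$ and $\varepsilon\in\mathbb{R}$, $\mathcal{P}_{\beta,h,\varepsilon}^{\omega,\tau}$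 (expectation $\mathcal{E}_{\beta,h,\varepsilon}^{\omega,\tau}$) is the law $\mathcal{P}_V$ for the potential with $\Delta V_i=(h+\beta\omega_i)\mathbf{1}_{\{i\in\tau\}}-\varepsilon$ for $i\ge1$. The quenched RWsRE is the case $\varepsilon=0$, with law $\mathcal{P}_{\beta,h}^{\omega,\tau}:=\mathcal{P}_{\beta,h,0}^{\omega,\tau}$ and expectation $\mathcal{E}_{\beta,h}^{\omega,\tau}:=\mathcal{E}_{\beta,h,0}^{\omega,\tau}$. Random pinning model. For $\beta\ge0$, $h\in\mathbb{R}$, $n\ge1$, let $Z_{n,\omega}^{\beta,h}:=\mathbf{E}\big[\exp\big(\sum_{i=1}^n(\beta\omega_i+h)\mathbf{1}_{\{i\in\tau\}}\big)\big]$. The free energy is $f(\beta,h):=\lim_{n\to\infty}\frac1n\log Z_{n,\omega}^{\beta,h}$, a limit which is known to exist $\mathbb{P}$-a.s., to be non-random and to satisfy $f(\beta,h)\ge0$. The quenched critical point $h_c(\beta)\in(-\infty,0]$ is the (known to exist) value such that $f(\beta,h)=0$ for every $h\le h_c(\beta)$ and $f(\beta,h)>0$ for every $h>h_c(\beta)$; it is known that $h_c(0)=0$. The annealed critical point is $h_c^{\mathrm a}(\beta):=-\lambda(\beta)$, where $\lambda(\beta):=\log\mathbb{E}(e^{\beta\omega_1})$. *)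

theory Defs
  imports "HOL-Probability.Probability"
begin

text \<open>The potential with increments \<open>d i\<close> for \<open>i \<ge> 1\<close>, normalised at \<open>0\<close> and reflected at \<open>-1/2\<close>.\<close>

definition sym_potential :: "(nat \<Rightarrow> real) \<Rightarrow> int \<Rightarrow> real" where
  "sym_potential d i = (\<Sum>j = 1..nat (if 0 \<le> i then i else - i - 1). d j)"

definition rw_step :: "(int \<Rightarrow> real) \<Rightarrow> int \<Rightarrow> int pmf" where
  "rw_step V i =
    map_pmf (\<lambda>b. if b then i + 1 else i - 1) (bernoulli_pmf (1 / (1 + exp (V i - V (i - 1)))))"

text \<open>The law of \<open>X n\<close> given the positions \<open>X 0, \<dots>, X (n - 1)\<close>.\<close>

definition rw_kernel :: "(int \<Rightarrow> real) \<Rightarrow> nat \<Rightarrow> (nat \<Rightarrow> int) \<Rightarrow> int pmf" where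
  "rw_kernel V n x = (if n = 0 then return_pmf 0 else rw_step V (x (n - 1)))"

text \<open>The law of the whole trajectory on \<open>nat \<Rightarrow> int\<close>, by the Ionescu-Tulcea theorem;
  the lemma \<open>emeasure_rw_law\<close> below gives its finite-dimensional distributions.\<close>

definition rw_law :: "(int \<Rightarrow> real) \<Rightarrow> (nat \<Rightarrow> int) measure" where
  "rw_law V = projective_family.lim UNIV
    (Ionescu_Tulcea.CI (\<lambda>n x. measure_pmf (rw_kernel V n x)) (\<lambda>_. count_space UNIV))
    (\<lambda>_. count_space UNIV)"

lemma sym_potential_0: "sym_potential d 0 = 0"
  by (simp add: sym_potential_def)

lemma sym_potential_reflect: "sym_potential d (- i - 1) = sym_potential d i"
  by (auto simp: sym_potential_def)

lemma sym_potential_increment: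
  assumes "i \<ge> 1"
  shows "sym_potential d (int i) - sym_potential d (int i - 1) = d i"
proof -
  obtain k where "i = Suc k" using assms by (cases i) auto
  moreover have "nat (1 + int k) = Suc k" by simp
  ultimately show ?thesis by (simp add: sym_potential_def)
qed

lemma pmf_rw_step:
  "pmf (rw_step V i) (i + 1) = 1 / (1 + exp (V i - V (i - 1)))"
  "pmf (rw_step V i) (i - 1) = 1 - 1 / (1 + exp (V i - V (i - 1)))"
proof -
  let ?p = "1 / (1 + exp (V i - V (i - 1)))"
  have p: "0 \<le> ?p" "?p \<le> 1" by (auto simp: field_simps add_pos_pos)
  have inj: "inj (\<lambda>b. if b then i + 1 else i - 1)"
    by (auto simp: inj_def)
  show "pmf (rw_step V i) (i + 1) = ?p"
    using pmf_map_inj'[OF inj, of "bernoulli_pmf ?p" True] p by (simp add: rw_step_def)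
  show "pmf (rw_step V i) (i - 1) = 1 - ?p"
    using pmf_map_inj'[OF inj, of "bernoulli_pmf ?p" False] p by (simp add: rw_step_def)
qed

lemma Ionescu_Tulcea_rw:
  "Ionescu_Tulcea (\<lambda>n x. measure_pmf (rw_kernel V n x)) (\<lambda>_. count_space UNIV)"
proof
  fix i :: nat
  have "(\<lambda>x. measure_pmf (rw_step V (x (i - 1)))) \<in>
      Pi\<^sub>M {0..<i} (\<lambda>_. count_space UNIV) \<rightarrow>\<^sub>M subprob_algebra (count_space UNIV)" if "i \<noteq> 0"
  proof -
    have "(\<lambda>x. x (i - 1)) \<in> Pi\<^sub>M {0..<i} (\<lambda>_. count_space UNIV) \<rightarrow>\<^sub>M (count_space UNIV :: int measure)"
      using that by (intro measurable_component_singleton) auto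
    moreover have "(\<lambda>k. measure_pmf (rw_step V k)) \<in>
        count_space UNIV \<rightarrow>\<^sub>M subprob_algebra (count_space UNIV)"
      by (rule measurable_measure_pmf)
    ultimately show ?thesis by (rule measurable_compose)
  qed
  then show "(\<lambda>x. measure_pmf (rw_kernel V i x)) \<in>
      Pi\<^sub>M {0..<i} (\<lambda>_. count_space UNIV) \<rightarrow>\<^sub>M subprob_algebra (count_space UNIV)"
    by (cases "i = 0") (auto simp: rw_kernel_def space_subprob_algebra
        intro!: measurable_const prob_space_imp_subprob_space prob_space_measure_pmf)
qed

lemma sets_rw_law: "sets (rw_law V) = sets (Pi\<^sub>M UNIV (\<lambda>_. count_space UNIV))"
proof -
  interpret Ionescu_Tulcea "\<lambda>n x. measure_pmf (rw_kernel V n x)" "\<lambda>_. count_space UNIV"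
    by (rule Ionescu_Tulcea_rw)
  show ?thesis unfolding rw_law_def by (rule PF.sets_lim)
qed

lemma prob_space_rw_law: "prob_space (rw_law V)"
proof -
  interpret Ionescu_Tulcea "\<lambda>n x. measure_pmf (rw_kernel V n x)" "\<lambda>_. count_space UNIV"
    by (rule Ionescu_Tulcea_rw)
  have "emeasure PF.lim (space PF.lim) = 1"
  proof -
    have "emeasure PF.lim (PF.emb UNIV {} {\<lambda>_. undefined}) = emeasure (CI {}) {\<lambda>_. undefined}"
      by (rule lim) (auto simp: PiM_empty)
    also have "\<dots> = 1"
      using prob_space.emeasure_space_1[OF PF.prob_space_P[of "{}"]]
      by (simp add: PF.space_P PiM_empty)
    also have "PF.emb UNIV {} {\<lambda>_. undefined} = space PF.lim"
      by (auto simp: prod_emb_def PF.space_lim space_PiM)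
    finally show ?thesis .
  qed
  then show ?thesis unfolding rw_law_def by (rule prob_spaceI)
qed

lemma emeasure_rw_law:
  "emeasure (rw_law V) {x. \<forall>i\<le>n. x i = y i} =
    (if y 0 = 0 then \<Prod>i<n. ennreal (pmf (rw_step V (y i)) (y (Suc i))) else 0)"
proof -
  interpret Ionescu_Tulcea "\<lambda>n x. measure_pmf (rw_kernel V n x)" "\<lambda>_. count_space UNIV"
    by (rule Ionescu_Tulcea_rw)
  let ?r = "\<lambda>n. restrict y {0..<n}"
  have sing: "{?r n} \<in> sets (Pi\<^sub>M {0..<n} (\<lambda>_. count_space UNIV))" for n
  proof -
    have "{?r n} = (\<Pi>\<^sub>E i\<in>{0..<n}. {y i})"
      by (auto simp: PiE_def extensional_def restrict_def fun_eq_iff Pi_def)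
    also have "\<dots> \<in> sets (Pi\<^sub>M {0..<n} (\<lambda>_. count_space UNIV))"
      by (intro sets_PiM_I_finite) auto
    finally show ?thesis .
  qed
  have undef: "(\<lambda>_. undefined) \<in> space (Pi\<^sub>M {0..<0::nat} (\<lambda>_. count_space UNIV))"
    by (simp add: space_PiM)
  have eP_sing: "emeasure (eP m x) {?r (Suc m)} =
      ennreal (pmf (rw_kernel V m (?r m)) (y m)) * indicator {?r m} x"
    if "x \<in> space (Pi\<^sub>M {0..<m} (\<lambda>_. count_space UNIV))" for m x
  proof -
    have x: "x j = undefined" if "j \<ge> m" for j
      using \<open>x \<in> _\<close> that by (auto simp: space_PiM PiE_def extensional_def)
    have upd: "x(m := z) = ?r (Suc m) \<longleftrightarrow> x = ?r m \<and> z = y m" for z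
    proof
      assume eq: "x(m := z) = ?r (Suc m)"
      have "x j = ?r m j" for j
        using fun_cong[OF eq, of j] x[of j] by (cases "j < m"; cases "j = m") auto
      moreover have "z = y m" using fun_cong[OF eq, of m] by simp
      ultimately show "x = ?r m \<and> z = y m" by blast
    next
      assume "x = ?r m \<and> z = y m"
      then have "(x(m := z)) j = ?r (Suc m) j" for j
        by (cases "j < m"; cases "j = m") auto
      then show "x(m := z) = ?r (Suc m)" by blast
    qed
    have "(\<lambda>z. x(m := z)) -` {?r (Suc m)} = {z. x = ?r m \<and> z = y m}"
      unfolding vimage_def singleton_iff upd ..
    then have "emeasure (eP m x) {?r (Suc m)} =
        emeasure (measure_pmf (rw_kernel V m x)) {z. x = ?r m \<and> z = y m}"
      by (simp only: emeasure_eP[OF that sing] space_count_space Int_UNIV_right)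
    also have "\<dots> = ennreal (pmf (rw_kernel V m (?r m)) (y m)) * indicator {?r m} x"
      by (cases "x = ?r m") (simp_all add: emeasure_pmf_single)
    finally show ?thesis .
  qed
  have C_Suc: "emeasure (C 0 (Suc m) (\<lambda>_. undefined)) {?r (Suc m)} =
      emeasure (C 0 m (\<lambda>_. undefined)) {?r m} * ennreal (pmf (rw_kernel V m (?r m)) (y m))" for m
  proof -
    have "emeasure (C 0 (Suc m) (\<lambda>_. undefined)) {?r (Suc m)} =
        (\<integral>\<^sup>+x. emeasure (eP m x) {?r (Suc m)} \<partial>C 0 m (\<lambda>_. undefined))"
      using measurable_eP[of m] sing[of "Suc m"] prob_space.not_empty[OF prob_space_C[OF undef, of m]]
      by (simp add: emeasure_bind[where N="Pi\<^sub>M {0..<Suc m} (\<lambda>_. count_space UNIV)"]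
          measurable_cong_sets[OF sets_C[OF undef] refl])
    also have "\<dots> = (\<integral>\<^sup>+x. ennreal (pmf (rw_kernel V m (?r m)) (y m)) * indicator {?r m} x
        \<partial>C 0 m (\<lambda>_. undefined))"
      using undef by (intro nn_integral_cong eP_sing) (simp add: space_C)
    also have "\<dots> = ennreal (pmf (rw_kernel V m (?r m)) (y m)) * emeasure (C 0 m (\<lambda>_. undefined)) {?r m}"
      using sing[of m] by (intro nn_integral_cmult_indicator) (simp add: sets_C[OF undef])
    finally show ?thesis by (simp add: mult.commute)
  qed
  have C: "emeasure (C 0 (Suc n) (\<lambda>_. undefined)) {?r (Suc n)} =
    (if y 0 = 0 then \<Prod>i<n. ennreal (pmf (rw_step V (y i)) (y (Suc i))) else 0)"
  proof (induction n)
    case 0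
    have "emeasure (C 0 0 (\<lambda>_. undefined)) {?r 0} = 1"
      using sing[of 0] by (simp add: restrict_def)
    moreover have "emeasure (C 0 (Suc 0) (\<lambda>_. undefined)) {?r (Suc 0)} =
        emeasure (C 0 0 (\<lambda>_. undefined)) {?r 0} * ennreal (pmf (rw_kernel V 0 (?r 0)) (y 0))"
      by (rule C_Suc)
    moreover have "pmf (rw_kernel V 0 (?r 0)) (y 0) = (if y 0 = 0 then 1 else 0)"
      by (simp add: rw_kernel_def indicator_def)
    ultimately show ?case
      by (simp only: lessThan_0 prod.empty mult_1 ennreal_1 ennreal_0 split: if_split)
        simp
  next
    case (Suc n)
    have "pmf (rw_kernel V (Suc n) (?r (Suc n))) (y (Suc n)) = pmf (rw_step V (y n)) (y (Suc n))"
      by (simp add: rw_kernel_def)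
    then show ?case
      by (subst C_Suc, simp only: Suc.IH prod.lessThan_Suc mult_zero_left split: if_split) simp
  qed
  have "emeasure PF.lim (PF.emb UNIV {0..<Suc n} {?r (Suc n)}) = emeasure (CI {0..<Suc n}) {?r (Suc n)}"
    by (rule lim[OF _ sing]) auto
  also have "\<dots> = emeasure (C 0 (Suc n) (\<lambda>_. undefined)) (PF.emb {0..<Suc n} {0..<Suc n} {?r (Suc n)})"
    by (rule emeasure_CI[OF _ sing]) auto
  also have "PF.emb {0..<Suc n} {0..<Suc n} {?r (Suc n)} = {?r (Suc n)}"
    by (rule prod_emb_id) (auto)
  also have "PF.emb UNIV {0..<Suc n} {?r (Suc n)} = {x. \<forall>i\<le>n. x i = y i}"
  proof -
    have "restrict x {0..<Suc n} = ?r (Suc n) \<longleftrightarrow> (\<forall>i\<le>n. x i = y i)" for x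
    proof
      assume eq: "restrict x {0..<Suc n} = ?r (Suc n)"
      show "\<forall>i\<le>n. x i = y i"
      proof (intro allI impI)
        fix i assume "i \<le> n"
        then show "x i = y i" using fun_cong[OF eq, of i] by (simp add: less_Suc_eq_le)
      qed
    next
      assume "\<forall>i\<le>n. x i = y i"
      then show "restrict x {0..<Suc n} = ?r (Suc n)"
        by (intro restrict_ext) (simp add: less_Suc_eq_le)
    qed
    then show ?thesis by (auto simp: prod_emb_def)
  qed
  finally show ?thesis unfolding rw_law_def C .
qed

definition visits :: "(nat \<Rightarrow> int) \<Rightarrow> ennreal" where
  "visits x = emeasure (count_space UNIV) {n. x n = 0}"

text \<open>Only the values of \<open>L\<close> on the positive half-line matter, and positivity is required near
  infinity only.\<close>

definition slowly_varying :: "(real \<Rightarrow> real) \<Rightarrow> bool" where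
  "slowly_varying L \<longleftrightarrow>
    set_borel_measurable borel {0<..} L \<and>
    (\<forall>\<^sub>F x in at_top. 0 < L x) \<and>
    (\<forall>c>0. ((\<lambda>x. L (c * x) / L x) \<longlongrightarrow> 1) at_top)"

locale renewal_process = prob_space T for T :: "'t measure" +
  fixes \<tau> :: "nat \<Rightarrow> 't \<Rightarrow> nat" and \<alpha> :: real and L :: "real \<Rightarrow> real"
  assumes start: "t \<in> space T \<Longrightarrow> \<tau> 0 t = 0"
    and increasing: "t \<in> space T \<Longrightarrow> \<tau> i t < \<tau> (Suc i) t"
    and indep_increments: "indep_vars (\<lambda>_. count_space UNIV) (\<lambda>i t. \<tau> (Suc i) t - \<tau> i t) UNIV"
    and stationary_increments:
      "distr T (count_space UNIV) (\<lambda>t. \<tau> (Suc i) t - \<tau> i t) = distr T (count_space UNIV) (\<tau> 1)"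
    and inter_arrival_law:
      "1 \<le> n \<Longrightarrow> prob {t \<in> space T. \<tau> 1 t = n} = L (real n) * real n powr (- (1 + \<alpha>))"
    and alpha_nonneg: "0 \<le> \<alpha>"
    and slowly_varying: "slowly_varying L"

text \<open>The disorder is indexed by the positive integers; \<open>\<omega> 0\<close> is arbitrary.\<close>

locale iid_disorder = prob_space W for W :: "'w measure" +
  fixes \<omega> :: "nat \<Rightarrow> 'w \<Rightarrow> real"
  assumes indep: "indep_vars (\<lambda>_. borel) \<omega> {1..}"
    and identically_distributed: "1 \<le> i \<Longrightarrow> distr W borel (\<omega> i) = distr W borel (\<omega> 1)"
    and integrable_disorder: "integrable W (\<omega> 1)"
    and centred: "expectation (\<omega> 1) = 0"
    and exp_moments: "0 \<le> \<beta> \<Longrightarrow> integrable W (\<lambda>w. exp (\<beta> * \<omega> 1 w))"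

text \<open>Here and below, \<open>x\<close> and \<open>S\<close> are realisations of the disorder and of the renewal set.\<close>

definition partition_function ::
    "'t measure \<Rightarrow> (nat \<Rightarrow> 't \<Rightarrow> nat) \<Rightarrow> real \<Rightarrow> real \<Rightarrow> nat \<Rightarrow> (nat \<Rightarrow> real) \<Rightarrow> real" where
  "partition_function T \<tau> \<beta> h n x =
    (LINT t|T. exp (\<Sum>i = 1..n. (\<beta> * x i + h) * indicator (range (\<lambda>k. \<tau> k t)) i))"

text \<open>The free energy and the critical curve are introduced through the properties
  that determine them for \<open>\<beta> \<ge> 0\<close> (see the two uniqueness lemmas); that such functions
  exist is a standard fact on the pinning model.\<close>

definition is_free_energy ::
    "'t measure \<Rightarrow> (nat \<Rightarrow> 't \<Rightarrow> nat) \<Rightarrow> 'w measure \<Rightarrow> (nat \<Rightarrow> 'w \<Rightarrow> real) \<Rightarrow>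
      (real \<Rightarrow> real \<Rightarrow> real) \<Rightarrow> bool" where
  "is_free_energy T \<tau> W \<omega> f \<longleftrightarrow>
    (\<forall>\<beta>\<ge>0. \<forall>h. 0 \<le> f \<beta> h \<and>
      (AE w in W.
        (\<lambda>n. ln (partition_function T \<tau> \<beta> h n (\<lambda>i. \<omega> i w)) / real n) \<longlonglongrightarrow> f \<beta> h))"

definition is_critical_curve :: "(real \<Rightarrow> real \<Rightarrow> real) \<Rightarrow> (real \<Rightarrow> real) \<Rightarrow> bool" where
  "is_critical_curve f h\<^sub>c \<longleftrightarrow>
    h\<^sub>c 0 = 0 \<and>
    (\<forall>\<beta>\<ge>0. h\<^sub>c \<beta> \<le> 0 \<and> (\<forall>h\<le>h\<^sub>c \<beta>. f \<beta> h = 0) \<and> (\<forall>h>h\<^sub>c \<beta>. 0 < f \<beta> h))"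

lemma free_energy_unique:
  assumes "prob_space W" "is_free_energy T \<tau> W \<omega> f" "is_free_energy T \<tau> W \<omega> g" "0 \<le> \<beta>"
  shows "f \<beta> h = g \<beta> h"
proof -
  interpret prob_space W by fact
  let ?X = "\<lambda>w n. ln (partition_function T \<tau> \<beta> h n (\<lambda>i. \<omega> i w)) / real n"
  have "AE w in W. ?X w \<longlonglongrightarrow> f \<beta> h" "AE w in W. ?X w \<longlonglongrightarrow> g \<beta> h"
    using assms(2-4) unfolding is_free_energy_def by blast+
  then have "AE w in W. f \<beta> h = g \<beta> h"
    by eventually_elim (rule LIMSEQ_unique)
  then show ?thesis by simp
qed

lemma critical_curve_unique:
  assumes "is_critical_curve f c" "is_critical_curve f c'" "0 \<le> \<beta>"
  shows "c \<beta> = c' \<beta>"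
  using assms unfolding is_critical_curve_def by (metis less_irrefl linorder_le_less_linear linorder_less_linear)

definition log_mgf :: "'w measure \<Rightarrow> (nat \<Rightarrow> 'w \<Rightarrow> real) \<Rightarrow> real \<Rightarrow> real" where
  "log_mgf W \<omega> \<beta> = ln (LINT w|W. exp (\<beta> * \<omega> 1 w))"

definition annealed_critical_point :: "'w measure \<Rightarrow> (nat \<Rightarrow> 'w \<Rightarrow> real) \<Rightarrow> real \<Rightarrow> real" where
  "annealed_critical_point W \<omega> \<beta> = - log_mgf W \<omega> \<beta>"

definition rwsre_law :: "real \<Rightarrow> real \<Rightarrow> real \<Rightarrow> (nat \<Rightarrow> real) \<Rightarrow> nat set \<Rightarrow> (nat \<Rightarrow> int) measure" where
  "rwsre_law \<beta> h \<epsilon> x S = rw_law (sym_potential (\<lambda>i. (h + \<beta> * x i) * indicator S i - \<epsilon>))"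

definition mean_visits :: "real \<Rightarrow> real \<Rightarrow> real \<Rightarrow> (nat \<Rightarrow> real) \<Rightarrow> nat set \<Rightarrow> ennreal" where
  "mean_visits \<beta> h \<epsilon> x S = (\<integral>\<^sup>+y. visits y \<partial>rwsre_law \<beta> h \<epsilon> x S)"

definition renewal_mean_visits ::
    "'t measure \<Rightarrow> (nat \<Rightarrow> 't \<Rightarrow> nat) \<Rightarrow> real \<Rightarrow> real \<Rightarrow> real \<Rightarrow> (nat \<Rightarrow> real) \<Rightarrow> ennreal" where
  "renewal_mean_visits T \<tau> \<beta> h \<epsilon> x = (\<integral>\<^sup>+t. mean_visits \<beta> h \<epsilon> x (range (\<lambda>k. \<tau> k t)) \<partial>T)"

definition annealed_mean_visits ::
    "'t measure \<Rightarrow> (nat \<Rightarrow> 't \<Rightarrow> nat) \<Rightarrow> 'w measure \<Rightarrow> (nat \<Rightarrow> 'w \<Rightarrow> real) \<Rightarrow>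
      real \<Rightarrow> real \<Rightarrow> real \<Rightarrow> ennreal" where
  "annealed_mean_visits T \<tau> W \<omega> \<beta> h \<epsilon> =
    (\<integral>\<^sup>+w. renewal_mean_visits T \<tau> \<beta> h \<epsilon> (\<lambda>i. \<omega> i w) \<partial>W)"

definition transience_probability ::
    "'t measure \<Rightarrow> (nat \<Rightarrow> 't \<Rightarrow> nat) \<Rightarrow> 'w measure \<Rightarrow> (nat \<Rightarrow> 'w \<Rightarrow> real) \<Rightarrow>
      real \<Rightarrow> real \<Rightarrow> ennreal" where
  "transience_probability T \<tau> W \<omega> \<beta> h =
    (\<integral>\<^sup>+w. \<integral>\<^sup>+t. emeasure (rwsre_law \<beta> h 0 (\<lambda>i. \<omega> i w) (range (\<lambda>k. \<tau> k t))) {y. visits y < \<infinity>}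
      \<partial>T \<partial>W)"

end

theory Submission
  imports Defs
begin

text \<open>
  The walk is a reversible nearest-neighbour chain: the edge between \<open>i\<close> and \<open>i + 1\<close> carries the
  conductance \<open>exp (- V i)\<close>. By the symmetry of the potential, the mean number of visits to the
  origin is the resistance \<open>\<Sum>i\<ge>0. exp (V i)\<close> of a half-line (\<open>mean_visits_rw_law\<close>). Its average
  over the renewal process is therefore \<open>\<Sum>n. exp (- \<epsilon> * n) * Z n\<close> with the pinning partition functions
  \<open>Z n\<close> (\<open>renewal_mean_visits_eq\<close>), and averaging over the disorder as well replaces \<open>Z n\<close> by a
  homogeneous partition function with the shifted parameter \<open>h - h\<^sub>a\<close>, where \<open>h\<^sub>a\<close> is the annealed
  critical point (\<open>annealed_mean_visits_eq\<close>). All claims that compare \<open>\<epsilon>\<close> with a free energy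
  are root tests for these two series, and below the annealed critical point the series at
  \<open>\<epsilon> = 0\<close> is dominated by a geometric series once the jumps have a finite mean.

  Transience for \<open>h < 0\<close> concerns a fixed renewal set: there the resistance is
  \<open>\<Sum>k. \<rho> k * W k\<close> with \<open>\<rho> k\<close> the \<open>k\<close>-th jump and \<open>W k\<close> a product of \<open>k\<close> independent weights. A small
  power of a weight has mean less than \<open>1\<close> because the disorder is centred
  (\<open>small_power_contracts\<close>), so \<open>W\<close> decays exponentially, while \<open>\<rho>\<close> grows
  subexponentially as soon as \<open>ln (\<tau> 1)\<close> is integrable.

  The deep claim is that \<open>\<Sum>n. Z n\<close> converges almost surely for \<open>h < h\<^sub>c\<close> when the jumps
  have a finite mean. The free energy vanishes at \<open>h\<^sub>c\<close>, which only says that \<open>Z n\<close> grows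
  subexponentially there; the gain \<open>exp (- u)\<close> per contact, \<open>u = h\<^sub>c - h\<close>, has to be turned into
  summability although a path of \<open>k\<close> contacts may be exponentially long in \<open>k\<close>. Three ideas
  achieve this.

  \<^item> Rare stretches (\<open>frac_moment_pinned_pf_bound\<close>). If a stretch of length \<open>n\<close> had
    pinned weight at least \<open>A\<close> with probability \<open>p\<close>, a path could visit only such stretches, jumping
    over gaps of typical length \<open>n / p\<close> at a cost \<open>(n / p) powr - a\<close>, for any \<open>a > 1 + \<alpha>\<close>. Zero free energy forbids a
    profit, so \<open>p\<close> is at most of the order of \<open>n * A powr (- 1 / a)\<close>. Hence pinned weights have
    fractional moments of every order \<open>\<gamma> < 1 / (1 + \<alpha>)\<close>, growing at most linearly in \<open>n\<close>.
  \<^item> Cutting at long jumps (\<open>frac_moment_renewal_bound\<close>). Powers \<open>\<gamma> \<le> 1\<close> are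
    subadditive, and the stretches of a path between its long jumps see disjoint parts of the
    environment. The fractional moments of all path sums are bounded once the long jumps carry
    enough extra weight loss to pay for the polynomial moments of the stretches.
  \<^item> A multi-scale tilt (\<open>scale_decomposition\<close>). An annealed estimate with the finite
    mean shows that only paths with \<open>\<Prod>r \<le> exp (C * k)\<close> over their jumps \<open>r\<close> matter. Among many disjoint bands of
    scales, the jumps in one band then have a product so small that they can be penalised by a large power at
    little exponential cost, and jumps beyond that band can be penalised by a small power; these penalties are the extra
    weight loss required for the cutting step at the lower end of the band. They are paid by the
    gain \<open>exp (- u)\<close> per contact (\<open>delocalised_series_finite\<close>).
\<close>

section \<open>The expected number of visits is an effective resistance\<close>

primrec position_pmf :: "(int \<Rightarrow> real) \<Rightarrow> nat \<Rightarrow> int pmf" where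
  "position_pmf V 0 = return_pmf 0"
| "position_pmf V (Suc n) = bind_pmf (position_pmf V n) (rw_step V)"

lemma space_rw_law: "space (rw_law V) = UNIV"
  using sets_eq_imp_space_eq[OF sets_rw_law[of V]] by (simp add: space_PiM)

lemma measurable_rw_coordinate [measurable]:
  "(\<lambda>x. x n) \<in> rw_law V \<rightarrow>\<^sub>M count_space UNIV"
proof -
  have "(\<lambda>x. x n) \<in> Pi\<^sub>M UNIV (\<lambda>_. count_space (UNIV::int set)) \<rightarrow>\<^sub>M count_space UNIV"
    by (rule measurable_component_singleton) simp
  then show ?thesis
    by (simp add: measurable_cong_sets[OF sets_rw_law refl])
qed

lemma sets_rw_position: "{x. x n = j} \<in> sets (rw_law V)"
proof -
  have "(\<lambda>x. x n) -` {j} \<inter> space (rw_law V) \<in> sets (rw_law V)"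
    by (rule measurable_sets[OF measurable_rw_coordinate]) simp
  then show ?thesis by (simp add: space_rw_law vimage_def)
qed

lemma sets_rw_cylinder: "{x. \<forall>k\<le>(n::nat). x k = y k} \<in> sets (rw_law V)"
proof -
  have "{x. \<forall>k\<le>n. x k = y k} = (\<Inter>k\<in>{..n}. {x. x k = y k})" by auto
  also have "\<dots> \<in> sets (rw_law V)"
    by (intro sets.finite_INT) (auto intro: sets_rw_position)
  finally show ?thesis .
qed

text \<open>The Markov property at time \<open>n\<close>: the law of the trajectory is only known through cylinders, so both
  events are split over the countably many initial trajectories of length \<open>n + 1\<close>.\<close>

lemma emeasure_rw_two_positions:
  "emeasure (rw_law V) {x. x n = i \<and> x (Suc n) = j} =
    emeasure (rw_law V) {x. x n = i} * ennreal (pmf (rw_step V i) j)"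
proof -
  define I where "I = {ys :: int list. length ys = Suc n \<and> ys ! n = i}"
  define C where "C = (\<lambda>ys :: int list. {x. \<forall>k\<le>n. x k = ys ! k})"
  define D where "D = (\<lambda>ys :: int list. {x. \<forall>k\<le>Suc n. x k = (ys @ [j]) ! k})"
  have cI: "countable I" by simp
  have inj: "ys = zs" if "ys \<in> I" "zs \<in> I" "\<forall>k\<le>n. ys ! k = zs ! k" for ys zs
    using that by (intro nth_equalityI) (auto simp: I_def)
  have dC: "disjoint_family_on C I"
    unfolding disjoint_family_on_def
  proof (intro ballI impI)
    fix ys zs assume *: "ys \<in> I" "zs \<in> I" "ys \<noteq> zs"
    show "C ys \<inter> C zs = {}"
    proof (rule ccontr)
      assume "C ys \<inter> C zs \<noteq> {}"
      then obtain x where "x \<in> C ys" "x \<in> C zs" by blast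
      then have "\<forall>k\<le>n. ys ! k = zs ! k" by (simp add: C_def)
      then show False using inj * by blast
    qed
  qed
  have UC: "{x. x n = i} = (\<Union>ys\<in>I. C ys)"
  proof (intro set_eqI iffI)
    fix x :: "nat \<Rightarrow> int" assume "x \<in> {x. x n = i}"
    then have "map x [0..<Suc n] \<in> I" "x \<in> C (map x [0..<Suc n])"
      by (auto simp: I_def C_def simp del: upt_Suc)
    then show "x \<in> (\<Union>ys\<in>I. C ys)" by blast
  qed (auto simp: I_def C_def)
  have nthD: "(ys @ [j]) ! k = (if k \<le> n then ys ! k else j)" if "ys \<in> I" "k \<le> Suc n" for ys k
    using that by (auto simp: I_def nth_append)
  have DC: "D ys \<subseteq> C ys" if "ys \<in> I" for ys
    using nthD[OF that] by (auto simp: C_def D_def)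
  have dD: "disjoint_family_on D I"
    using dC DC unfolding disjoint_family_on_def by blast
  have UD: "{x. x n = i \<and> x (Suc n) = j} = (\<Union>ys\<in>I. D ys)"
  proof (intro set_eqI iffI)
    fix x :: "nat \<Rightarrow> int" assume x: "x \<in> {x. x n = i \<and> x (Suc n) = j}"
    have 1: "map x [0..<Suc n] \<in> I" using x by (auto simp: I_def simp del: upt_Suc)
    have "x \<in> D (map x [0..<Suc n])"
      unfolding D_def using x nthD[OF 1] by (auto simp del: upt_Suc simp: le_Suc_eq nth_append)
    then show "x \<in> (\<Union>ys\<in>I. D ys)" using 1 by blast
  next
    fix x assume "x \<in> (\<Union>ys\<in>I. D ys)"
    then obtain ys where ys: "ys \<in> I" "\<forall>k\<le>Suc n. x k = (ys @ [j]) ! k" by (auto simp: D_def)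
    then show "x \<in> {x. x n = i \<and> x (Suc n) = j}"
      using nthD[OF ys(1), of n] nthD[OF ys(1), of "Suc n"] by (auto simp: I_def)
  qed
  have step: "emeasure (rw_law V) (D ys) = emeasure (rw_law V) (C ys) * ennreal (pmf (rw_step V i) j)"
    if "ys \<in> I" for ys
  proof -
    have "(\<Prod>k<Suc n. ennreal (pmf (rw_step V ((ys @ [j]) ! k)) ((ys @ [j]) ! Suc k)))
      = (\<Prod>k<n. ennreal (pmf (rw_step V (ys ! k)) (ys ! Suc k))) * ennreal (pmf (rw_step V i) j)"
      using that nthD[OF that] by (auto simp: I_def intro!: prod.cong)
    moreover have "(ys @ [j]) ! 0 = ys ! 0" using nthD[OF that, of 0] by simp
    ultimately show ?thesis
      unfolding D_def C_def emeasure_rw_law by simp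
  qed
  have "emeasure (rw_law V) {x. x n = i \<and> x (Suc n) = j} = (\<integral>\<^sup>+ys. emeasure (rw_law V) (D ys) \<partial>count_space I)"
    unfolding UD by (rule emeasure_UN_countable[OF _ cI dD]) (auto simp: D_def intro: sets_rw_cylinder)
  also have "\<dots> = (\<integral>\<^sup>+ys. emeasure (rw_law V) (C ys) * ennreal (pmf (rw_step V i) j) \<partial>count_space I)"
    by (intro nn_integral_cong) (simp add: step)
  also have "\<dots> = (\<integral>\<^sup>+ys. emeasure (rw_law V) (C ys) \<partial>count_space I) * ennreal (pmf (rw_step V i) j)"
    by (rule nn_integral_multc) simp
  also have "(\<integral>\<^sup>+ys. emeasure (rw_law V) (C ys) \<partial>count_space I) = emeasure (rw_law V) {x. x n = i}"
    unfolding UC by (rule emeasure_UN_countable[OF _ cI dC, symmetric]) (auto simp: C_def intro: sets_rw_cylinder)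
  finally show ?thesis .
qed

lemma emeasure_rw_position: "emeasure (rw_law V) {x. x n = j} = ennreal (pmf (position_pmf V n) j)"
proof (induction n arbitrary: j)
  case 0
  have "{x. x 0 = j} = {x :: nat \<Rightarrow> int. \<forall>i\<le>(0::nat). x i = (\<lambda>_. j) i}" by auto
  then show ?case by (simp only: emeasure_rw_law) (simp add: indicator_def)
next
  case (Suc n)
  have "{x. x (Suc n) = j} = (\<Union>i\<in>UNIV. {x. x n = i \<and> x (Suc n) = j})" by auto
  also have "emeasure (rw_law V) \<dots> =
      (\<integral>\<^sup>+i. emeasure (rw_law V) {x. x n = i \<and> x (Suc n) = j} \<partial>count_space UNIV)"
  proof (rule emeasure_UN_countable)
    show "{x. x n = i \<and> x (Suc n) = j} \<in> sets (rw_law V)" for i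
      using sets.Int[OF sets_rw_position[of n i V] sets_rw_position[of "Suc n" j V]]
      by (simp add: Collect_conj_eq)
  qed (auto simp: disjoint_family_on_def)
  also have "\<dots> = (\<integral>\<^sup>+i. ennreal (pmf (position_pmf V n) i) * ennreal (pmf (rw_step V i) j) \<partial>count_space UNIV)"
    by (simp add: emeasure_rw_two_positions Suc.IH)
  also have "\<dots> = ennreal (pmf (position_pmf V (Suc n)) j)"
    by (simp add: ennreal_pmf_bind nn_integral_measure_pmf)
  finally show ?case .
qed

text \<open>The resistance between the origin and \<open>j\<close> in the network whose edge from \<open>i\<close> to \<open>i + 1\<close> has resistance
  \<open>exp (V i)\<close>; by symmetry it depends on \<open>\<bar>j\<bar>\<close> only.\<close>

definition resistance_from_origin :: "(nat \<Rightarrow> real) \<Rightarrow> int \<Rightarrow> ennreal" where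
  "resistance_from_origin d j = (\<Sum>i<nat \<bar>j\<bar>. ennreal (exp (sym_potential d (int i))))"

lemma nn_integral_rw_step:
  "(\<integral>\<^sup>+k. g k \<partial>measure_pmf (rw_step V i)) =
    ennreal (1 / (1 + exp (V i - V (i - 1)))) * g (i + 1)
    + ennreal (exp (V i - V (i - 1)) / (1 + exp (V i - V (i - 1)))) * g (i - 1)"
proof -
  define p where "p = 1 / (1 + exp (V i - V (i - 1)))"
  have p: "0 \<le> p" "p \<le> 1" by (auto simp: p_def field_simps add_pos_pos)
  have q: "1 - p = exp (V i - V (i - 1)) / (1 + exp (V i - V (i - 1)))"
    unfolding p_def using add_pos_pos[OF zero_less_one exp_gt_zero, of "V i - V (i - 1)"]
    by (auto simp: field_simps)
  show ?thesis unfolding q[symmetric] p_def[symmetric]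
    using p by (simp add: rw_step_def p_def[symmetric] add.commute mult.commute)
qed

text \<open>The resistance from the origin is a martingale along the walk until it returns to the origin. At the origin both neighbours have
  resistance \<open>exp (V 0) = 1\<close>, so each visit raises the mean by exactly \<open>1\<close>.\<close>

lemma resistance_harmonic:
  fixes d :: "nat \<Rightarrow> real"
  shows "(\<integral>\<^sup>+k. resistance_from_origin d k \<partial>measure_pmf (rw_step (sym_potential d) j)) =
    resistance_from_origin d j + (if j = 0 then 1 else 0)"
proof -
  let ?V = "sym_potential d"
  let ?S = "\<lambda>n. \<Sum>i<n. exp (?V (int i))"
  have R: "resistance_from_origin d j = ennreal (?S (nat \<bar>j\<bar>))" for j
    by (simp add: resistance_from_origin_def sum_ennreal)
  have S0: "0 \<le> ?S n" for n by (simp add: sum_nonneg)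
  define \<Delta> where "\<Delta> = ?V j - ?V (j - 1)"
  have e: "exp \<Delta> > 0" "1 + exp \<Delta> > 0" by (auto intro: add_pos_pos)
  have "1 / (1 + exp \<Delta>) * ?S (nat \<bar>j + 1\<bar>) + exp \<Delta> / (1 + exp \<Delta>) * ?S (nat \<bar>j - 1\<bar>)
      = ?S (nat \<bar>j\<bar>) + (if j = 0 then 1 else 0)"
  proof -
    consider "j = 0" | m where "j = int (Suc m)" | m where "j = - int (Suc m)"
      by (metis int_cases not0_implies_Suc of_nat_0 int_cases2)
    then have "?S (nat \<bar>j + 1\<bar>) + exp \<Delta> * ?S (nat \<bar>j - 1\<bar>) = (1 + exp \<Delta>) * (?S (nat \<bar>j\<bar>) + (if j = 0 then 1 else 0))"
    proof cases
      case 1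
      then have "\<Delta> = 0" using sym_potential_reflect[of d 0] by (simp add: \<Delta>_def)
      then show ?thesis using 1 by (simp add: sym_potential_0)
    next
      case 2
      then have n: "nat \<bar>j + 1\<bar> = Suc (Suc m)" "nat \<bar>j\<bar> = Suc m" "nat \<bar>j - 1\<bar> = m" by auto
      have "?V j = ?V (int m) + \<Delta>" by (simp add: \<Delta>_def 2)
      then have "exp (?V (int (Suc m))) = exp (?V (int m)) * exp \<Delta>" by (simp add: 2 exp_add)
      then show ?thesis unfolding n using 2 by (simp add: algebra_simps)
    next
      case 3
      then have n: "nat \<bar>j + 1\<bar> = m" "nat \<bar>j\<bar> = Suc m" "nat \<bar>j - 1\<bar> = Suc (Suc m)" by auto
      have "?V j = ?V (int m)" "?V (j - 1) = ?V (int (Suc m))"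
        using sym_potential_reflect[of d "int m"] sym_potential_reflect[of d "int (Suc m)"]
        by (auto simp: 3 algebra_simps minus_diff_commute[symmetric] diff_diff_eq)
      then have "?V (int m) = ?V (int (Suc m)) + \<Delta>" by (simp add: \<Delta>_def)
      then have "exp (?V (int m)) = exp (?V (int (Suc m))) * exp \<Delta>" by (simp add: exp_add)
      then show ?thesis unfolding n using 3 by (simp add: algebra_simps)
    qed
    then have "(?S (nat \<bar>j + 1\<bar>) + exp \<Delta> * ?S (nat \<bar>j - 1\<bar>)) / (1 + exp \<Delta>) = ?S (nat \<bar>j\<bar>) + (if j = 0 then 1 else 0)"
      using e by (simp add: field_simps)
    then show ?thesis by (simp add: add_divide_distrib)
  qed
  then have "ennreal (1 / (1 + exp \<Delta>) * ?S (nat \<bar>j + 1\<bar>) + exp \<Delta> / (1 + exp \<Delta>) * ?S (nat \<bar>j - 1\<bar>))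
      = ennreal (?S (nat \<bar>j\<bar>) + (if j = 0 then 1 else 0))" by simp
  moreover have "(if j = 0 then 1 else 0 :: ennreal) = ennreal (if j = 0 then 1 else 0)" by simp
  ultimately show ?thesis
    unfolding nn_integral_rw_step R \<Delta>_def[symmetric]
    using e S0 by (simp add: ennreal_plus[symmetric] ennreal_mult[symmetric] del: sum_ennreal ennreal_plus)
qed

text \<open>Summing the increments: the mean of the resistance at time \<open>n\<close> counts the visits before time \<open>n\<close>.\<close>

lemma resistance_at_time:
  "(\<integral>\<^sup>+k. resistance_from_origin d k \<partial>measure_pmf (position_pmf (sym_potential d) n)) =
    (\<Sum>m<n. ennreal (pmf (position_pmf (sym_potential d) m) 0))"
proof (induction n)
  case 0
  then show ?case by (simp add: resistance_from_origin_def)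
next
  case (Suc n)
  have "(\<integral>\<^sup>+k. resistance_from_origin d k \<partial>measure_pmf (position_pmf (sym_potential d) (Suc n)))
    = (\<integral>\<^sup>+j. resistance_from_origin d j + indicator {0} j \<partial>measure_pmf (position_pmf (sym_potential d) n))"
    by (auto simp: nn_integral_bind_pmf resistance_harmonic intro!: nn_integral_cong split: split_indicator)
  also have "\<dots> = (\<integral>\<^sup>+j. resistance_from_origin d j \<partial>measure_pmf (position_pmf (sym_potential d) n))
      + ennreal (pmf (position_pmf (sym_potential d) n) 0)"
    by (subst nn_integral_add) (auto simp: emeasure_pmf_single)
  finally show ?case by (simp add: Suc.IH)
qed

text \<open>From any site the origin is reached with positive probability in a fixed number of steps, so the mass
  at a site is controlled by a later mass at the origin.\<close>

lemma pmf_position_return: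
  "\<exists>c>0. \<forall>n. c * pmf (position_pmf V n) j \<le> pmf (position_pmf V (n + nat \<bar>j\<bar>)) 0"
proof (induction "nat \<bar>j\<bar>" arbitrary: j)
  case 0
  then show ?case by (intro exI[of _ 1]) auto
next
  case (Suc m)
  define i where "i = (if j > 0 then j - 1 else j + 1)"
  have m: "m = nat \<bar>i\<bar>" "nat \<bar>j\<bar> = Suc (nat \<bar>i\<bar>)" using Suc(2) by (auto simp: i_def)
  obtain c where c: "c > 0" "\<And>n. c * pmf (position_pmf V n) i \<le> pmf (position_pmf V (n + nat \<bar>i\<bar>)) 0"
    using Suc(1)[OF m(1)] by blast
  define q where "q = pmf (rw_step V j) i"
  have q: "q > 0"
  proof -
    have "0 < 1 / (1 + e) \<and> 1 / (1 + e) < 1" if "e > 0" for e :: real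
      using that by (simp add: divide_less_eq)
    from this[of "exp (V j - V (j - 1))"]
    have "0 < 1 / (1 + exp (V j - V (j - 1)))" "1 / (1 + exp (V j - V (j - 1))) < 1"
      by simp_all
    then show ?thesis using pmf_rw_step[of V j] by (auto simp: q_def i_def)
  qed
  have st: "q * pmf (position_pmf V n) j \<le> pmf (position_pmf V (Suc n)) i" for n
  proof -
    have "ennreal (q * pmf (position_pmf V n) j) = (\<integral>\<^sup>+k. ennreal q * indicator {j} k \<partial>measure_pmf (position_pmf V n))"
      using q by (simp add: nn_integral_cmult_indicator emeasure_pmf_single ennreal_mult)
    also have "\<dots> \<le> (\<integral>\<^sup>+k. ennreal (pmf (rw_step V k) i) \<partial>measure_pmf (position_pmf V n))"
      by (intro nn_integral_mono) (auto simp: q_def split: split_indicator)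
    also have "\<dots> = ennreal (pmf (position_pmf V (Suc n)) i)" by (simp add: ennreal_pmf_bind)
    finally show ?thesis by simp
  qed
  show ?case
  proof (intro exI[of _ "c * q"] conjI allI)
    fix n
    have "c * q * pmf (position_pmf V n) j \<le> c * pmf (position_pmf V (Suc n)) i"
      using st[of n] c(1) by (simp add: mult.assoc)
    also have "\<dots> \<le> pmf (position_pmf V (Suc n + nat \<bar>i\<bar>)) 0" by (rule c(2))
    finally show "c * q * pmf (position_pmf V n) j \<le> pmf (position_pmf V (n + nat \<bar>j\<bar>)) 0"
      using m by simp
  qed (use c q in auto)
qed

lemma resistance_from_origin_le: "resistance_from_origin d j \<le> (\<Sum>i. ennreal (exp (sym_potential d (int i))))"
  unfolding resistance_from_origin_def by (rule sum_le_suminf) auto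

text \<open>The mean of the resistance at time \<open>n\<close> is at most the total resistance, which bounds the Green
  function from above. Conversely, a finite Green function forces the mass to leave every finite set, and
  then the mean resistance exceeds, in the limit, the resistance to any given distance.\<close>

theorem green_function_eq_resistance:
  "(\<Sum>n. ennreal (pmf (position_pmf (sym_potential d) n) 0)) = (\<Sum>i. ennreal (exp (sym_potential d (int i))))"
    (is "?G = ?R")
proof (rule antisym)
  let ?p = "position_pmf (sym_potential d)"
  show "?G \<le> ?R"
    unfolding suminf_eq_SUP
  proof (rule SUP_least)
    fix n
    have "(\<Sum>m<n. ennreal (pmf (?p m) 0)) \<le> (\<integral>\<^sup>+k. ?R \<partial>measure_pmf (?p n))"
      unfolding resistance_at_time[symmetric] by (intro nn_integral_mono resistance_from_origin_le)
    then show "(\<Sum>m<n. ennreal (pmf (?p m) 0)) \<le> (SUP n. \<Sum>i<n. ennreal (exp (sym_potential d (int i))))"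
      by (simp add: suminf_eq_SUP measure_pmf.emeasure_space_1[simplified])
  qed
  show "?R \<le> ?G"
  proof (cases "?G = \<infinity>")
    case False
    then have "summable (\<lambda>n. pmf (?p n) 0)" by (intro summable_suminf_not_top) auto
    then have lim0: "(\<lambda>n. pmf (?p n) 0) \<longlonglongrightarrow> 0" by (rule summable_LIMSEQ_zero)
    have limj: "(\<lambda>n. pmf (?p n) j) \<longlonglongrightarrow> 0" for j
    proof -
      obtain c where c: "c > 0" "\<And>n. c * pmf (?p n) j \<le> pmf (?p (n + nat \<bar>j\<bar>)) 0"
        using pmf_position_return[of "sym_potential d" j] by blast
      have "(\<lambda>n. pmf (?p (n + nat \<bar>j\<bar>)) 0 / c) \<longlonglongrightarrow> 0 / c"
        by (rule tendsto_divide[OF LIMSEQ_ignore_initial_segment[OF lim0] tendsto_const]) (use c in auto)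
      then have lim: "(\<lambda>n. pmf (?p (n + nat \<bar>j\<bar>)) 0 / c) \<longlonglongrightarrow> 0" by simp
      have le: "pmf (?p n) j \<le> pmf (?p (n + nat \<bar>j\<bar>)) 0 / c" for n
        using c(1) c(2)[of n] by (simp add: field_simps)
      show ?thesis
      proof (rule tendsto_sandwich)
        show "\<forall>\<^sub>F n in sequentially. 0 \<le> pmf (?p n) j" by simp
        show "\<forall>\<^sub>F n in sequentially. pmf (?p n) j \<le> pmf (?p (n + nat \<bar>j\<bar>)) 0 / c"
          by (rule always_eventually) (use le in blast)
        show "(\<lambda>n. pmf (?p (n + nat \<bar>j\<bar>)) 0 / c) \<longlonglongrightarrow> 0" by (rule lim)
      qed (rule tendsto_const)
    qed
    show ?thesis
      unfolding suminf_eq_SUP[of "\<lambda>i. ennreal (exp (sym_potential d (int i)))"]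
    proof (rule SUP_least)
      fix m :: nat
      define S where "S = (\<Sum>i<m. exp (sym_potential d (int i)))"
      have S0: "S \<ge> 0" by (simp add: S_def sum_nonneg)
      let ?J = "{- int m..int m}"
      have "ennreal (S * (1 - (\<Sum>j\<in>?J. pmf (?p n) j))) \<le> ?G" for n
      proof -
        have "1 - (\<Sum>j\<in>?J. pmf (?p n) j) = measure (measure_pmf (?p n)) (- ?J)"
          using measure_pmf.prob_compl[of ?J "?p n"] by (simp add: measure_measure_pmf_finite Compl_eq_Diff_UNIV)
        then have "ennreal (S * (1 - (\<Sum>j\<in>?J. pmf (?p n) j))) = (\<integral>\<^sup>+k. ennreal S * indicator (- ?J) k \<partial>measure_pmf (?p n))"
          using S0 by (simp add: nn_integral_cmult_indicator measure_pmf.emeasure_eq_measure ennreal_mult)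
        also have "\<dots> \<le> (\<integral>\<^sup>+k. resistance_from_origin d k \<partial>measure_pmf (?p n))"
        proof (intro nn_integral_mono)
          fix k :: int
          have "m \<le> nat \<bar>k\<bar>" if "k \<notin> ?J" using that by auto
          then show "ennreal S * indicator (- ?J) k \<le> resistance_from_origin d k"
            unfolding S_def resistance_from_origin_def
            by (auto simp: sum_ennreal[symmetric] split: split_indicator simp del: sum_ennreal intro!: sum_mono2)
        qed
        also have "\<dots> \<le> ?G" unfolding resistance_at_time by (rule sum_le_suminf) auto
        finally show ?thesis .
      qed
      moreover have "(\<lambda>n. S * (1 - (\<Sum>j\<in>?J. pmf (?p n) j))) \<longlonglongrightarrow> S * (1 - (\<Sum>j\<in>?J. 0))"
        by (intro tendsto_intros limj)
      then have "(\<lambda>n. ennreal (S * (1 - (\<Sum>j\<in>?J. pmf (?p n) j)))) \<longlonglongrightarrow> ennreal S"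
        by (simp add: tendsto_ennrealI)
      ultimately have "ennreal S \<le> ?G" by (intro LIMSEQ_le_const2[of _ "ennreal S"]) auto
      then show "(\<Sum>i<m. ennreal (exp (sym_potential d (int i)))) \<le> ?G"
        by (simp add: S_def sum_ennreal)
    qed
  qed auto
qed

lemma measurable_visits [measurable]: "visits \<in> borel_measurable (rw_law V)"
  and visits_eq_sum: "visits x = (\<Sum>n. indicator {x. x n = 0} x)"
proof -
  show *: "visits x = (\<Sum>n. indicator {x. x n = 0} x)" for x
  proof -
    have "visits x = (\<integral>\<^sup>+n. indicator {n. x n = 0} n \<partial>count_space UNIV)"
      by (simp add: visits_def)
    also have "\<dots> = (\<Sum>n. indicator {n. x n = 0} n)" by (rule nn_integral_count_space_nat)
    finally show ?thesis by (simp add: indicator_def)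
  qed
  show "visits \<in> borel_measurable (rw_law V)"
    unfolding * using sets_rw_position by measurable
qed

theorem mean_visits_rw_law:
  "(\<integral>\<^sup>+y. visits y \<partial>rw_law (sym_potential d)) = (\<Sum>i. ennreal (exp (sym_potential d (int i))))"
proof -
  have "(\<integral>\<^sup>+y. visits y \<partial>rw_law (sym_potential d))
      = (\<Sum>n. \<integral>\<^sup>+y. indicator {x. x n = 0} y \<partial>rw_law (sym_potential d))"
    unfolding visits_eq_sum using sets_rw_position by (intro nn_integral_suminf) measurable
  also have "\<dots> = (\<Sum>n. ennreal (pmf (position_pmf (sym_potential d) n) 0))"
    by (simp add: sets_rw_position emeasure_rw_position)
  finally show ?thesis by (simp add: green_function_eq_resistance)
qed

lemma visits_finite:
  assumes "(\<integral>\<^sup>+y. visits y \<partial>rw_law V) < \<infinity>"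
  shows "emeasure (rw_law V) {y. visits y < \<infinity>} = 1"
proof -
  have "AE y in rw_law V. visits y \<noteq> \<infinity>"
    using assms by (intro nn_integral_noteq_infinite) auto
  then have "AE y in rw_law V. y \<in> {y. visits y < \<infinity>}" by (simp add: less_top)
  moreover have "{y \<in> space (rw_law V). visits y < \<infinity>} \<in> sets (rw_law V)" by measurable
  ultimately show ?thesis
    using prob_space.emeasure_eq_1_AE[OF prob_space_rw_law] by (simp add: space_rw_law)
qed

section \<open>Slowly varying functions grow slower than any power\<close>

text \<open>The uniform convergence theorem for slowly varying functions in additive notation. For large \<open>x\<close> the
  set \<open>E x\<close> of bad shifts in \<open>{0..2}\<close> has measure less than \<open>1 / 2\<close>. For \<open>c \<le> 1\<close> the bad sets of \<open>x\<close>
  and \<open>x + c\<close> cannot cover \<open>{c..2}\<close> together, so some point \<open>x + t\<close> is close in value to both \<open>x\<close> and \<open>x + c\<close>.\<close>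

lemma additive_uniform_convergence:
  fixes g :: "real \<Rightarrow> real"
  assumes [measurable]: "g \<in> borel_measurable borel"
    and lim: "\<And>y. ((\<lambda>x. g (x + y) - g x) \<longlongrightarrow> 0) at_top"
    and "0 < \<epsilon>"
  obtains X where "\<And>x c. X \<le> x \<Longrightarrow> 0 \<le> c \<Longrightarrow> c \<le> 1 \<Longrightarrow> \<bar>g (x + c) - g x\<bar> < \<epsilon>"
proof -
  define E where "E x = {t \<in> {0..2}. \<epsilon> / 2 \<le> \<bar>g (x + t) - g x\<bar>}" for x
  have E_sets [measurable]: "E x \<in> sets borel" for x unfolding E_def by measurable
  have "((\<lambda>x. LINT t|lborel. indicator (E x) t) \<longlongrightarrow> (LINT t|(lborel::real measure). (0::real))) at_top"
  proof (rule integral_dominated_convergence_at_top[where w = "indicator {0..2}"])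
    show "integrable lborel (indicator {0..2::real} :: real \<Rightarrow> real)"
      by (intro integrable_real_indicator) auto
    show "\<forall>\<^sub>F x in at_top. AE t in lborel. norm (indicator (E x) t :: real) \<le> indicator {0..2} t"
      by (auto simp: E_def split: split_indicator)
    show "AE t in lborel. ((\<lambda>x. indicator (E x) t :: real) \<longlongrightarrow> 0) at_top"
    proof (rule AE_I2)
      fix t :: real
      have "\<forall>\<^sub>F x in at_top. \<bar>g (x + t) - g x\<bar> < \<epsilon> / 2"
        using tendstoD[OF lim[of t], of "\<epsilon> / 2"] \<open>0 < \<epsilon>\<close> by simp
      then have "\<forall>\<^sub>F x in at_top. (indicator (E x) t :: real) = 0"
        by eventually_elim (auto simp: E_def)
      then show "((\<lambda>x. indicator (E x) t :: real) \<longlongrightarrow> 0) at_top"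
        by (rule tendsto_eventually)
    qed
  qed auto
  then have "((\<lambda>x. measure lborel (E x)) \<longlongrightarrow> 0) at_top" by simp
  then have "\<forall>\<^sub>F x in at_top. measure lborel (E x) < 1 / 2"
    by (rule order_tendstoD) simp
  then obtain X where X: "\<And>x. X \<le> x \<Longrightarrow> measure lborel (E x) < 1 / 2"
    unfolding eventually_at_top_linorder by blast
  have "\<bar>g (x + c) - g x\<bar> < \<epsilon>" if x: "X \<le> x" and c: "0 \<le> c" "c \<le> 1" for x c
  proof -
    have fin: "E y \<in> lmeasurable" for y
      by (rule fmeasurableI2[of "{0..2}"]) (auto simp: E_def intro: sets_completionI_sets E_sets[unfolded E_def])
    have tr: "(+) c ` E (x + c) \<in> lmeasurable"
      by (intro measurable_translation fin)
    have m: "measure lebesgue (E y) = measure lborel (E y)" for y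
      by (intro measure_completion) (use E_sets in simp)
    have "\<exists>t\<in>{c..2}. t \<notin> E x \<and> t \<notin> (+) c ` E (x + c)"
    proof (rule ccontr)
      assume "\<not> ?thesis"
      then have "{c..2} \<subseteq> E x \<union> (+) c ` E (x + c)" by blast
      then have "measure lebesgue {c..2} \<le> measure lebesgue (E x \<union> (+) c ` E (x + c))"
        by (intro measure_mono_fmeasurable fmeasurable.Un fin tr) auto
      also have "\<dots> \<le> measure lebesgue (E x) + measure lebesgue ((+) c ` E (x + c))"
        by (intro measure_Un_le fmeasurableD fin tr)
      also have "\<dots> < 1 / 2 + 1 / 2"
        unfolding measure_translation m using X[OF x] X[of "x + c"] x c by simp
      finally show False using c by simp
    qed
    then obtain t where t: "c \<le> t" "t \<le> 2" "t \<notin> E x" "t \<notin> (+) c ` E (x + c)" by auto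
    have "t - c \<notin> E (x + c)" using t(4) by (metis add.commute diff_add_cancel image_eqI)
    then have "\<bar>g (x + t) - g (x + c)\<bar> < \<epsilon> / 2" using t c by (auto simp: E_def)
    moreover have "\<bar>g (x + t) - g x\<bar> < \<epsilon> / 2" using t c by (auto simp: E_def)
    ultimately show ?thesis by linarith
  qed
  then show thesis by (rule that)
qed

text \<open>Increments over unit intervals are eventually at most \<open>\<epsilon> / 2\<close>, uniformly, so they add up to at most half
  of the slope \<open>\<epsilon>\<close> and the remaining half absorbs the constant.\<close>

lemma additive_sublinear:
  fixes g :: "real \<Rightarrow> real"
  assumes "g \<in> borel_measurable borel"
    and "\<And>y. ((\<lambda>x. g (x + y) - g x) \<longlongrightarrow> 0) at_top"
    and "0 < \<epsilon>"
  shows "\<forall>\<^sub>F x in at_top. \<bar>g x\<bar> \<le> \<epsilon> * x"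
proof -
  obtain X where X: "\<And>x c. X \<le> x \<Longrightarrow> 0 \<le> c \<Longrightarrow> c \<le> 1 \<Longrightarrow> \<bar>g (x + c) - g x\<bar> < \<epsilon> / 2"
    using additive_uniform_convergence[OF assms(1,2), of "\<epsilon> / 2"] \<open>0 < \<epsilon>\<close> by auto
  have steps: "\<bar>g (X + real n)\<bar> \<le> \<bar>g X\<bar> + real n * (\<epsilon> / 2)" for n
  proof (induction n)
    case (Suc n)
    have "\<bar>g (X + real n + 1) - g (X + real n)\<bar> < \<epsilon> / 2" by (rule X) auto
    then have "\<bar>g (X + real n + 1)\<bar> \<le> \<bar>g X\<bar> + real n * (\<epsilon> / 2) + \<epsilon> / 2" using Suc by linarith
    then show ?case by (simp add: algebra_simps add_divide_distrib)
  qed simp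
  have bound: "\<bar>g x\<bar> \<le> \<bar>g X\<bar> + (x - X + 1) * (\<epsilon> / 2)" if "X \<le> x" for x
  proof -
    define n where "n = nat \<lfloor>x - X\<rfloor>"
    have n: "real n \<le> x - X" "x - X \<le> real n + 1" using that by (auto simp: n_def)
    have "\<bar>g (X + real n + (x - X - real n)) - g (X + real n)\<bar> < \<epsilon> / 2" by (rule X) (use n in auto)
    then have "\<bar>g x - g (X + real n)\<bar> < \<epsilon> / 2" by simp
    then have "\<bar>g x\<bar> \<le> \<bar>g (X + real n)\<bar> + \<epsilon> / 2" by linarith
    also have "\<dots> \<le> \<bar>g X\<bar> + (real n + 1) * (\<epsilon> / 2)" using steps[of n] by (simp add: algebra_simps add_divide_distrib)
    also have "\<dots> \<le> \<bar>g X\<bar> + (x - X + 1) * (\<epsilon> / 2)"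
      using n \<open>0 < \<epsilon>\<close> by (intro add_left_mono mult_right_mono) auto
    finally show ?thesis .
  qed
  define Y where "Y = max X (2 * (\<bar>g X\<bar> + (1 - X) * (\<epsilon> / 2)) / \<epsilon>)"
  show ?thesis
    unfolding eventually_at_top_linorder
  proof (intro exI[of _ Y] allI impI)
    fix x assume x: "Y \<le> x"
    then have "2 * (\<bar>g X\<bar> + (1 - X) * (\<epsilon> / 2)) / \<epsilon> \<le> x" by (simp add: Y_def)
    then have "\<bar>g X\<bar> + (1 - X) * (\<epsilon> / 2) \<le> x * \<epsilon> / 2"
      using \<open>0 < \<epsilon>\<close> by (simp add: pos_divide_le_eq algebra_simps)
    moreover have "\<bar>g x\<bar> \<le> \<bar>g X\<bar> + (1 - X) * (\<epsilon> / 2) + x * \<epsilon> / 2"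
      using bound[of x] x by (simp add: Y_def algebra_simps add_divide_distrib diff_divide_distrib)
    ultimately show "\<bar>g x\<bar> \<le> \<epsilon> * x" by (simp add: mult.commute)
  qed
qed

text \<open>In the logarithmic scale \<open>g x = ln (L (exp x))\<close>, slow variation says that increments of \<open>g\<close> vanish
  at infinity.\<close>

lemma slowly_varying_bounds:
  assumes L: "slowly_varying L" and "0 < s"
  shows "\<forall>\<^sub>F x in at_top. x powr (- s) \<le> L x \<and> L x \<le> x powr s"
proof -
  define g where "g x = ln (L (exp x))" for x
  have "(\<lambda>x. indicator {0<..} x *\<^sub>R L x) \<in> borel_measurable borel"
    using L by (simp add: slowly_varying_def set_borel_measurable_def)
  then have "(\<lambda>x. indicator {0<..} (exp x :: real) *\<^sub>R L (exp x)) \<in> borel_measurable borel"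
    by (rule measurable_compose[rotated]) simp
  then have "(\<lambda>x. L (exp x)) \<in> borel_measurable borel" by simp
  then have meas: "g \<in> borel_measurable borel" unfolding g_def by measurable
  have pos: "\<forall>\<^sub>F x in at_top. 0 < L x" using L by (simp add: slowly_varying_def)
  have exp_top: "filterlim (exp :: real \<Rightarrow> real) at_top at_top" by (rule exp_at_top)
  have pos': "\<forall>\<^sub>F x in at_top. 0 < L (exp x)"
    using eventually_compose_filterlim[OF pos exp_top] .
  have lim: "((\<lambda>x. g (x + y) - g x) \<longlongrightarrow> 0) at_top" for y
  proof -
    have "((\<lambda>x. L (exp y * x) / L x) \<longlongrightarrow> 1) at_top"
      using L by (simp add: slowly_varying_def)
    then have "((\<lambda>x. L (exp y * exp x) / L (exp x)) \<longlongrightarrow> 1) at_top"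
      by (rule filterlim_compose[OF _ exp_top])
    then have "((\<lambda>x. ln (L (exp y * exp x) / L (exp x))) \<longlongrightarrow> ln 1) at_top"
      by (intro tendsto_ln) auto
    then have l: "((\<lambda>x. ln (L (exp y * exp x) / L (exp x))) \<longlongrightarrow> 0) at_top" by simp
    have "filterlim (\<lambda>x. x + y) at_top at_top"
      using filterlim_tendsto_add_at_top[OF tendsto_const filterlim_ident, of y] by (simp add: add.commute)
    from eventually_compose_filterlim[OF pos' this]
    have "\<forall>\<^sub>F x in at_top. 0 < L (exp (x + y))" .
    with pos' have "\<forall>\<^sub>F x in at_top. ln (L (exp y * exp x) / L (exp x)) = g (x + y) - g x"
      by eventually_elim (simp add: g_def ln_div exp_add mult.commute)
    then show ?thesis using l by (simp add: tendsto_cong)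
  qed
  have "\<forall>\<^sub>F x in at_top. \<bar>g x\<bar> \<le> s * x"
    by (rule additive_sublinear[OF meas lim \<open>0 < s\<close>])
  then have "\<forall>\<^sub>F x in at_top. \<bar>g (ln x)\<bar> \<le> s * ln x"
    by (rule eventually_compose_filterlim[OF _ ln_at_top])
  then show ?thesis
    using pos eventually_gt_at_top[of 0]
  proof eventually_elim
    case (elim x)
    have "- (s * ln x) \<le> ln (L x)" "ln (L x) \<le> s * ln x" using elim by (auto simp: g_def)
    then have "exp (- (s * ln x)) \<le> L x" "L x \<le> exp (s * ln x)"
      using elim by (metis exp_le_cancel_iff exp_ln)+
    then show ?case using elim by (simp add: powr_def)
  qed
qed

section \<open>Renewal path sums in a fixed environment\<close>

text \<open>Real powers on \<open>[0, \<infinity>]\<close>. The value at \<open>\<top>\<close> is \<open>\<top>\<close>, which is the right convention only for positive exponents.\<close>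

definition epow :: "real \<Rightarrow> ennreal \<Rightarrow> ennreal" where
  "epow \<gamma> x = (if x = \<top> then \<top> else ennreal (enn2real x powr \<gamma>))"

lemma epow_ennreal: "0 \<le> x \<Longrightarrow> epow \<gamma> (ennreal x) = ennreal (x powr \<gamma>)"
  by (simp add: epow_def)

lemma epow_top [simp]: "epow \<gamma> \<top> = \<top>" by (simp add: epow_def)

lemma epow_0 [simp]: "epow \<gamma> 0 = 0" by (simp add: epow_def)

lemma epow_1 [simp]: "epow \<gamma> 1 = 1" by (simp add: epow_def)

lemma measurable_epow [measurable]: "epow \<gamma> \<in> borel_measurable borel"
  unfolding epow_def by measurable

lemma epow_mono:
  assumes "0 < \<gamma>" "x \<le> y" shows "epow \<gamma> x \<le> epow \<gamma> y"
  using assms by (cases x; cases y) (auto simp: epow_def top_unique intro!: ennreal_leI powr_mono2)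

lemma epow_mult:
  shows "epow \<gamma> (x * y) = epow \<gamma> x * epow \<gamma> y"
proof -
  consider "x = 0 \<or> y = 0" | "x \<noteq> 0" "y \<noteq> 0" "x = \<top> \<or> y = \<top>" | "x \<noteq> \<top>" "y \<noteq> \<top>" by blast
  then show ?thesis
  proof cases
    case 1
    then show ?thesis by auto
  next
    case 2
    have "epow \<gamma> z \<noteq> 0" if "z \<noteq> 0" for z
      using that by (cases z) (simp_all add: epow_ennreal ennreal_eq_0_iff)
    then have "epow \<gamma> x \<noteq> 0" "epow \<gamma> y \<noteq> 0" using 2 by blast+
    with 2 show ?thesis by (elim disjE) (simp_all add: ennreal_mult_top ennreal_top_mult)
  next
    case 3
    then show ?thesis
      by (cases x; cases y) (simp_all add: epow_ennreal powr_mult flip: ennreal_mult)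
  qed
qed

lemma epow_power: "epow \<gamma> (x ^ n) = epow \<gamma> x ^ n"
  by (induction n) (auto simp: epow_mult)

lemma epow_epow_inverse:
  assumes "0 < \<gamma>" shows "epow (1 / \<gamma>) (epow \<gamma> x) = x"
  using assms by (cases x) (auto simp: epow_ennreal powr_powr)

lemma epow_le_iff:
  assumes "0 < \<gamma>" shows "epow \<gamma> x \<le> y \<longleftrightarrow> x \<le> epow (1 / \<gamma>) y"
proof
  assume "epow \<gamma> x \<le> y"
  then have "epow (1 / \<gamma>) (epow \<gamma> x) \<le> epow (1 / \<gamma>) y" using assms by (intro epow_mono) auto
  then show "x \<le> epow (1 / \<gamma>) y" by (simp add: epow_epow_inverse assms)
next
  assume "x \<le> epow (1 / \<gamma>) y"
  then have "epow \<gamma> x \<le> epow \<gamma> (epow (1 / \<gamma>) y)" using assms by (intro epow_mono) auto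
  then show "epow \<gamma> x \<le> y" using epow_epow_inverse[of "1 / \<gamma>" y] assms by simp
qed

lemma powr_subadditive:
  fixes x y \<gamma> :: real
  assumes "0 \<le> x" "0 \<le> y" "0 < \<gamma>" "\<gamma> \<le> 1"
  shows "(x + y) powr \<gamma> \<le> x powr \<gamma> + y powr \<gamma>"
proof (cases "x + y = 0")
  case False
  then have s: "0 < x + y" using assms by simp
  have le: "z / (x + y) \<le> (z / (x + y)) powr \<gamma>" if "0 \<le> z" "z \<le> x + y" for z
  proof (cases "z = 0")
    case False
    then have "(z / (x + y)) powr 1 \<le> (z / (x + y)) powr \<gamma>"
      using assms that s by (intro powr_mono') auto
    then show ?thesis using that s by simp
  qed simp
  have "1 = x / (x + y) + y / (x + y)" using s by (simp add: add_divide_distrib[symmetric])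
  also have "\<dots> \<le> (x / (x + y)) powr \<gamma> + (y / (x + y)) powr \<gamma>"
    using assms by (intro add_mono le) auto
  also have "\<dots> = (x powr \<gamma> + y powr \<gamma>) / (x + y) powr \<gamma>"
    using assms s by (simp add: powr_divide add_divide_distrib)
  finally show ?thesis using s by (simp add: field_simps)
next
  case True
  then show ?thesis by simp
qed

context
  fixes \<gamma> :: real assumes \<gamma>: "0 < \<gamma>" "\<gamma> \<le> 1"
begin

lemma epow_add_le: "epow \<gamma> (x + y) \<le> epow \<gamma> x + epow \<gamma> y"
proof (cases "x = \<top> \<or> y = \<top>")
  case False
  then show ?thesis
    using powr_subadditive[OF _ _ \<gamma>]
    by (cases x; cases y) (auto simp: epow_ennreal ennreal_plus[symmetric] ennreal_leI simp del: ennreal_plus)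
qed auto

lemma epow_sum_le: "epow \<gamma> (sum f A) \<le> (\<Sum>i\<in>A. epow \<gamma> (f i))"
proof (induction A rule: infinite_finite_induct)
  case (insert a A)
  have "epow \<gamma> (sum f (insert a A)) \<le> epow \<gamma> (f a) + epow \<gamma> (sum f A)"
    using insert by (simp add: epow_add_le)
  also have "\<dots> \<le> epow \<gamma> (f a) + (\<Sum>i\<in>A. epow \<gamma> (f i))" by (intro add_left_mono insert)
  finally show ?case using insert by simp
qed auto

text \<open>Subadditivity is what makes powers \<open>\<gamma> \<le> 1\<close> suitable for sums over paths. The infinite case follows
  from the finite one because the inverse power moves to the right-hand side.\<close>

lemma epow_suminf_le: "epow \<gamma> (\<Sum>i. f i) \<le> (\<Sum>i. epow \<gamma> (f i))"
  unfolding epow_le_iff[OF \<gamma>(1)] suminf_eq_SUP[of f]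
proof (rule SUP_least)
  fix n
  have "epow \<gamma> (sum f {..<n}) \<le> (\<Sum>i<n. epow \<gamma> (f i))" by (rule epow_sum_le)
  also have "\<dots> \<le> (\<Sum>i. epow \<gamma> (f i))" by (rule sum_le_suminf) auto
  finally show "sum f {..<n} \<le> epow (1 / \<gamma>) (\<Sum>i. epow \<gamma> (f i))"
    using epow_le_iff[OF \<gamma>(1)] by blast
qed

end

text \<open>The environment \<open>e\<close> records in \<open>e i\<close> the weight of a contact at site \<open>i + 1\<close>, as seen from a
  contact at site \<open>0\<close>; after a jump to site \<open>n\<close> it is seen shifted by \<open>n\<close>.\<close>

definition env_shift :: "nat \<Rightarrow> (nat \<Rightarrow> ennreal) \<Rightarrow> nat \<Rightarrow> ennreal" where
  "env_shift n e = (\<lambda>i. e (i + n))"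

lemma env_shift_0 [simp]: "env_shift 0 e = e" by (simp add: env_shift_def)

lemma env_shift_shift [simp]: "env_shift m (env_shift n e) = env_shift (m + n) e"
  by (simp add: env_shift_def add.assoc)

lemma env_shift_apply: "env_shift n e i = e (i + n)" by (simp add: env_shift_def)

text \<open>The transfer operator: jump from a contact at \<open>0\<close> to the next contact at \<open>Suc r\<close>, collect its weight, and
  evaluate \<open>g\<close> in the environment seen from there. Its powers applied to \<open>1\<close> sum the weights of all
  paths with a given number of contacts.\<close>

definition step_op :: "(nat \<Rightarrow> ennreal) \<Rightarrow> ((nat \<Rightarrow> ennreal) \<Rightarrow> ennreal) \<Rightarrow> (nat \<Rightarrow> ennreal) \<Rightarrow> ennreal" where
  "step_op \<kappa> g e = (\<Sum>r. \<kappa> (Suc r) * e r * g (env_shift (Suc r) e))"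

text \<open>The total weight of all renewal paths from \<open>0\<close> that have a contact at \<open>n\<close>, by the first jump.\<close>

fun pinned_pf :: "(nat \<Rightarrow> ennreal) \<Rightarrow> nat \<Rightarrow> (nat \<Rightarrow> ennreal) \<Rightarrow> ennreal" where
  "pinned_pf \<kappa> 0 e = 1"
| "pinned_pf \<kappa> (Suc n) e = (\<Sum>r\<le>n. \<kappa> (Suc r) * e r * pinned_pf \<kappa> (n - r) (env_shift (Suc r) e))"

text \<open>The part of \<open>pinned_pf \<kappa> n\<close> that comes from paths with exactly \<open>k\<close> jumps.\<close>

fun pinned_pf_steps :: "(nat \<Rightarrow> ennreal) \<Rightarrow> nat \<Rightarrow> nat \<Rightarrow> (nat \<Rightarrow> ennreal) \<Rightarrow> ennreal" where
  "pinned_pf_steps \<kappa> 0 n e = (if n = 0 then 1 else 0)"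
| "pinned_pf_steps \<kappa> (Suc k) n e = (\<Sum>r<n. \<kappa> (Suc r) * e r * pinned_pf_steps \<kappa> k (n - Suc r) (env_shift (Suc r) e))"

abbreviation contact_sum :: "(nat \<Rightarrow> ennreal) \<Rightarrow> nat \<Rightarrow> (nat \<Rightarrow> ennreal) \<Rightarrow> ennreal" where
  "contact_sum \<kappa> k \<equiv> (step_op \<kappa> ^^ k) (\<lambda>_. 1)"

lemma step_op_add: "step_op \<kappa> (\<lambda>e. f e + g e) e = step_op \<kappa> f e + step_op \<kappa> g e"
  unfolding step_op_def by (subst suminf_add) (auto simp: distrib_left)

lemma step_op_kernel_add: "step_op (\<lambda>r. \<kappa> r + \<kappa>' r) f e = step_op \<kappa> f e + step_op \<kappa>' f e"
  unfolding step_op_def by (subst suminf_add) (auto simp: distrib_right)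

lemma step_op_zero: "step_op \<kappa> (\<lambda>_. 0) e = 0" by (simp add: step_op_def)

lemma step_op_sum: "step_op \<kappa> (\<lambda>e. \<Sum>i\<in>A. f i e) e = (\<Sum>i\<in>A. step_op \<kappa> (f i) e)"
  by (induction A rule: infinite_finite_induct) (auto simp: step_op_add step_op_zero)

lemma suminf_commute_ennreal: "(\<Sum>i. \<Sum>j. f i j) = (\<Sum>j. \<Sum>i. f i j :: ennreal)" for f :: "nat \<Rightarrow> nat \<Rightarrow> ennreal"
  using nn_integral_suminf[of "\<lambda>j i. f i j" "count_space UNIV"]
  by (simp add: nn_integral_count_space_nat)

lemma pinned_pf_steps_eq_0: "(\<And>r. m < r \<Longrightarrow> \<kappa> r = 0) \<Longrightarrow> k * m < n \<Longrightarrow> pinned_pf_steps \<kappa> k n e = 0"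
proof (induction k arbitrary: n e)
  case (Suc k)
  have "\<kappa> (Suc r) * e r * pinned_pf_steps \<kappa> k (n - Suc r) (env_shift (Suc r) e) = 0" if "r < n" for r
  proof (cases "m < Suc r")
    case False
    then have "k * m < n - Suc r" using Suc.prems(2) by simp
    then show ?thesis using Suc by simp
  qed (use Suc in simp)
  then show ?case by simp
qed simp

lemma pinned_pf_steps_le_pinned_pf:
  assumes "\<And>r. \<kappa>' r \<le> c * \<kappa> r" shows "pinned_pf_steps \<kappa>' k n e \<le> c ^ k * pinned_pf \<kappa> n e"
proof (induction k arbitrary: n e)
  case (Suc k)
  show ?case
  proof (cases n)
    case (Suc m)
    have "pinned_pf_steps \<kappa>' (Suc k) n e \<le> (\<Sum>r<n. c * \<kappa> (Suc r) * e r * (c ^ k * pinned_pf \<kappa> (n - Suc r) (env_shift (Suc r) e)))"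
      by (simp del: pinned_pf.simps, intro sum_mono mult_mono assms Suc.IH order_refl) auto
    also have "\<dots> = c ^ Suc k * pinned_pf \<kappa> n e"
      unfolding Suc lessThan_Suc_atMost by (simp add: sum_distrib_left mult_ac)
    finally show ?thesis .
  qed simp
qed auto

text \<open>For jumps of length at most \<open>m\<close>, the endpoint of \<open>k\<close> jumps takes finitely many values. Each summand is a
  product of two factors that see disjoint parts of the environment.\<close>

lemma step_op_power_eq:
  assumes "\<And>r. m < r \<Longrightarrow> \<kappa> r = 0"
  shows "(step_op \<kappa> ^^ k) g e = (\<Sum>n\<le>k * m. pinned_pf_steps \<kappa> k n e * g (env_shift n e))"
proof (induction k arbitrary: e)
  case (Suc k)
  have ext: "(\<Sum>n\<le>k * m. pinned_pf_steps \<kappa> k n e * g (env_shift n e)) = (\<Sum>n. pinned_pf_steps \<kappa> k n e * g (env_shift n e))" for k e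
    using pinned_pf_steps_eq_0[OF assms] by (intro suminf_finite[symmetric]) (auto simp: not_le)
  have IH: "(step_op \<kappa> ^^ k) g e = (\<Sum>n. pinned_pf_steps \<kappa> k n e * g (env_shift n e))" for e
    by (rule trans[OF Suc.IH ext])
  have "(step_op \<kappa> ^^ Suc k) g e =
      (\<Sum>r. \<Sum>n. \<kappa> (Suc r) * e r * (pinned_pf_steps \<kappa> k n (env_shift (Suc r) e) * g (env_shift (n + Suc r) e)))"
    by (simp add: step_op_def IH)
  also have "\<dots> = (\<Sum>r. \<Sum>n. if r < n then \<kappa> (Suc r) * e r * pinned_pf_steps \<kappa> k (n - Suc r) (env_shift (Suc r) e) * g (env_shift n e) else 0)"
  proof (rule suminf_cong)
    fix r
    let ?h = "\<lambda>n. if r < n then \<kappa> (Suc r) * e r * pinned_pf_steps \<kappa> k (n - Suc r) (env_shift (Suc r) e) * g (env_shift n e) else 0"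
    have "(\<Sum>n. ?h n) = (\<Sum>n. ?h (n + Suc r)) + (\<Sum>n<Suc r. ?h n)"
      by (rule suminf_offset) simp
    also have "(\<Sum>n<Suc r. ?h n) = 0" by (intro sum.neutral) auto
    finally show "(\<Sum>n. \<kappa> (Suc r) * e r * (pinned_pf_steps \<kappa> k n (env_shift (Suc r) e) * g (env_shift (n + Suc r) e))) = (\<Sum>n. ?h n)"
      by (simp add: mult_ac)
  qed
  also have "\<dots> = (\<Sum>n. \<Sum>r. if r < n then \<kappa> (Suc r) * e r * pinned_pf_steps \<kappa> k (n - Suc r) (env_shift (Suc r) e) * g (env_shift n e) else 0)"
    by (rule suminf_commute_ennreal)
  also have "\<dots> = (\<Sum>n. pinned_pf_steps \<kappa> (Suc k) n e * g (env_shift n e))"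
  proof (intro suminf_cong)
    fix n
    show "(\<Sum>r. if r < n then \<kappa> (Suc r) * e r * pinned_pf_steps \<kappa> k (n - Suc r) (env_shift (Suc r) e) * g (env_shift n e) else 0)
        = pinned_pf_steps \<kappa> (Suc k) n e * g (env_shift n e)"
      by (subst suminf_finite[of "{..<n}"]) (auto simp: sum_distrib_right)
  qed
  also have "\<dots> = (\<Sum>n\<le>Suc k * m. pinned_pf_steps \<kappa> (Suc k) n e * g (env_shift n e))" by (rule ext[symmetric])
  finally show ?case .
qed simp

text \<open>Paths with jumps of two kinds, split at the first jump of the second kind.\<close>

lemma step_op_split_power:
  "(step_op (\<lambda>r. \<kappa> r + \<kappa>' r) ^^ k) g e = (step_op \<kappa> ^^ k) g e +
    (\<Sum>j<k. (step_op \<kappa> ^^ j) (step_op \<kappa>' ((step_op (\<lambda>r. \<kappa> r + \<kappa>' r) ^^ (k - Suc j)) g)) e)"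
proof (induction k arbitrary: e)
  case (Suc k)
  let ?T = "step_op (\<lambda>r. \<kappa> r + \<kappa>' r)"
  have "(?T ^^ Suc k) g e = step_op \<kappa> ((?T ^^ k) g) e + step_op \<kappa>' ((?T ^^ k) g) e"
    by (simp add: step_op_kernel_add)
  also have "(?T ^^ k) g = (\<lambda>e. (step_op \<kappa> ^^ k) g e +
    (\<Sum>j<k. (step_op \<kappa> ^^ j) (step_op \<kappa>' ((?T ^^ (k - Suc j)) g)) e))" using Suc.IH by blast
  also have "step_op \<kappa> \<dots> e = (step_op \<kappa> ^^ Suc k) g e +
    (\<Sum>j<k. (step_op \<kappa> ^^ Suc j) (step_op \<kappa>' ((?T ^^ (k - Suc j)) g)) e)"
    by (simp add: step_op_add step_op_sum)
  finally show ?case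
    unfolding Suc.IH[symmetric] by (simp add: sum.lessThan_Suc_shift add_ac del: sum.lessThan_Suc)
qed simp

text \<open>Concatenating a path to \<open>n\<close> and a path from \<open>n\<close> gives a path with a contact at \<open>n\<close>.\<close>

lemma pinned_pf_superadditive: "pinned_pf \<kappa> n e * pinned_pf \<kappa> m (env_shift n e) \<le> pinned_pf \<kappa> (n + m) e"
proof (induction n arbitrary: e rule: less_induct)
  case (less n)
  show ?case
  proof (cases n)
    case (Suc k)
    have IH: "pinned_pf \<kappa> (k - r) (env_shift (Suc r) e) * pinned_pf \<kappa> m (env_shift n e) \<le> pinned_pf \<kappa> (k - r + m) (env_shift (Suc r) e)"
      if "r \<le> k" for r
      using less.IH[of "k - r" "env_shift (Suc r) e"] that Suc by simp
    have "pinned_pf \<kappa> n e * pinned_pf \<kappa> m (env_shift n e) =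
      (\<Sum>r\<le>k. \<kappa> (Suc r) * e r * (pinned_pf \<kappa> (k - r) (env_shift (Suc r) e) * pinned_pf \<kappa> m (env_shift n e)))"
      by (simp add: Suc sum_distrib_right mult.assoc)
    also have "\<dots> \<le> (\<Sum>r\<le>k. \<kappa> (Suc r) * e r * pinned_pf \<kappa> (k - r + m) (env_shift (Suc r) e))"
      by (intro sum_mono mult_left_mono IH) auto
    also have "\<dots> = (\<Sum>r\<le>k. \<kappa> (Suc r) * e r * pinned_pf \<kappa> (k + m - r) (env_shift (Suc r) e))"
      by (intro sum.cong) auto
    also have "\<dots> \<le> pinned_pf \<kappa> (n + m) e"
      unfolding Suc add_Suc pinned_pf.simps by (intro sum_mono2) auto
    finally show ?thesis .
  qed simp
qed

lemma pinned_pf_one_jump: "0 < r \<Longrightarrow> \<kappa> r * e (r - 1) \<le> pinned_pf \<kappa> r e"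
proof -
  assume "0 < r"
  then obtain k where k: "r = Suc k" by (cases r) auto
  have "\<kappa> (Suc k) * e k * pinned_pf \<kappa> (k - k) (env_shift (Suc k) e) \<le> pinned_pf \<kappa> (Suc k) e"
    unfolding pinned_pf.simps by (rule member_le_sum) auto
  then show ?thesis by (simp add: k)
qed

lemma pinned_pf_cong: "(\<And>i. i < n \<Longrightarrow> e i = e' i) \<Longrightarrow> pinned_pf \<kappa> n e = pinned_pf \<kappa> n e'"
proof (induction n arbitrary: e e' rule: less_induct)
  case (less n)
  show ?case
  proof (cases n)
    case (Suc k)
    have "pinned_pf \<kappa> (k - r) (env_shift (Suc r) e) = pinned_pf \<kappa> (k - r) (env_shift (Suc r) e')" if "r \<le> k" for r
      using that Suc by (intro less.IH) (auto simp: env_shift_apply intro: less.prems)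
    then show ?thesis using less.prems Suc by (auto intro!: sum.cong)
  qed simp
qed

lemma pinned_pf_steps_cong: "(\<And>i. i < n \<Longrightarrow> e i = e' i) \<Longrightarrow> pinned_pf_steps \<kappa> k n e = pinned_pf_steps \<kappa> k n e'"
proof (induction k arbitrary: n e e')
  case (Suc k)
  have "pinned_pf_steps \<kappa> k (n - Suc r) (env_shift (Suc r) e) = pinned_pf_steps \<kappa> k (n - Suc r) (env_shift (Suc r) e')" if "r < n" for r
    using that by (intro Suc.IH) (auto simp: env_shift_apply intro: Suc.prems)
  then show ?case using Suc.prems by (auto intro!: sum.cong)
qed simp

section \<open>Fractional moments in an i.i.d. environment\<close>

text \<open>The law \<open>S\<close> of an environment with independent weights of common law \<open>M\<close>.\<close>

locale iid_weights = sequence_space M for M :: "ennreal measure" +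
  assumes sets_M [measurable_cong]: "sets M = sets borel"
begin

lemma space_M [simp]: "space M = UNIV"
  using sets_eq_imp_space_eq[OF sets_M] by simp

lemma space_S [simp]: "space S = UNIV"
  by (simp add: space_PiM)

lemma measurable_coordinate [measurable]: "(\<lambda>e. e i) \<in> borel_measurable S"
proof -
  have "(\<lambda>e. e i) \<in> S \<rightarrow>\<^sub>M M" by (rule measurable_component_singleton) simp
  then show ?thesis by (simp add: measurable_cong_sets[OF refl sets_M])
qed

lemma measurable_env_shift [measurable]: "env_shift n \<in> S \<rightarrow>\<^sub>M S"
  unfolding env_shift_def by (rule measurable_PiM_single') auto

lemma measurable_step_op [measurable]:
  assumes [measurable]: "g \<in> borel_measurable S"
  shows "step_op \<kappa> g \<in> borel_measurable S"
  unfolding step_op_def by measurable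

lemma measurable_step_op_power [measurable]:
  assumes [measurable]: "g \<in> borel_measurable S"
  shows "(step_op \<kappa> ^^ k) g \<in> borel_measurable S"
  by (induction k) auto

lemma measurable_pinned_pf [measurable]: "pinned_pf \<kappa> n \<in> borel_measurable S"
proof (induction n rule: less_induct)
  case (less n)
  show ?case
  proof (cases n)
    case 0
    then show ?thesis by (simp add: pinned_pf.simps(1)[abs_def])
  next
    case (Suc k)
    have [measurable]: "pinned_pf \<kappa> (k - r) \<in> borel_measurable S" if "r \<in> {..k}" for r
      by (rule less) (use Suc that in auto)
    show ?thesis unfolding Suc pinned_pf.simps[abs_def] by measurable
  qed
qed

lemma measurable_pinned_pf_steps [measurable]: "pinned_pf_steps \<kappa> k n \<in> borel_measurable S"
proof (induction k arbitrary: n)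
  case 0
  then show ?case by (simp add: pinned_pf_steps.simps[abs_def])
next
  case (Suc k)
  note [measurable] = Suc
  show ?case unfolding pinned_pf_steps.simps[abs_def] by measurable
qed

text \<open>Independence of the first \<open>n\<close> sites from the environment seen from \<open>n\<close>, together with stationarity. The proof glues
  two independent environments at site \<open>n\<close>, which does not change the law.\<close>

lemma nn_integral_split:
  assumes [measurable]: "g \<in> borel_measurable S" "h \<in> borel_measurable S"
    and dep: "\<And>e e'. (\<And>i. i < n \<Longrightarrow> e i = e' i) \<Longrightarrow> g e = g e'"
  shows "(\<integral>\<^sup>+e. g e * h (env_shift n e) \<partial>S) = (\<integral>\<^sup>+e. g e \<partial>S) * (\<integral>\<^sup>+e. h e \<partial>S)"
proof -
  have "(\<integral>\<^sup>+e. g e * h (env_shift n e) \<partial>S) =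
      (\<integral>\<^sup>+e. g e * h (env_shift n e) \<partial>distr (S \<Otimes>\<^sub>M S) S (\<lambda>(\<omega>, \<omega>'). comb_seq n \<omega> \<omega>'))"
    by (simp add: PiM_comb_seq)
  also have "\<dots> = (\<integral>\<^sup>+p. g (comb_seq n (fst p) (snd p)) * h (env_shift n (comb_seq n (fst p) (snd p))) \<partial>(S \<Otimes>\<^sub>M S))"
    by (subst nn_integral_distr) (auto simp: split_beta')
  also have "\<dots> = (\<integral>\<^sup>+p. g (fst p) * h (snd p) \<partial>(S \<Otimes>\<^sub>M S))"
  proof (rule nn_integral_cong)
    fix p
    have "g (comb_seq n (fst p) (snd p)) = g (fst p)" by (rule dep) (simp add: comb_seq_less)
    moreover have "env_shift n (comb_seq n (fst p) (snd p)) = snd p"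
      by (simp add: env_shift_def comb_seq_add)
    ultimately show "g (comb_seq n (fst p) (snd p)) * h (env_shift n (comb_seq n (fst p) (snd p))) = g (fst p) * h (snd p)"
      by simp
  qed
  also have "\<dots> = (\<integral>\<^sup>+\<omega>. \<integral>\<^sup>+\<omega>'. g \<omega> * h \<omega>' \<partial>S \<partial>S)"
    by (subst P.nn_integral_fst[symmetric]) auto
  also have "\<dots> = (\<integral>\<^sup>+e. g e \<partial>S) * (\<integral>\<^sup>+e. h e \<partial>S)"
    by (simp add: nn_integral_cmult nn_integral_multc)
  finally show ?thesis .
qed

lemma nn_integral_env_shift:
  assumes "h \<in> borel_measurable S"
  shows "(\<integral>\<^sup>+e. h (env_shift n e) \<partial>S) = (\<integral>\<^sup>+e. h e \<partial>S)"
  using nn_integral_split[of "\<lambda>_. 1" h n] assms by (simp add: P.emeasure_space_1[simplified])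

lemma nn_integral_coordinate:
  assumes [measurable]: "\<phi> \<in> borel_measurable borel"
  shows "(\<integral>\<^sup>+e. \<phi> (e i) \<partial>S) = (\<integral>\<^sup>+e. \<phi> (e 0) \<partial>S)"
  using nn_integral_env_shift[of "\<lambda>e. \<phi> (e 0)" i] by (simp add: env_shift_apply)

lemma nn_integral_step_op:
  assumes [measurable]: "g \<in> borel_measurable S"
  shows "(\<integral>\<^sup>+e. step_op \<kappa> g e \<partial>S) = (\<Sum>r. \<kappa> (Suc r)) * (\<integral>\<^sup>+e. e 0 \<partial>S) * (\<integral>\<^sup>+e. g e \<partial>S)"
proof -
  have "(\<integral>\<^sup>+e. step_op \<kappa> g e \<partial>S) = (\<Sum>r. \<integral>\<^sup>+e. (\<kappa> (Suc r) * e r) * g (env_shift (Suc r) e) \<partial>S)"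
    unfolding step_op_def by (rule nn_integral_suminf) auto
  also have "\<dots> = (\<Sum>r. \<kappa> (Suc r) * ((\<integral>\<^sup>+e. e 0 \<partial>S) * (\<integral>\<^sup>+e. g e \<partial>S)))"
  proof (rule suminf_cong)
    fix r
    have "(\<integral>\<^sup>+e. (\<kappa> (Suc r) * e r) * g (env_shift (Suc r) e) \<partial>S) = (\<integral>\<^sup>+e. \<kappa> (Suc r) * e r \<partial>S) * (\<integral>\<^sup>+e. g e \<partial>S)"
      by (rule nn_integral_split) auto
    also have "(\<integral>\<^sup>+e. \<kappa> (Suc r) * e r \<partial>S) = \<kappa> (Suc r) * (\<integral>\<^sup>+e. e r \<partial>S)"
      by (rule nn_integral_cmult) auto
    also have "(\<integral>\<^sup>+e. e r \<partial>S) = (\<integral>\<^sup>+e. e 0 \<partial>S)"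
      by (rule nn_integral_coordinate[of "\<lambda>x. x"]) auto
    finally show "(\<integral>\<^sup>+e. (\<kappa> (Suc r) * e r) * g (env_shift (Suc r) e) \<partial>S) =
        \<kappa> (Suc r) * ((\<integral>\<^sup>+e. e 0 \<partial>S) * (\<integral>\<^sup>+e. g e \<partial>S))" by (simp add: mult.assoc)
  qed
  finally show ?thesis by (simp add: mult.assoc)
qed

definition frac_moment :: "real \<Rightarrow> ((nat \<Rightarrow> ennreal) \<Rightarrow> ennreal) \<Rightarrow> ennreal" where
  "frac_moment \<gamma> g = (\<integral>\<^sup>+e. epow \<gamma> (g e) \<partial>S)"

context
  fixes \<gamma> :: real assumes \<gamma>: "0 < \<gamma>" "\<gamma> \<le> 1"
begin

lemma frac_moment_step_le:
  assumes [measurable]: "g \<in> borel_measurable S"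
  shows "frac_moment \<gamma> (step_op \<kappa> g) \<le>
    (\<Sum>r. epow \<gamma> (\<kappa> (Suc r))) * frac_moment \<gamma> (\<lambda>e. e 0) * frac_moment \<gamma> g"
proof -
  have "frac_moment \<gamma> (step_op \<kappa> g) \<le>
      (\<integral>\<^sup>+e. (\<Sum>r. epow \<gamma> (\<kappa> (Suc r)) * epow \<gamma> (e r) * epow \<gamma> (g (env_shift (Suc r) e))) \<partial>S)"
    unfolding frac_moment_def step_op_def
    by (intro nn_integral_mono order_trans[OF epow_suminf_le[OF \<gamma>]]) (simp add: epow_mult)
  also have "\<dots> = (\<Sum>r. \<integral>\<^sup>+e. (epow \<gamma> (\<kappa> (Suc r)) * epow \<gamma> (e r)) * epow \<gamma> (g (env_shift (Suc r) e)) \<partial>S)"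
    by (rule nn_integral_suminf) auto
  also have "\<dots> = (\<Sum>r. epow \<gamma> (\<kappa> (Suc r)) * (frac_moment \<gamma> (\<lambda>e. e 0) * frac_moment \<gamma> g))"
  proof (rule suminf_cong)
    fix r
    have "(\<integral>\<^sup>+e. (epow \<gamma> (\<kappa> (Suc r)) * epow \<gamma> (e r)) * epow \<gamma> (g (env_shift (Suc r) e)) \<partial>S)
        = (\<integral>\<^sup>+e. epow \<gamma> (\<kappa> (Suc r)) * epow \<gamma> (e r) \<partial>S) * (\<integral>\<^sup>+e. epow \<gamma> (g e) \<partial>S)"
      by (rule nn_integral_split) auto
    also have "(\<integral>\<^sup>+e. epow \<gamma> (\<kappa> (Suc r)) * epow \<gamma> (e r) \<partial>S) = epow \<gamma> (\<kappa> (Suc r)) * (\<integral>\<^sup>+e. epow \<gamma> (e r) \<partial>S)"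
      by (rule nn_integral_cmult) auto
    also have "(\<integral>\<^sup>+e. epow \<gamma> (e r) \<partial>S) = (\<integral>\<^sup>+e. epow \<gamma> (e 0) \<partial>S)"
      by (rule nn_integral_coordinate) auto
    finally show "(\<integral>\<^sup>+e. (epow \<gamma> (\<kappa> (Suc r)) * epow \<gamma> (e r)) * epow \<gamma> (g (env_shift (Suc r) e)) \<partial>S) =
        epow \<gamma> (\<kappa> (Suc r)) * (frac_moment \<gamma> (\<lambda>e. e 0) * frac_moment \<gamma> g)"
      by (simp add: frac_moment_def mult.assoc)
  qed
  finally show ?thesis by (simp add: mult.assoc)
qed

text \<open>Stretches of short jumps: sum over the endpoint, use independence, and bound each stretch by the
  full pinned partition function with the discount \<open>c\<close> per contact.\<close>

lemma frac_moment_power_le: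
  assumes [measurable]: "g \<in> borel_measurable S"
    and short: "\<And>r. m < r \<Longrightarrow> \<kappa>' r = 0"
    and dom: "\<And>r. \<kappa>' r \<le> c * \<kappa> r"
    and B: "\<And>n. frac_moment \<gamma> (pinned_pf \<kappa> n) \<le> b n"
  shows "frac_moment \<gamma> ((step_op \<kappa>' ^^ k) g) \<le> epow \<gamma> c ^ k * (\<Sum>n\<le>k * m. b n) * frac_moment \<gamma> g"
proof -
  have "frac_moment \<gamma> ((step_op \<kappa>' ^^ k) g) \<le>
      (\<integral>\<^sup>+e. (\<Sum>n\<le>k * m. epow \<gamma> (pinned_pf_steps \<kappa>' k n e) * epow \<gamma> (g (env_shift n e))) \<partial>S)"
    unfolding frac_moment_def
  proof (rule nn_integral_mono)
    fix e
    have "(step_op \<kappa>' ^^ k) g e = (\<Sum>n\<le>k * m. pinned_pf_steps \<kappa>' k n e * g (env_shift n e))"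
      using short by (rule step_op_power_eq)
    then show "epow \<gamma> ((step_op \<kappa>' ^^ k) g e) \<le> (\<Sum>n\<le>k * m. epow \<gamma> (pinned_pf_steps \<kappa>' k n e) * epow \<gamma> (g (env_shift n e)))"
      using epow_sum_le[OF \<gamma>, of "\<lambda>n. pinned_pf_steps \<kappa>' k n e * g (env_shift n e)" "{..k * m}"] by (simp add: epow_mult)
  qed
  also have "\<dots> = (\<Sum>n\<le>k * m. \<integral>\<^sup>+e. epow \<gamma> (pinned_pf_steps \<kappa>' k n e) * epow \<gamma> (g (env_shift n e)) \<partial>S)"
    by (rule nn_integral_sum) auto
  also have "\<dots> = (\<Sum>n\<le>k * m. frac_moment \<gamma> (pinned_pf_steps \<kappa>' k n) * frac_moment \<gamma> g)"
    unfolding frac_moment_def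
    by (intro sum.cong refl nn_integral_split) (auto intro!: arg_cong[where f="epow \<gamma>"] pinned_pf_steps_cong)
  also have "\<dots> \<le> (\<Sum>n\<le>k * m. (epow \<gamma> c ^ k * b n) * frac_moment \<gamma> g)"
  proof (intro sum_mono mult_right_mono)
    fix n
    have "frac_moment \<gamma> (pinned_pf_steps \<kappa>' k n) \<le> (\<integral>\<^sup>+e. epow \<gamma> c ^ k * epow \<gamma> (pinned_pf \<kappa> n e) \<partial>S)"
      unfolding frac_moment_def epow_power[symmetric] epow_mult[symmetric]
      by (intro nn_integral_mono epow_mono pinned_pf_steps_le_pinned_pf \<gamma> dom)
    also have "\<dots> \<le> epow \<gamma> c ^ k * b n"
      using B[of n] by (simp add: nn_integral_cmult frac_moment_def mult_left_mono)
    finally show "frac_moment \<gamma> (pinned_pf_steps \<kappa>' k n) \<le> epow \<gamma> c ^ k * b n" .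
  qed auto
  finally show ?thesis by (simp add: sum_distrib_left sum_distrib_right)
qed

lemma frac_moment_add_le:
  assumes [measurable]: "f \<in> borel_measurable S" "g \<in> borel_measurable S"
  shows "frac_moment \<gamma> (\<lambda>e. f e + g e) \<le> frac_moment \<gamma> f + frac_moment \<gamma> g"
  unfolding frac_moment_def
  by (subst nn_integral_add[symmetric]) (auto intro!: nn_integral_mono epow_add_le \<gamma>)

lemma frac_moment_sum_le:
  assumes [measurable]: "\<And>i. i \<in> A \<Longrightarrow> f i \<in> borel_measurable S"
  shows "frac_moment \<gamma> (\<lambda>e. \<Sum>i\<in>A. f i e) \<le> (\<Sum>i\<in>A. frac_moment \<gamma> (f i))"
  unfolding frac_moment_def
  by (subst nn_integral_sum[symmetric]) (auto intro!: nn_integral_mono epow_sum_le \<gamma>)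

lemma frac_moment_one: "frac_moment \<gamma> (\<lambda>_. 1) = 1"
  by (simp add: frac_moment_def P.emeasure_space_1[simplified])

text \<open>Short jumps follow \<open>\<kappa>1\<close>, long ones \<open>\<kappa>2\<close>. Splitting at the first long jump gives a renewal inequality for
  the fractional moments, with a stretch of \<open>j\<close> short jumps contributing \<open>a j\<close> and the long jump \<open>\<eta>\<close>. Since
  \<open>(\<Sum>j. a j) * \<eta> \<le> 1 / 2\<close>, the bound \<open>2 * D\<close> reproduces itself.\<close>

theorem frac_moment_renewal_bound:
  assumes short: "\<And>r. m < r \<Longrightarrow> \<kappa>1 r = 0"
    and dom: "\<And>r. \<kappa>1 r \<le> c * \<kappa> r"
    and B: "\<And>n. frac_moment \<gamma> (pinned_pf \<kappa> n) \<le> b n"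
    and D: "(\<Sum>k. epow \<gamma> c ^ k * (\<Sum>n\<le>k * m. b n)) \<le> D"
    and half: "D * ((\<Sum>r. epow \<gamma> (\<kappa>2 (Suc r))) * frac_moment \<gamma> (\<lambda>e. e 0)) \<le> 1 / 2"
  shows "frac_moment \<gamma> (contact_sum (\<lambda>r. \<kappa>1 r + \<kappa>2 r) k) \<le> 2 * D"
proof (induction k rule: less_induct)
  case (less k)
  let ?T = "step_op (\<lambda>r. \<kappa>1 r + \<kappa>2 r)"
  let ?F = "\<lambda>k. (?T ^^ k) (\<lambda>_. 1)"
  define a where "a k = epow \<gamma> c ^ k * (\<Sum>n\<le>k * m. b n)" for k
  define \<eta> where "\<eta> = (\<Sum>r. epow \<gamma> (\<kappa>2 (Suc r))) * frac_moment \<gamma> (\<lambda>e. e 0)"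
  have pw: "frac_moment \<gamma> ((step_op \<kappa>1 ^^ k) g) \<le> a k * frac_moment \<gamma> g"
    if "g \<in> borel_measurable S" for g k
    unfolding a_def by (rule frac_moment_power_le[OF that short dom B])
  have "frac_moment \<gamma> (?F k) \<le> frac_moment \<gamma> (contact_sum \<kappa>1 k) +
      frac_moment \<gamma> (\<lambda>e. \<Sum>j<k. (step_op \<kappa>1 ^^ j) (step_op \<kappa>2 (?F (k - Suc j))) e)"
    by (subst step_op_split_power[abs_def]) (rule frac_moment_add_le; measurable)
  also have "\<dots> \<le> a k + (\<Sum>j<k. frac_moment \<gamma> ((step_op \<kappa>1 ^^ j) (step_op \<kappa>2 (?F (k - Suc j)))))"
    using pw[of "\<lambda>_. 1" k] by (intro add_mono frac_moment_sum_le) (auto simp: frac_moment_one)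
  also have "\<dots> \<le> a k + (\<Sum>j<k. a j * (\<eta> * (2 * D)))"
  proof (intro add_left_mono sum_mono)
    fix j assume j: "j \<in> {..<k}"
    have "frac_moment \<gamma> ((step_op \<kappa>1 ^^ j) (step_op \<kappa>2 (?F (k - Suc j))))
        \<le> a j * frac_moment \<gamma> (step_op \<kappa>2 (?F (k - Suc j)))" by (rule pw) measurable
    also have "\<dots> \<le> a j * (\<eta> * frac_moment \<gamma> (?F (k - Suc j)))"
      unfolding \<eta>_def by (intro mult_left_mono frac_moment_step_le) auto
    also have "\<dots> \<le> a j * (\<eta> * (2 * D))"
      using j by (intro mult_left_mono less) auto
    finally show "frac_moment \<gamma> ((step_op \<kappa>1 ^^ j) (step_op \<kappa>2 (?F (k - Suc j)))) \<le> a j * (\<eta> * (2 * D))" .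
  qed
  also have "\<dots> = a k + (\<Sum>j<k. a j) * (\<eta> * (2 * D))" by (simp add: sum_distrib_right)
  also have "\<dots> \<le> D + D * (\<eta> * (2 * D))"
  proof (intro add_mono mult_right_mono)
    have "(\<Sum>j<k. a j) \<le> (\<Sum>j. a j)" for k by (rule sum_le_suminf) auto
    moreover have "a k \<le> (\<Sum>j<Suc k. a j)" by simp
    ultimately show "a k \<le> D" "(\<Sum>j<k. a j) \<le> D" using D unfolding a_def[symmetric]
      by (meson order_trans)+
  qed auto
  also have "D * (\<eta> * (2 * D)) = (D * \<eta>) * (2 * D)" by (simp add: mult_ac)
  also have "\<dots> \<le> (1 / 2) * (2 * D)" using half unfolding \<eta>_def by (intro mult_right_mono) auto
  also have "(1 / 2) * (2 * D) = D"
    by (simp add: mult.assoc[symmetric] ennreal_divide_times)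
  finally show ?case by (simp add: mult_2)
qed

end

end

section \<open>Zero free energy bounds the tails: the rare stretch argument\<close>

text \<open>A path that visits exactly the good blocks among the first \<open>N\<close>. Block \<open>i\<close> starts at site \<open>i * d\<close>, and \<open>y\<close> is
  the end of the last good block \<open>l\<close> so far. A jump over \<open>\<Delta>\<close> blocks costs \<open>(\<Delta> * d) powr - a\<close>; bounding
  \<open>\<Delta>\<close> by \<open>t * exp (\<Delta> / t)\<close> turns this into a fixed cost per good block and a cost \<open>a / t\<close> per
  block, which replaces an arithmetic-geometric mean inequality for the gaps.\<close>

lemma chain_of_good_blocks:
  fixes e :: "nat \<Rightarrow> ennreal" and c a \<eta> A t :: real and d n r0 :: nat
  defines "B \<equiv> c * (real d * t) powr (- a) * \<eta> * A"
  assumes kernel: "\<And>r. r0 \<le> r \<Longrightarrow> ennreal (c * real r powr (- a)) \<le> \<kappa> r"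
    and pos: "0 < c" "0 < a" "0 < \<eta>" "0 < A" "0 < t" "0 < r0" and d: "d = n + r0"
    and good: "\<And>i. 1 \<le> i \<Longrightarrow> G i \<Longrightarrow> ennreal \<eta> \<le> e (i * d - 1) \<and> ennreal A \<le> pinned_pf \<kappa> n (env_shift (i * d) e)"
  shows "\<exists>y l. l \<le> N \<and> l * d \<le> y \<and> y \<le> l * d + n \<and> card {i \<in> {1..N}. G i} \<le> l \<and>
    ennreal (B ^ card {i \<in> {1..N}. G i} * exp (- (a / t) * real l)) \<le> pinned_pf \<kappa> y e"
proof (induction N)
  case 0
  then show ?case by (intro exI[of _ 0]) auto
next
  case (Suc N)
  then obtain y l where l: "l \<le> N" "l * d \<le> y" "y \<le> l * d + n" "card {i \<in> {1..N}. G i} \<le> l"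
    and w: "ennreal (B ^ card {i \<in> {1..N}. G i} * exp (- (a / t) * real l)) \<le> pinned_pf \<kappa> y e" by blast
  define g where "g = card {i \<in> {1..N}. G i}"
  have split: "{i \<in> {1..Suc N}. G i} = (if G (Suc N) then insert (Suc N) {i \<in> {1..N}. G i} else {i \<in> {1..N}. G i})"
    by (auto simp: le_Suc_eq)
  show ?case
  proof (cases "G (Suc N)")
    case False
    then have eq: "{i \<in> {1..Suc N}. G i} = {i \<in> {1..N}. G i}" using split by simp
    show ?thesis unfolding eq by (rule exI[of _ y], rule exI[of _ l]) (use l w in simp)
  next
    case True
    have card: "card {i \<in> {1..Suc N}. G i} = Suc g"
      unfolding split g_def using True by simp
    have d0: "0 < d" using d pos by simp
    have B0: "0 \<le> B" using pos by (simp add: B_def)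
    define r where "r = Suc N * d - y"
    have "y + r0 \<le> Suc N * d"
    proof -
      have "y + r0 \<le> l * d + d" using l(3) d by simp
      also have "\<dots> \<le> Suc N * d" using l(1) by simp
      finally show ?thesis .
    qed
    then have r: "r0 \<le> r" "y + r = Suc N * d" by (auto simp: r_def)
    define \<Delta> where "\<Delta> = real (Suc N - l)"
    have \<Delta>: "0 < \<Delta>" using l(1) by (simp add: \<Delta>_def)
    have "r \<le> (Suc N - l) * d" using l(2) r(2) by (simp add: diff_mult_distrib)
    then have "real r \<le> \<Delta> * real d" unfolding \<Delta>_def by (metis of_nat_le_iff of_nat_mult)
    then have r_le: "(\<Delta> * real d) powr (- a) \<le> real r powr (- a)"
      using r pos by (intro powr_mono2') auto
    have "\<Delta> / t \<le> exp (\<Delta> / t)" using exp_ge_add_one_self[of "\<Delta> / t"] by linarith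
    then have "\<Delta> \<le> t * exp (\<Delta> / t)" using pos by (simp add: field_simps)
    then have "(t * exp (\<Delta> / t)) powr (- a) \<le> \<Delta> powr (- a)"
      using \<Delta> pos by (intro powr_mono2') auto
    then have "t powr (- a) * exp (- (a / t) * \<Delta>) \<le> \<Delta> powr (- a)"
      using pos by (simp add: powr_mult exp_powr_real) (simp add: mult_ac)
    then have "c * (real d powr (- a) * (t powr (- a) * exp (- (a / t) * \<Delta>))) \<le> c * (real d powr (- a) * \<Delta> powr (- a))"
      using pos by (intro mult_left_mono) auto
    also have "\<dots> = c * (\<Delta> * real d) powr (- a)" using \<Delta> by (simp add: powr_mult mult_ac)
    also have "\<dots> \<le> c * real r powr (- a)" using r_le pos by simp
    finally have jump: "c * (real d * t) powr (- a) * exp (- (a / t) * \<Delta>) \<le> c * real r powr (- a)"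
      using pos by (simp add: powr_mult mult_ac)
    have S: "Suc N * d - 1 = y + (r - 1)" using r pos by simp
    have gd: "ennreal \<eta> \<le> e (y + (r - 1))" "ennreal A \<le> pinned_pf \<kappa> n (env_shift (Suc N * d) e)"
      using good[of "Suc N"] True unfolding S by auto
    have "ennreal (c * (real d * t) powr (- a) * exp (- (a / t) * \<Delta>)) * ennreal \<eta> \<le> \<kappa> r * e (y + (r - 1))"
    proof (rule mult_mono)
      show "ennreal (c * (real d * t) powr (- a) * exp (- (a / t) * \<Delta>)) \<le> \<kappa> r"
        using ennreal_leI[OF jump] kernel[OF r(1)] by (rule order_trans)
    qed (use gd in auto)
    also have "\<dots> \<le> pinned_pf \<kappa> r (env_shift y e)"
      using pinned_pf_one_jump[of r \<kappa> "env_shift y e"] r pos by (simp add: env_shift_apply add.commute)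
    finally have j2: "ennreal (c * (real d * t) powr (- a) * exp (- (a / t) * \<Delta>)) * ennreal \<eta> \<le> pinned_pf \<kappa> r (env_shift y e)" .
    have "ennreal (B ^ g * exp (- (a / t) * real l)) * (ennreal (c * (real d * t) powr (- a) * exp (- (a / t) * \<Delta>)) * ennreal \<eta>) * ennreal A
        \<le> pinned_pf \<kappa> y e * pinned_pf \<kappa> r (env_shift y e) * pinned_pf \<kappa> n (env_shift (y + r) e)"
      using w j2 gd(2) unfolding g_def r(2) by (intro mult_mono) auto
    also have "\<dots> \<le> pinned_pf \<kappa> (y + r) e * pinned_pf \<kappa> n (env_shift (y + r) e)"
      by (intro mult_right_mono pinned_pf_superadditive) auto
    also have "\<dots> \<le> pinned_pf \<kappa> (y + r + n) e" by (rule pinned_pf_superadditive)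
    finally have "ennreal (B ^ g * exp (- (a / t) * real l)) * (ennreal (c * (real d * t) powr (- a) * exp (- (a / t) * \<Delta>)) * ennreal \<eta>) * ennreal A
        \<le> pinned_pf \<kappa> (Suc N * d + n) e" unfolding r(2) .
    moreover have "B ^ Suc g * exp (- (a / t) * real (Suc N)) =
        B ^ g * exp (- (a / t) * real l) * (c * (real d * t) powr (- a) * exp (- (a / t) * \<Delta>) * \<eta>) * A"
    proof -
      have "real (Suc N) = real l + \<Delta>" using l(1) by (simp add: \<Delta>_def of_nat_diff)
      then have "exp (- (a / t) * real (Suc N)) = exp (- (a / t) * real l) * exp (- (a / t) * \<Delta>)"
        by (simp add: exp_add[symmetric] algebra_simps)
      moreover have "B ^ Suc g = B ^ g * (c * (real d * t) powr (- a) * \<eta> * A)" by (simp add: B_def)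
      ultimately show ?thesis by (simp only: mult_ac)
    qed
    moreover have "ennreal (X * (Y * \<eta>) * A) = ennreal X * (ennreal Y * ennreal \<eta>) * ennreal A" if "0 \<le> X" "0 \<le> Y" for X Y
      using that pos by (simp add: ennreal_mult)
    ultimately have "ennreal (B ^ Suc g * exp (- (a / t) * real (Suc N))) \<le> pinned_pf \<kappa> (Suc N * d + n) e"
      using pos B0 by (metis exp_ge_zero less_imp_le mult_nonneg_nonneg powr_ge_zero zero_le_power)
    moreover have "Suc g \<le> Suc N" using l(1,4) by (simp add: g_def)
    ultimately have "Suc N \<le> Suc N \<and> Suc N * d \<le> Suc N * d + n \<and> Suc N * d + n \<le> Suc N * d + n \<and> Suc g \<le> Suc N \<and>
      ennreal (B ^ Suc g * exp (- (a / t) * real (Suc N))) \<le> pinned_pf \<kappa> (Suc N * d + n) e" by auto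
    then show ?thesis unfolding card by blast
  qed
qed

context iid_weights
begin

text \<open>A first moment bound: if on average a fraction \<open>p\<close> of the blocks is good, then at least
  half of that fraction is good with probability at least \<open>p / 2\<close>.\<close>

lemma good_block_frequency:
  fixes G :: "nat \<Rightarrow> (nat \<Rightarrow> ennreal) set" and p :: real
  assumes [measurable]: "\<And>i. G i \<in> sets S" and p: "\<And>i. 1 \<le> i \<Longrightarrow> measure S (G i) = p"
    and "1 \<le> N"
  shows "p / 2 \<le> measure S {e. p * real N / 2 \<le> real (card {i \<in> {1..N}. e \<in> G i})}"
proof -
  let ?g = "\<lambda>e. \<Sum>i\<in>{1..N}. indicator (G i) e :: real"
  have card: "real (card {i \<in> {1..N}. e \<in> G i}) = ?g e" for e
    by (simp add: indicator_def sum.If_cases Int_def)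
  define E where "E = {e. p * real N / 2 \<le> ?g e}"
  have [measurable]: "E \<in> sets S"
  proof -
    have "{e \<in> space S. p * real N / 2 \<le> ?g e} \<in> sets S" by measurable
    also have "{e \<in> space S. p * real N / 2 \<le> ?g e} = E" by (simp add: E_def)
    finally show ?thesis .
  qed
  have "real N * p = (\<Sum>i\<in>{1..N}. measure S (G i))" using p by simp
  also have "\<dots> = (LINT e|S. ?g e)"
    by (subst Bochner_Integration.integral_sum) (auto simp: less_top[symmetric])
  also have "\<dots> \<le> (LINT e|S. real N * indicator E e + p * real N / 2)"
  proof (rule integral_mono)
    show "integrable S ?g" by (intro Bochner_Integration.integrable_sum integrable_real_indicator) (auto simp: less_top[symmetric])
    show "integrable S (\<lambda>e. real N * indicator E e + p * real N / 2)"
      by (intro Bochner_Integration.integrable_add integrable_mult_right integrable_real_indicator) (auto simp: less_top[symmetric])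
    fix e
    have "?g e \<le> (\<Sum>i\<in>{1..N}. 1)" by (intro sum_mono) (auto simp: indicator_def)
    moreover have "0 \<le> p" using p[of 1] measure_nonneg[of S "G 1"] by simp
    then have "0 \<le> p * real N" by simp
    ultimately show "?g e \<le> real N * indicator E e + p * real N / 2"
      by (cases "e \<in> E") (simp_all add: E_def)
  qed
  also have "\<dots> = real N * measure S E + p * real N / 2"
    by (subst Bochner_Integration.integral_add) (auto simp: less_top[symmetric] P.prob_space[simplified])
  finally have "real N * (p / 2) \<le> real N * measure S E" by (simp add: algebra_simps)
  then have "p / 2 \<le> measure S E" using \<open>1 \<le> N\<close> by simp
  then show ?thesis unfolding E_def card .
qed

text \<open>With \<open>t = 2 / p\<close>, the inverse of the guaranteed frequency of good blocks, the path through all of them gains a factor of at least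
  \<open>exp 1\<close> per good block if the claim fails. The pinned partition functions would then grow exponentially along a
  subsequence, with probability at least \<open>p / 2\<close>.\<close>

lemma rare_stretch_contradiction:
  fixes c a \<eta> A p :: real and r0 n :: nat
  assumes kernel: "\<And>r. r0 \<le> r \<Longrightarrow> ennreal (c * real r powr (- a)) \<le> \<kappa> r"
    and pos: "0 < c" "0 < a" "0 < \<eta>" "0 < A" "0 < p" "0 < r0"
    and sub: "\<And>\<delta>. 0 < \<delta> \<Longrightarrow> AE e in S. \<forall>\<^sub>F n in sequentially. pinned_pf \<kappa> n e \<le> ennreal (exp (\<delta> * real n))"
    and p: "p = measure S {e. ennreal \<eta> \<le> e 0 \<and> ennreal A \<le> pinned_pf \<kappa> n (env_shift 1 e)}"
  shows "c * (real (n + r0) * (2 / p)) powr (- a) * \<eta> * A < exp (a + 1)"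
proof (rule ccontr)
  assume contr: "\<not> ?thesis"
  define d where "d = n + r0"
  define t where "t = 2 / p"
  define B where "B = c * (real d * t) powr (- a) * \<eta> * A"
  have B: "exp (a + 1) \<le> B" using contr by (simp add: B_def d_def t_def)
  have d0: "0 < d" using pos by (simp add: d_def)
  have t0: "0 < t" using pos by (simp add: t_def)
  define H where "H = {e. ennreal \<eta> \<le> e 0 \<and> ennreal A \<le> pinned_pf \<kappa> n (env_shift 1 e)}"
  have [measurable]: "H \<in> sets S"
  proof -
    have "{e \<in> space S. ennreal \<eta> \<le> e 0 \<and> ennreal A \<le> pinned_pf \<kappa> n (env_shift 1 e)} \<in> sets S" by measurable
    then show ?thesis by (simp add: H_def)
  qed
  define G where "G i = {e. env_shift (i * d - 1) e \<in> H}" for i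
  have [measurable]: "G i \<in> sets S" for i
  proof -
    have "env_shift (i * d - 1) -` H \<inter> space S \<in> sets S" by measurable
    then show ?thesis by (simp add: G_def vimage_def)
  qed
  have Gp: "measure S (G i) = p" for i
  proof -
    have "(\<integral>\<^sup>+e. indicator H (env_shift (i * d - 1) e) \<partial>S) = (\<integral>\<^sup>+e. indicator H e \<partial>S)"
      by (rule nn_integral_env_shift) measurable
    also have "(\<lambda>e. indicator H (env_shift (i * d - 1) e) :: ennreal) = indicator (G i)"
      by (auto simp: G_def indicator_def)
    finally have "emeasure S (G i) = emeasure S H" by simp
    then show ?thesis unfolding p H_def[symmetric] by (simp add: measure_def)
  qed
  have good: "ennreal \<eta> \<le> e (i * d - 1) \<and> ennreal A \<le> pinned_pf \<kappa> n (env_shift (i * d) e)" if "1 \<le> i" "e \<in> G i" for e i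
  proof -
    have "1 \<le> i * d" using that(1) d0 by (simp add: Suc_le_eq)
    then show ?thesis using that(2) by (simp add: G_def H_def env_shift_apply)
  qed
  define E where "E N = {e. p * real N / 2 \<le> real (card {i \<in> {1..N}. e \<in> G i})}" for N
  have [measurable]: "E N \<in> sets S" for N
  proof -
    have card: "real (card {i \<in> {1..N}. e \<in> G i}) = (\<Sum>i\<in>{1..N}. indicator (G i) e)" for e
      by (simp add: indicator_def sum.If_cases Int_def)
    have "{e \<in> space S. p * real N / 2 \<le> (\<Sum>i\<in>{1..N}. indicator (G i) e :: real)} \<in> sets S" by measurable
    then show ?thesis unfolding E_def card by (simp only: space_S UNIV_I simp_thms)
  qed
  \<comment> \<open>half of the guaranteed growth rate \<open>p / 2\<close> per block of length \<open>d\<close>, the path ending at most \<open>n\<close> sites later\<close>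
  define \<delta> where "\<delta> = p / (4 * real (d + n))"
  have \<delta>0: "0 < \<delta>" using pos d0 by (simp add: \<delta>_def)
  have "AE e in S. (\<lambda>N. indicator (E N) e :: real) \<longlonglongrightarrow> 0"
    using sub[OF \<delta>0]
  proof eventually_elim
    case (elim e)
    then obtain m0 where m0: "\<And>m. m0 \<le> m \<Longrightarrow> pinned_pf \<kappa> m e \<le> ennreal (exp (\<delta> * real m))"
      by (auto simp: eventually_sequentially)
    have notE: "e \<notin> E N" if N: "2 * real m0 / p + 1 \<le> real N" for N
    proof
      assume eN: "e \<in> E N"
      define g where "g = card {i \<in> {1..N}. e \<in> G i}"
      have "0 \<le> 2 * real m0 / p" using pos by simp
      then have N1: "1 \<le> N" using N by linarith
      obtain y l where yl: "l \<le> N" "l * d \<le> y" "y \<le> l * d + n" "g \<le> l"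
        and w: "ennreal (B ^ g * exp (- (a / t) * real l)) \<le> pinned_pf \<kappa> y e"
        using chain_of_good_blocks[where N=N and G="\<lambda>i. e \<in> G i" and e=e and \<kappa>=\<kappa> and c=c and a=a and \<eta>=\<eta> and A=A and t=t and d=d and n=n,
            OF kernel pos(1-4) t0 pos(6) d_def good] unfolding B_def g_def by blast
      have gN: "p * real N / 2 \<le> real g" using eN by (simp add: E_def g_def)
      have "real m0 \<le> p * real N / 2" using N pos by (simp add: field_simps)
      then have "m0 \<le> g" using gN by linarith
      also have "g \<le> l * d" using yl(4) d0 by (metis le_trans mult.right_neutral mult_le_mono2 Suc_leI One_nat_def)
      finally have "m0 \<le> y" using yl(2) by linarith
      then have up: "pinned_pf \<kappa> y e \<le> ennreal (exp (\<delta> * real y))" by (rule m0)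
      have "l * d \<le> N * d" "n \<le> N * n" using yl(1) N1 by auto
      then have "y \<le> N * d + N * n" using yl(3) by linarith
      then have "real y \<le> real N * real (d + n)"
        by (metis distrib_left of_nat_le_iff of_nat_mult)
      then have "\<delta> * real y \<le> \<delta> * (real N * real (d + n))" using \<delta>0 by (intro mult_left_mono) auto
      also have "\<dots> = p * real N / 4"
      proof -
        have "real (d + n) \<noteq> 0" using d0 by simp
        moreover have "p / (4 * x) * (real N * x) = p * real N / 4" if "x \<noteq> 0" for x :: real
          using that by (simp add: field_simps)
        ultimately show ?thesis unfolding \<delta>_def by blast
      qed
      finally have "\<delta> * real y \<le> p * real N / 4" .
      also have "\<dots> < p * real N / 2" using pos N1 by simp
      also have "\<dots> \<le> real g" by (rule gN)
      finally have lt: "\<delta> * real y < real g" .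
      have "(a / t) * real l \<le> (a / t) * real N" using yl(1) pos t0 by (intro mult_left_mono) auto
      also have "\<dots> = a * (p * real N / 2)" by (simp add: t_def)
      also have "\<dots> \<le> a * real g" using gN pos by (intro mult_left_mono) auto
      finally have "exp (- (a * real g)) \<le> exp (- (a / t) * real l)" by simp
      moreover have "exp (a + 1) ^ g \<le> B ^ g" using B by (intro power_mono) auto
      ultimately have "exp (a + 1) ^ g * exp (- (a * real g)) \<le> B ^ g * exp (- (a / t) * real l)"
        by (intro mult_mono) (auto intro: order_trans[OF _ zero_le_power] order_trans[OF exp_ge_zero B])
      moreover have "exp (a + 1) ^ g * exp (- (a * real g)) = exp (real g)"
        by (simp add: exp_of_nat_mult[symmetric] exp_add[symmetric] algebra_simps)
      ultimately have "ennreal (exp (real g)) \<le> ennreal (exp (\<delta> * real y))"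
        using w up by (metis ennreal_leI order_trans)
      then show False using lt by simp
    qed
    have "\<forall>\<^sub>F N in sequentially. (indicator (E N) e :: real) = 0"
      unfolding eventually_sequentially
    proof (intro exI allI impI)
      fix N assume "nat \<lceil>2 * real m0 / p + 1\<rceil> \<le> N"
      then have "2 * real m0 / p + 1 \<le> real N" by (meson of_nat_ceiling of_nat_le_iff order_trans)
      then show "(indicator (E N) e :: real) = 0" using notE by simp
    qed
    then show ?case by (rule tendsto_eventually)
  qed
  then have "(\<lambda>N. LINT e|S. indicator (E N) e :: real) \<longlonglongrightarrow> (LINT e|S. 0)"
    by (intro integral_dominated_convergence[where w="\<lambda>_. 1"]) (auto split: split_indicator)
  then have "(\<lambda>N. measure S (E N)) \<longlonglongrightarrow> 0" by simp
  then have "\<forall>\<^sub>F N in sequentially. measure S (E N) < p / 2"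
    using pos by (intro order_tendstoD) auto
  then obtain N0 where N0: "\<And>N. N0 \<le> N \<Longrightarrow> measure S (E N) < p / 2"
    unfolding eventually_sequentially by blast
  define N where "N = max 1 N0"
  have N: "1 \<le> N" "measure S (E N) < p / 2" using N0[of N] by (auto simp: N_def)
  then show False
    using good_block_frequency[of G p N] Gp unfolding E_def by auto
qed

text \<open>Solving the inequality of the rare stretch argument for the probability of a good block. A block is
  good if its first weight is at least \<open>\<eta>\<close>, which is independent of what follows, and the stretch behind it
  has weight at least \<open>A\<close>.\<close>

lemma rare_stretch_tail:
  fixes c a \<eta> :: real and r0 :: nat
  assumes kernel: "\<And>r. r0 \<le> r \<Longrightarrow> ennreal (c * real r powr (- a)) \<le> \<kappa> r"
    and pos: "0 < c" "0 < a" "0 < \<eta>" "0 < r0"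
    and q: "0 < measure S {e. ennreal \<eta> \<le> e 0}"
    and sub: "\<And>\<delta>. 0 < \<delta> \<Longrightarrow> AE e in S. \<forall>\<^sub>F n in sequentially. pinned_pf \<kappa> n e \<le> ennreal (exp (\<delta> * real n))"
  shows "\<exists>C>0. \<forall>n. \<forall>A>0. measure S {e. ennreal A \<le> pinned_pf \<kappa> n e} \<le> C * (real n + 1) * A powr (- (1 / a))"
proof -
  define q where "q = measure S {e. ennreal \<eta> \<le> e 0}"
  have q0: "0 < q" using assms(6) by (simp add: q_def)
  define C1 where "C1 = (exp (a + 1) / (c * \<eta>)) powr (1 / a)"
  define C where "C = 2 * real r0 * C1 / q"
  have C1: "0 < C1" using pos by (simp add: C1_def)
  have C0: "0 < C" using C1 q0 pos by (simp add: C_def)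
  have "measure S {e. ennreal A \<le> pinned_pf \<kappa> n e} \<le> C * (real n + 1) * A powr (- (1 / a))" if "0 < A" for n A
  proof -
    define p1 where "p1 = measure S {e. ennreal A \<le> pinned_pf \<kappa> n e}"
    define p where "p = measure S {e. ennreal \<eta> \<le> e 0 \<and> ennreal A \<le> pinned_pf \<kappa> n (env_shift 1 e)}"
    have [measurable]: "{e. ennreal A \<le> pinned_pf \<kappa> n e} \<in> sets S" "{e. ennreal \<eta> \<le> e 0} \<in> sets S"
      "{e. ennreal \<eta> \<le> e 0 \<and> ennreal A \<le> pinned_pf \<kappa> n (env_shift 1 e)} \<in> sets S"
    proof -
      have "{e \<in> space S. ennreal A \<le> pinned_pf \<kappa> n e} \<in> sets S" "{e \<in> space S. ennreal \<eta> \<le> e 0} \<in> sets S"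
        "{e \<in> space S. ennreal \<eta> \<le> e 0 \<and> ennreal A \<le> pinned_pf \<kappa> n (env_shift 1 e)} \<in> sets S"
        by measurable
      then show "{e. ennreal A \<le> pinned_pf \<kappa> n e} \<in> sets S" "{e. ennreal \<eta> \<le> e 0} \<in> sets S"
        "{e. ennreal \<eta> \<le> e 0 \<and> ennreal A \<le> pinned_pf \<kappa> n (env_shift 1 e)} \<in> sets S" by simp_all
    qed
    have "(\<integral>\<^sup>+e. indicator {e. ennreal \<eta> \<le> e 0} e * indicator {e. ennreal A \<le> pinned_pf \<kappa> n e} (env_shift 1 e) \<partial>S) =
        (\<integral>\<^sup>+e. indicator {e. ennreal \<eta> \<le> e 0} e \<partial>S) * (\<integral>\<^sup>+e. indicator {e. ennreal A \<le> pinned_pf \<kappa> n e} e \<partial>S)"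
      by (rule nn_integral_split) (auto simp: indicator_def)
    also have "(\<lambda>e. indicator {e. ennreal \<eta> \<le> e 0} e * indicator {e. ennreal A \<le> pinned_pf \<kappa> n e} (env_shift 1 e) :: ennreal)
      = indicator {e. ennreal \<eta> \<le> e 0 \<and> ennreal A \<le> pinned_pf \<kappa> n (env_shift 1 e)}"
      by (auto simp: indicator_def)
    finally have pp: "p = q * p1"
      by (simp add: p_def q_def p1_def P.emeasure_eq_measure ennreal_mult[symmetric] del: One_nat_def)
    show ?thesis
    proof (cases "p1 = 0")
      case True
      then show ?thesis using C0 by (simp add: p1_def[symmetric])
    next
      case False
      then have "0 < p1" by (simp add: p1_def zero_less_measure_iff)
      then have p0: "0 < p" using pp q0 by simp
      have "c * (real (n + r0) * (2 / p)) powr (- a) * \<eta> * A < exp (a + 1)"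
        using p_def by (intro rare_stretch_contradiction[OF kernel pos(1-3) that p0 pos(4) sub])
      define D where "D = real (n + r0) * 2"
      have D0: "0 < D" using pos by (simp add: D_def)
      have "(D / p) powr (- a) < exp (a + 1) / (c * \<eta>) * (1 / A)"
        using \<open>c * (real (n + r0) * (2 / p)) powr (- a) * \<eta> * A < exp (a + 1)\<close> pos that
        by (simp add: D_def field_simps)
      then have "((D / p) powr (- a)) powr (1 / a) < (exp (a + 1) / (c * \<eta>) * (1 / A)) powr (1 / a)"
        using pos D0 p0 by (intro powr_less_mono2) auto
      also have "((D / p) powr (- a)) powr (1 / a) = p / D"
      proof -
        have "((D / p) powr (- a)) powr (1 / a) = (D / p) powr (-1)" using pos by (simp only: powr_powr) simp
        then show ?thesis using D0 p0 by (simp add: powr_minus_divide)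
      qed
      also have "(exp (a + 1) / (c * \<eta>) * (1 / A)) powr (1 / a) = C1 * A powr (- (1 / a))"
        unfolding C1_def by (subst powr_mult) (use pos that in \<open>auto simp: powr_minus_divide powr_divide\<close>)
      finally have "p < D * (C1 * A powr (- (1 / a)))" using D0 by (simp add: field_simps)
      then have "q * p1 \<le> D * (C1 * A powr (- (1 / a)))" by (simp add: pp)
      then have "p1 \<le> D * (C1 * A powr (- (1 / a))) / q" using q0 by (simp add: field_simps)
      also have "\<dots> \<le> (2 * real r0 * (real n + 1)) * (C1 * A powr (- (1 / a))) / q"
      proof -
        have "real n * 1 \<le> real n * real r0" using pos by (intro mult_left_mono) auto
        then have "D \<le> 2 * real r0 * (real n + 1)" by (simp add: D_def algebra_simps)
        then show ?thesis using C1 q0 by (intro divide_right_mono mult_right_mono) auto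
      qed
      also have "\<dots> = C * (real n + 1) * A powr (- (1 / a))" by (simp add: C_def)
      finally show ?thesis by (simp add: p1_def)
    qed
  qed
  then show ?thesis using C0 by blast
qed

text \<open>A dyadic layer-cake bound, from which tail estimates give moments.\<close>

lemma epow_dyadic:
  assumes "0 < \<gamma>"
  shows "epow \<gamma> x \<le> 1 + (\<Sum>i. ennreal (2 powr (\<gamma> * (real i + 1))) * indicator {y. ennreal (2 ^ i) \<le> y} x)"
proof (cases x)
  case top
  have "(\<Sum>i. 1 :: ennreal) = \<top>" using nn_integral_count_space_nat[of "\<lambda>_. 1"] by simp
  moreover have "(\<Sum>i. 1 :: ennreal) \<le> (\<Sum>i. ennreal (2 powr (\<gamma> * (real i + 1))) * indicator {y. ennreal (2 ^ i) \<le> y} x)"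
    using assms by (intro suminf_le) (auto simp: top intro!: ge_one_powr_ge_zero)
  ultimately show ?thesis by (simp add: top_unique)
next
  case (real r)
  show ?thesis
  proof (cases "r \<le> 1")
    case True
    then have "r powr \<gamma> \<le> 1 powr \<gamma>" using real assms by (intro powr_mono2) auto
    then have "epow \<gamma> x \<le> 1" using real by (simp add: epow_ennreal)
    then show ?thesis by (rule order_trans) simp
  next
    case False
    define i where "i = nat \<lfloor>log 2 r\<rfloor>"
    have l: "0 \<le> log 2 r" using False by simp
    have i: "real i \<le> log 2 r" "log 2 r \<le> real i + 1" using l by (auto simp: i_def)
    have "2 ^ i \<le> r" using i(1) False by (simp add: le_log_iff powr_realpow)
    have "r \<le> 2 powr (real i + 1)" using i(2) False by (simp add: log_le_iff)
    then have "r powr \<gamma> \<le> (2 powr (real i + 1)) powr \<gamma>" using False assms by (intro powr_mono2) auto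
    then have "epow \<gamma> x \<le> ennreal (2 powr (\<gamma> * (real i + 1))) * indicator {y. ennreal (2 ^ i) \<le> y} x"
      using real \<open>2 ^ i \<le> r\<close> by (simp add: epow_ennreal powr_powr mult.commute ennreal_leI)
    also have "\<dots> \<le> (\<Sum>i. ennreal (2 powr (\<gamma> * (real i + 1))) * indicator {y. ennreal (2 ^ i) \<le> y} x)"
    proof -
      have "h i \<le> suminf h" for h :: "nat \<Rightarrow> ennreal"
        using sum_le_suminf[of h "{i}"] by simp
      then show ?thesis .
    qed
    also have "\<dots> \<le> 1 + \<dots>" by simp
    finally show ?thesis .
  qed
qed

text \<open>The tail exponent \<open>1 / a\<close> exceeds \<open>\<gamma>\<close>, so the dyadic sum is geometric; the linear factor in \<open>n\<close> is inherited
  from the tail bound.\<close>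

theorem frac_moment_pinned_pf_bound:
  fixes c a \<eta> \<gamma> :: real and r0 :: nat
  assumes kernel: "\<And>r. r0 \<le> r \<Longrightarrow> ennreal (c * real r powr (- a)) \<le> \<kappa> r"
    and pos: "0 < c" "0 < a" "0 < \<eta>" "0 < r0"
    and q: "0 < measure S {e. ennreal \<eta> \<le> e 0}"
    and sub: "\<And>\<delta>. 0 < \<delta> \<Longrightarrow> AE e in S. \<forall>\<^sub>F n in sequentially. pinned_pf \<kappa> n e \<le> ennreal (exp (\<delta> * real n))"
    and \<gamma>: "0 < \<gamma>" "\<gamma> < 1 / a"
  shows "\<exists>C>0. \<forall>n. frac_moment \<gamma> (pinned_pf \<kappa> n) \<le> ennreal (C * (real n + 1))"
proof -
  obtain C where C: "0 < C" "\<And>n A. 0 < A \<Longrightarrow> measure S {e. ennreal A \<le> pinned_pf \<kappa> n e} \<le> C * (real n + 1) * A powr (- (1 / a))"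
    using rare_stretch_tail[OF kernel pos q sub] by blast
  define z where "z = 2 powr (\<gamma> - 1 / a)"
  have z: "0 < z" "z < 1" using \<gamma> by (auto simp: z_def powr_less_one)
  define D where "D = 1 + C * 2 powr \<gamma> * (1 / (1 - z))"
  have "frac_moment \<gamma> (pinned_pf \<kappa> n) \<le> ennreal (D * (real n + 1))" for n
  proof -
    have ms: "{e. ennreal A \<le> pinned_pf \<kappa> n e} \<in> sets S" for A
    proof -
      have "{e \<in> space S. ennreal A \<le> pinned_pf \<kappa> n e} \<in> sets S" by measurable
      then show ?thesis by simp
    qed
    have "frac_moment \<gamma> (pinned_pf \<kappa> n) \<le>
        (\<integral>\<^sup>+e. 1 + (\<Sum>i. ennreal (2 powr (\<gamma> * (real i + 1))) * indicator {e. ennreal (2 ^ i) \<le> pinned_pf \<kappa> n e} e) \<partial>S)"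
      unfolding frac_moment_def using epow_dyadic[OF \<gamma>(1)]
      by (intro nn_integral_mono) (simp add: indicator_def)
    also have "\<dots> = 1 + (\<Sum>i. ennreal (2 powr (\<gamma> * (real i + 1))) * emeasure S {e. ennreal (2 ^ i) \<le> pinned_pf \<kappa> n e})"
      using ms by (subst nn_integral_add) (auto simp: nn_integral_suminf nn_integral_cmult_indicator P.emeasure_space_1[simplified])
    also have "\<dots> \<le> 1 + (\<Sum>i. ennreal (C * (real n + 1) * 2 powr \<gamma> * z ^ i))"
    proof (intro add_left_mono suminf_le)
      fix i
      have "2 powr (\<gamma> * (real i + 1)) * measure S {e. ennreal (2 ^ i) \<le> pinned_pf \<kappa> n e}
          \<le> 2 powr (\<gamma> * (real i + 1)) * (C * (real n + 1) * (2 ^ i) powr (- (1 / a)))"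
        by (intro mult_left_mono C) auto
      also have "2 powr (\<gamma> * (real i + 1)) * (C * (real n + 1) * (2 ^ i) powr (- (1 / a))) = C * (real n + 1) * 2 powr \<gamma> * z ^ i"
      proof -
        have "2 powr (\<gamma> * (real i + 1)) = 2 powr \<gamma> * (2 powr \<gamma>) ^ i"
          by (simp add: powr_add algebra_simps powr_realpow[symmetric] powr_powr)
        moreover have "((2::real) ^ i) powr (- (1 / a)) = (2 powr (- (1 / a))) ^ i"
          by (simp add: powr_realpow[symmetric] powr_powr mult.commute)
        moreover have "z ^ i = (2 powr \<gamma>) ^ i * (2 powr (- (1 / a))) ^ i"
          by (simp add: z_def powr_diff power_mult_distrib[symmetric] powr_minus_divide)
        ultimately show ?thesis by (simp only: mult_ac)
      qed
      finally have *: "2 powr (\<gamma> * (real i + 1)) * measure S {e. ennreal (2 ^ i) \<le> pinned_pf \<kappa> n e} \<le> C * (real n + 1) * 2 powr \<gamma> * z ^ i" .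
      show "ennreal (2 powr (\<gamma> * (real i + 1))) * emeasure S {e. ennreal (2 ^ i) \<le> pinned_pf \<kappa> n e} \<le> ennreal (C * (real n + 1) * 2 powr \<gamma> * z ^ i)"
        using ennreal_leI[OF *] by (simp add: P.emeasure_eq_measure ennreal_mult)
    qed auto
    also have "(\<Sum>i. ennreal (C * (real n + 1) * 2 powr \<gamma> * z ^ i)) = ennreal (C * (real n + 1) * 2 powr \<gamma> * (1 / (1 - z)))"
      using C z by (intro suminf_ennreal_eq sums_mult geometric_sums) auto
    also have "1 + \<dots> = ennreal (1 + C * (real n + 1) * 2 powr \<gamma> * (1 / (1 - z)))"
      using C z by (subst ennreal_plus) auto
    also have "\<dots> \<le> ennreal (D * (real n + 1))"
      by (intro ennreal_leI) (simp add: D_def algebra_simps add_divide_distrib)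
    finally show ?thesis .
  qed
  moreover have "0 < D" using C z by (simp add: D_def add_pos_nonneg)
  ultimately show ?thesis by blast
qed

end

section \<open>Summability below the critical point: a multi-scale tilt\<close>

text \<open>The sum over the jump lengths of paths with \<open>k\<close> contacts of their weight times a functional \<open>G\<close> of the
  list of jumps. It transports inequalities between functionals to inequalities between transfer operators.\<close>

primrec path_sum :: "(nat \<Rightarrow> ennreal) \<Rightarrow> nat \<Rightarrow> (nat \<Rightarrow> ennreal) \<Rightarrow> (nat list \<Rightarrow> ennreal) \<Rightarrow> ennreal" where
  "path_sum \<kappa> 0 e G = G []"
| "path_sum \<kappa> (Suc k) e G = (\<Sum>r. \<kappa> (Suc r) * e r * path_sum \<kappa> k (env_shift (Suc r) e) (\<lambda>rs. G (Suc r # rs)))"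

lemma path_sum_mono:
  "(\<And>rs. length rs = k \<Longrightarrow> 0 \<notin> set rs \<Longrightarrow> G rs \<le> H rs) \<Longrightarrow> path_sum \<kappa> k e G \<le> path_sum \<kappa> k e H"
proof (induction k arbitrary: e G H)
  case (Suc k)
  have "path_sum \<kappa> k e' (\<lambda>rs. G (Suc r # rs)) \<le> path_sum \<kappa> k e' (\<lambda>rs. H (Suc r # rs))" for r e'
    by (rule Suc.IH) (auto intro!: Suc.prems)
  then show ?case by (auto intro!: suminf_le mult_left_mono)
qed simp

lemma path_sum_add: "path_sum \<kappa> k e (\<lambda>rs. G rs + H rs) = path_sum \<kappa> k e G + path_sum \<kappa> k e H"
  by (induction k arbitrary: e G H) (auto simp: distrib_left suminf_add[symmetric])

lemma path_sum_zero: "path_sum \<kappa> k e (\<lambda>_. 0) = 0"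
  by (induction k arbitrary: e) auto

lemma path_sum_sum: "path_sum \<kappa> k e (\<lambda>rs. \<Sum>i\<in>A. G i rs) = (\<Sum>i\<in>A. path_sum \<kappa> k e (G i))"
  by (induction A rule: infinite_finite_induct) (auto simp: path_sum_add path_sum_zero)

lemma path_sum_cmult: "path_sum \<kappa> k e (\<lambda>rs. c * G rs) = c * path_sum \<kappa> k e G"
proof (induction k arbitrary: e G)
  case (Suc k)
  have "(\<Sum>r. \<kappa> (Suc r) * e r * (c * path_sum \<kappa> k (env_shift (Suc r) e) (\<lambda>rs. G (Suc r # rs))))
      = (\<Sum>r. c * (\<kappa> (Suc r) * e r * path_sum \<kappa> k (env_shift (Suc r) e) (\<lambda>rs. G (Suc r # rs))))"
    by (simp only: mult_ac)
  then show ?case by (simp add: Suc.IH)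
qed simp

lemma path_sum_prod: "path_sum \<kappa> k e (\<lambda>rs. \<Prod>r\<leftarrow>rs. w r) = contact_sum (\<lambda>r. \<kappa> r * w r) k e"
proof (induction k arbitrary: e)
  case (Suc k)
  show ?case by (simp add: path_sum_cmult Suc.IH step_op_def mult_ac)
qed simp

lemma exp_sum_list: "(\<Prod>r\<leftarrow>rs. exp (f r)) = exp (\<Sum>r\<leftarrow>rs. f r :: real)"
  by (induction rs) (auto simp: exp_add)

text \<open>Jumps up to \<open>R j\<close> are free, those in the band from \<open>R j\<close> to \<open>R (Suc j)\<close> are penalised by a large power \<open>\<theta>\<close>,
  longer ones by a small power \<open>\<theta>'\<close>.\<close>

definition scale_exponent :: "(nat \<Rightarrow> nat) \<Rightarrow> real \<Rightarrow> real \<Rightarrow> nat \<Rightarrow> nat \<Rightarrow> real" where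
  "scale_exponent R \<theta> \<theta>' j r = (if r \<le> R j then 0 else if r \<le> R (Suc j) then \<theta> else \<theta>')"

text \<open>Either the logarithms of the jumps add up to at least \<open>C\<close> per jump, and the first term exceeds \<open>1\<close>.
  Otherwise the bands are disjoint, so one of the \<open>J\<close> bands carries at most the share \<open>C / J\<close> per jump of
  that sum; for this band the penalties of all jumps are compensated by the factor \<open>exp \<delta>\<close> per jump.\<close>

lemma scale_decomposition:
  fixes C \<delta> \<theta> \<theta>' :: real and R :: "nat \<Rightarrow> nat" and J :: nat
  assumes pos: "0 < C" "0 \<le> \<theta>" "0 \<le> \<theta>'" "0 < J" and budget: "\<theta> * C / real J + \<theta>' * C \<le> \<delta>"
    and R: "mono R" and rs: "0 \<notin> set rs"
  shows "1 \<le> (\<Prod>r\<leftarrow>rs. exp (- C + ln (real r))) +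
    (\<Sum>j<J. \<Prod>r\<leftarrow>rs. exp (\<delta> - scale_exponent R \<theta> \<theta>' j r * ln (real r)))"
proof (cases "C * real (length rs) \<le> (\<Sum>r\<leftarrow>rs. ln (real r))")
  case True
  have "(\<Sum>r\<leftarrow>rs. - C + ln (real r)) = - C * real (length rs) + (\<Sum>r\<leftarrow>rs. ln (real r))"
    by (induction rs) (auto simp: algebra_simps)
  then have "1 \<le> (\<Prod>r\<leftarrow>rs. exp (- C + ln (real r)))" using True by (simp add: exp_sum_list)
  moreover have "0 \<le> (\<Sum>j<J. \<Prod>r\<leftarrow>rs. exp (\<delta> - scale_exponent R \<theta> \<theta>' j r * ln (real r)))"
    by (intro sum_nonneg) (simp add: exp_sum_list)
  ultimately show ?thesis by linarith
next
  case False
  define band where "band j = (\<Sum>r\<leftarrow>rs. (if R j < r \<and> r \<le> R (Suc j) then 1 else 0) * ln (real r))" for j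
  have one: "(\<Sum>j<J. if R j < r \<and> r \<le> R (Suc j) then 1 else 0 :: real) \<le> 1" for r
  proof (cases "\<exists>j<J. R j < r \<and> r \<le> R (Suc j)")
    case True
    then obtain j where j: "j < J" "R j < r" "r \<le> R (Suc j)" by blast
    have "\<not> (R i < r \<and> r \<le> R (Suc i))" if "i \<noteq> j" for i
      using that j monoD[OF R, of "Suc i" j] monoD[OF R, of "Suc j" i] by (cases i j rule: linorder_cases) auto
    then have "(\<Sum>j<J. if R j < r \<and> r \<le> R (Suc j) then 1 else 0 :: real) = (\<Sum>i<J. if i = j then 1 else 0)"
      using j by (intro sum.cong) auto
    then show ?thesis using j by simp
  next
    case False
    then have "(\<Sum>j<J. if R j < r \<and> r \<le> R (Suc j) then 1 else 0 :: real) = 0"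
      by (intro sum.neutral) auto
    then show ?thesis by simp
  qed
  have "(\<Sum>j<J. band j) \<le> (\<Sum>r\<leftarrow>rs. ln (real r))"
    unfolding band_def using rs
  proof (induction rs)
    case (Cons r rs)
    have "(\<Sum>j<J. (if R j < r \<and> r \<le> R (Suc j) then 1 else 0) * ln (real r)) \<le> 1 * ln (real r)"
      unfolding sum_distrib_right[symmetric] using Cons.prems by (intro mult_right_mono one) auto
    then show ?case using Cons by (simp add: sum.distrib)
  qed simp
  have "\<exists>j<J. band j \<le> C * real (length rs) / real J"
  proof (rule ccontr)
    assume "\<not> ?thesis"
    then have "(\<Sum>j<J. C * real (length rs) / real J) \<le> (\<Sum>j<J. band j)"
      by (intro sum_mono) (auto simp: not_le less_imp_le)
    then have "C * real (length rs) \<le> (\<Sum>j<J. band j)" using pos by simp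
    then show False using False \<open>(\<Sum>j<J. band j) \<le> (\<Sum>r\<leftarrow>rs. ln (real r))\<close> by linarith
  qed
  then obtain j where j: "j < J" "band j \<le> C * real (length rs) / real J" by blast
  have "(\<Sum>r\<leftarrow>rs. scale_exponent R \<theta> \<theta>' j r * ln (real r))
      \<le> \<theta> * band j + \<theta>' * (\<Sum>r\<leftarrow>rs. ln (real r))"
    unfolding band_def using rs
  proof (induction rs)
    case (Cons r rs)
    have l: "0 \<le> ln (real r)" using Cons.prems by auto
    have "scale_exponent R \<theta> \<theta>' j r * ln (real r)
        \<le> \<theta> * ((if R j < r \<and> r \<le> R (Suc j) then 1 else 0) * ln (real r)) + \<theta>' * ln (real r)"
      using l pos by (auto simp: scale_exponent_def)
    then show ?case using Cons by (simp add: algebra_simps)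
  qed simp
  also have "\<dots> \<le> \<theta> * (C * real (length rs) / real J) + \<theta>' * (C * real (length rs))"
    using j False pos by (intro add_mono mult_left_mono) auto
  also have "\<dots> = (\<theta> * C / real J + \<theta>' * C) * real (length rs)" by (simp add: algebra_simps)
  also have "\<dots> \<le> \<delta> * real (length rs)" using budget by (intro mult_right_mono) auto
  finally have le: "(\<Sum>r\<leftarrow>rs. scale_exponent R \<theta> \<theta>' j r * ln (real r)) \<le> \<delta> * real (length rs)" .
  have eq: "(\<Sum>r\<leftarrow>rs. \<delta> - f r) = \<delta> * real (length rs) - (\<Sum>r\<leftarrow>rs. f r)" for f :: "nat \<Rightarrow> real"
    by (induction rs) (auto simp: algebra_simps)
  let ?h = "\<lambda>j. \<Prod>r\<leftarrow>rs. exp (\<delta> - scale_exponent R \<theta> \<theta>' j r * ln (real r))"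
  have "1 \<le> ?h j" unfolding exp_sum_list eq using le by simp
  also have "?h j \<le> (\<Sum>j<J. ?h j)" using j(1) by (intro member_le_sum) (auto simp: exp_sum_list)
  finally show ?thesis by (simp add: exp_sum_list add_increasing)
qed

lemma ennreal_prod_list: "(\<And>x. 0 \<le> f x) \<Longrightarrow> ennreal (\<Prod>r\<leftarrow>rs. f r) = (\<Prod>r\<leftarrow>rs. ennreal (f r))"
proof (induction rs)
  case (Cons a rs)
  have "0 \<le> (\<Prod>r\<leftarrow>rs. f r)" using Cons.prems by (induction rs) auto
  then show ?case using Cons by (simp add: ennreal_mult)
qed simp

lemma step_op_scale_decomposition:
  fixes C \<delta> \<theta> \<theta>' :: real and R :: "nat \<Rightarrow> nat" and J :: nat
  assumes "0 < C" "0 \<le> \<theta>" "0 \<le> \<theta>'" "0 < J" "\<theta> * C / real J + \<theta>' * C \<le> \<delta>" "mono R"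
  shows "contact_sum \<kappa> k e \<le>
    contact_sum (\<lambda>r. \<kappa> r * ennreal (exp (- C + ln (real r)))) k e +
    (\<Sum>j<J. contact_sum (\<lambda>r. \<kappa> r * ennreal (exp (\<delta> - scale_exponent R \<theta> \<theta>' j r * ln (real r)))) k e)"
proof -
  let ?f = "\<lambda>r. exp (- C + ln (real r))"
  let ?g = "\<lambda>j r. exp (\<delta> - scale_exponent R \<theta> \<theta>' j r * ln (real r))"
  have nn: "0 \<le> (\<Prod>r\<leftarrow>rs. f r)" if "\<And>x. 0 \<le> f x" for f :: "nat \<Rightarrow> real" and rs :: "nat list"
    using that by (induction rs) auto
  have "contact_sum \<kappa> k e = path_sum \<kappa> k e (\<lambda>rs. \<Prod>r\<leftarrow>rs. 1)"
    unfolding path_sum_prod by simp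
  also have "\<dots> \<le> path_sum \<kappa> k e (\<lambda>rs. (\<Prod>r\<leftarrow>rs. ennreal (?f r)) + (\<Sum>j<J. \<Prod>r\<leftarrow>rs. ennreal (?g j r)))"
  proof (rule path_sum_mono)
    fix rs :: "nat list" assume "0 \<notin> set rs"
    from ennreal_leI[OF scale_decomposition[OF assms this]]
    have "ennreal 1 \<le> ennreal ((\<Prod>r\<leftarrow>rs. ?f r) + (\<Sum>j<J. \<Prod>r\<leftarrow>rs. ?g j r))" .
    also have "\<dots> = ennreal (\<Prod>r\<leftarrow>rs. ?f r) + (\<Sum>j<J. ennreal (\<Prod>r\<leftarrow>rs. ?g j r))"
    proof -
      have "ennreal (\<Sum>j<J. h j) = (\<Sum>j<J. ennreal (h j))" if "\<And>j. 0 \<le> h j" for h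
        using that by (simp add: sum_ennreal)
      note this[of "\<lambda>j. \<Prod>r\<leftarrow>rs. ?g j r", OF nn, OF exp_ge_zero]
      then show ?thesis
        by (subst ennreal_plus) (auto intro!: nn sum_nonneg)
    qed
    also have "\<dots> = (\<Prod>r\<leftarrow>rs. ennreal (?f r)) + (\<Sum>j<J. \<Prod>r\<leftarrow>rs. ennreal (?g j r))"
      by (subst (1 2) ennreal_prod_list) auto
    finally show "(\<Prod>r\<leftarrow>rs. 1) \<le> (\<Prod>r\<leftarrow>rs. ennreal (?f r)) + (\<Sum>j<J. \<Prod>r\<leftarrow>rs. ennreal (?g j r))"
      by (simp add: map_replicate_const)
  qed
  finally show ?thesis by (simp only: path_sum_add path_sum_sum path_sum_prod)
qed


lemma step_op_scale_power: "contact_sum (\<lambda>r. c * \<kappa> r) k e = c ^ k * contact_sum \<kappa> k e"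
proof (induction k arbitrary: e)
  case (Suc k)
  have "(\<Sum>r. c * \<kappa> (Suc r) * e r * (c ^ k * contact_sum \<kappa> k (env_shift (Suc r) e)))
      = (\<Sum>r. c * c ^ k * (\<kappa> (Suc r) * e r * contact_sum \<kappa> k (env_shift (Suc r) e)))"
    by (simp only: mult_ac)
  then show ?case by (simp add: step_op_def[of _ "(step_op _ ^^ k) _"] Suc.IH)
qed simp

lemma sum_Suc_le_square: "(\<Sum>n\<le>N. real n + 1) \<le> (real N + 1)\<^sup>2"
  by (induction N) (auto simp: power2_eq_square algebra_simps)

text \<open>A polynomial in the number of contacts is absorbed by an arbitrarily small exponential discount.\<close>

lemma linear_le_exp:
  assumes "0 < s" shows "real k + 1 \<le> max 1 (1 / s) * exp (s * real k)"
proof -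
  have "real k \<le> max 1 (1 / s) * (s * real k)"
  proof -
    have "1 \<le> max 1 (1 / s) * s" using assms by (simp add: max_def field_simps)
    then have "1 * real k \<le> max 1 (1 / s) * s * real k" by (intro mult_right_mono) auto
    then show ?thesis by simp
  qed
  moreover have "1 \<le> max 1 (1 / s)" by simp
  ultimately have "real k + 1 \<le> max 1 (1 / s) * (s * real k + 1)" unfolding distrib_left by linarith
  also have "\<dots> \<le> max 1 (1 / s) * exp (s * real k)"
    using exp_ge_add_one_self[of "s * real k"] by (intro mult_left_mono) (auto simp: add.commute)
  finally show ?thesis .
qed

context iid_weights
begin

text \<open>The constant in the next bound. Its independence of \<open>m\<close> is what allows the scale \<open>m\<close> to be chosen afterwards.\<close>

definition level_constant :: "real \<Rightarrow> real \<Rightarrow> real \<Rightarrow> real" where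
  "level_constant \<gamma> u Cb = Cb * (max 1 (4 / (u * \<gamma>)))\<^sup>2 / (1 - exp (- (u * \<gamma> / 2)))"

lemma short_jump_series_le:
  assumes "0 < \<gamma>" "0 < u" "0 < Cb" "1 \<le> m"
  shows "(\<Sum>k. epow \<gamma> (ennreal (exp (- u))) ^ k * (\<Sum>n\<le>k * m. ennreal (Cb * (real n + 1)))) \<le>
    ennreal ((real m)\<^sup>2 * level_constant \<gamma> u Cb)"
proof -
  define M where "M = max 1 (4 / (u * \<gamma>))"
  define y where "y = exp (- (u * \<gamma> / 2))"
  have y: "0 < y" "y < 1" using assms by (auto simp: y_def)
  have "(\<Sum>k. epow \<gamma> (ennreal (exp (- u))) ^ k * (\<Sum>n\<le>k * m. ennreal (Cb * (real n + 1)))) \<le>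
      (\<Sum>k. ennreal ((real m)\<^sup>2 * Cb * M\<^sup>2 * y ^ k))"
  proof (intro suminf_le)
    fix k
    \<comment> \<open>half of the discount absorbs the polynomial factor\<close>
    define z where "z = exp (- (u * \<gamma>))"
    have z: "epow \<gamma> (ennreal (exp (- u))) = ennreal z"
      by (simp add: epow_ennreal z_def exp_powr_real)
    have "(\<Sum>n\<le>k * m. Cb * (real n + 1)) \<le> Cb * (real (k * m) + 1)\<^sup>2"
      unfolding sum_distrib_left[symmetric] using assms by (intro mult_left_mono sum_Suc_le_square) auto
    also have "\<dots> \<le> Cb * (real m * (real k + 1))\<^sup>2"
      using assms by (intro mult_left_mono power_mono) (auto simp: algebra_simps)
    also have "\<dots> \<le> Cb * (real m * (M * exp (u * \<gamma> / 4 * real k)))\<^sup>2"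
      using linear_le_exp[of "u * \<gamma> / 4" k] assms unfolding M_def
      by (intro mult_left_mono power_mono) auto
    also have "\<dots> = (real m)\<^sup>2 * Cb * M\<^sup>2 * exp (u * \<gamma> / 2 * real k)"
      by (simp add: power_mult_distrib exp_double[symmetric] mult_ac)
    finally have "z ^ k * (\<Sum>n\<le>k * m. Cb * (real n + 1)) \<le> z ^ k * ((real m)\<^sup>2 * Cb * M\<^sup>2 * exp (u * \<gamma> / 2 * real k))"
      by (intro mult_left_mono) (auto simp: z_def)
    also have "\<dots> = (real m)\<^sup>2 * Cb * M\<^sup>2 * y ^ k"
      by (simp add: z_def y_def exp_of_nat_mult[symmetric] exp_add[symmetric] algebra_simps)
    finally show "epow \<gamma> (ennreal (exp (- u))) ^ k * (\<Sum>n\<le>k * m. ennreal (Cb * (real n + 1)))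
        \<le> ennreal ((real m)\<^sup>2 * Cb * M\<^sup>2 * y ^ k)"
      unfolding z using assms
      by (subst sum_ennreal) (auto simp: ennreal_mult[symmetric] ennreal_power z_def sum_nonneg intro!: ennreal_leI)
  qed auto
  also have "\<dots> = ennreal ((real m)\<^sup>2 * Cb * M\<^sup>2 * (1 / (1 - y)))"
    using y assms by (intro suminf_ennreal_eq sums_mult geometric_sums) auto
  also have "\<dots> = ennreal ((real m)\<^sup>2 * level_constant \<gamma> u Cb)"
    by (simp add: level_constant_def M_def y_def mult.assoc)
  finally show ?thesis .
qed

text \<open>The fractional moment of the whole series is finite by subadditivity, hence the series is finite.\<close>

lemma AE_finite_of_frac_moment:
  assumes "0 < \<gamma>" "\<gamma> \<le> 1" "0 < u" and [measurable]: "\<And>k. F k \<in> borel_measurable S"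
    and bound: "\<And>k. frac_moment \<gamma> (F k) \<le> ennreal D"
  shows "AE e in S. (\<Sum>k. ennreal (exp (- u * real k)) * F k e) < \<infinity>"
proof -
  define y where "y = exp (- (u * \<gamma>))"
  have y: "0 < y" "y < 1" using assms by (auto simp: y_def)
  have "(\<integral>\<^sup>+e. epow \<gamma> (\<Sum>k. ennreal (exp (- u * real k)) * F k e) \<partial>S) \<le>
      (\<integral>\<^sup>+e. (\<Sum>k. ennreal (y ^ k) * epow \<gamma> (F k e)) \<partial>S)"
  proof (rule nn_integral_mono)
    fix e
    have "epow \<gamma> (\<Sum>k. ennreal (exp (- u * real k)) * F k e) \<le> (\<Sum>k. epow \<gamma> (ennreal (exp (- u * real k)) * F k e))"
      by (rule epow_suminf_le[OF assms(1,2)])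
    also have "\<dots> = (\<Sum>k. ennreal (y ^ k) * epow \<gamma> (F k e))"
      by (simp add: epow_mult epow_ennreal y_def exp_powr_real exp_of_nat_mult[symmetric] mult_ac)
    finally show "epow \<gamma> (\<Sum>k. ennreal (exp (- u * real k)) * F k e) \<le> (\<Sum>k. ennreal (y ^ k) * epow \<gamma> (F k e))" .
  qed
  also have "\<dots> = (\<Sum>k. \<integral>\<^sup>+e. ennreal (y ^ k) * epow \<gamma> (F k e) \<partial>S)"
    by (rule nn_integral_suminf) auto
  also have "\<dots> \<le> (\<Sum>k. ennreal (y ^ k) * ennreal D)"
    using bound by (intro suminf_le) (auto simp: nn_integral_cmult frac_moment_def intro!: mult_left_mono)
  also have "\<dots> = (\<Sum>k. ennreal (y ^ k)) * ennreal D" by simp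
  also have "(\<Sum>k. ennreal (y ^ k)) = ennreal (1 / (1 - y))"
    using y by (intro suminf_ennreal_eq geometric_sums) auto
  also have "\<dots> * ennreal D < \<infinity>" by (simp add: ennreal_mult_less_top)
  finally have "AE e in S. epow \<gamma> (\<Sum>k. ennreal (exp (- u * real k)) * F k e) \<noteq> \<infinity>"
    by (intro nn_integral_noteq_infinite) auto
  then show ?thesis by eventually_elim (auto simp: less_top[symmetric])
qed

text \<open>Stretches of jumps up to \<open>m\<close> cost a factor of order \<open>m\<^sup>2\<close> in fractional moments, and the penalty \<open>m powr (- 3 / \<gamma>)\<close> on
  longer jumps contributes \<open>m powr - 3\<close>. For large \<open>m\<close> the product is at most \<open>1 / 2\<close>.\<close>

lemma band_series_finite:
  fixes \<gamma> u u' Cb w0 c3 :: real and m :: nat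
  assumes \<gamma>: "0 < \<gamma>" "\<gamma> \<le> 1" and pos: "0 < u" "0 < u'" "0 < Cb" "0 \<le> w0" "0 \<le> c3"
    and B: "\<And>n. frac_moment \<gamma> (pinned_pf \<kappa> n) \<le> ennreal (Cb * (real n + 1))"
    and w0: "frac_moment \<gamma> (\<lambda>e. e 0) \<le> ennreal w0"
    and short: "\<And>r. r \<le> m \<Longrightarrow> \<kappa>' r \<le> ennreal (exp (- u)) * \<kappa> r"
    and long: "\<And>r. m < r \<Longrightarrow> \<kappa>' r \<le> ennreal (real m powr (- (3 / \<gamma>))) * \<kappa>3 r"
    and c3: "(\<Sum>r. epow \<gamma> (\<kappa>3 (Suc r))) \<le> ennreal c3"
    and m: "1 \<le> m" "2 * level_constant \<gamma> u Cb * c3 * w0 \<le> real m"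
  shows "AE e in S. (\<Sum>k. ennreal (exp (- u' * real k)) * contact_sum \<kappa>' k e) < \<infinity>"
proof (rule AE_finite_of_frac_moment[OF \<gamma> pos(2)])
  define D where "D = (real m)\<^sup>2 * level_constant \<gamma> u Cb"
  have "0 < 1 - exp (- (u * \<gamma> / 2))" using \<gamma> pos by simp
  then have lc: "0 \<le> level_constant \<gamma> u Cb" using pos unfolding level_constant_def
    by (intro divide_nonneg_pos mult_nonneg_nonneg) auto
  then have D0: "0 \<le> D" by (simp add: D_def)
  define k1 where "k1 r = (if r \<le> m then \<kappa>' r else 0)" for r
  define k2 where "k2 r = (if r \<le> m then 0 else \<kappa>' r)" for r
  have eq: "\<kappa>' = (\<lambda>r. k1 r + k2 r)" by (auto simp: k1_def k2_def)
  show "frac_moment \<gamma> (contact_sum \<kappa>' k) \<le> ennreal (2 * D)" for k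
  proof -
    have "(\<Sum>r. epow \<gamma> (k2 (Suc r))) \<le> (\<Sum>r. ennreal (real m powr (-3)) * epow \<gamma> (\<kappa>3 (Suc r)))"
    proof (intro suminf_le)
      fix r
      have "epow \<gamma> (ennreal (real m powr (- (3 / \<gamma>))) * \<kappa>3 (Suc r)) = ennreal (real m powr (-3)) * epow \<gamma> (\<kappa>3 (Suc r))"
        using \<gamma> by (simp add: epow_mult epow_ennreal powr_powr)
      moreover have "k2 (Suc r) \<le> ennreal (real m powr (- (3 / \<gamma>))) * \<kappa>3 (Suc r)"
        using long[of "Suc r"] by (simp add: k2_def)
      ultimately show "epow \<gamma> (k2 (Suc r)) \<le> ennreal (real m powr (-3)) * epow \<gamma> (\<kappa>3 (Suc r))"
        using epow_mono[OF \<gamma>(1)] by metis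
    qed auto
    also have "\<dots> \<le> ennreal (real m powr (-3)) * ennreal c3"
      using c3 by (simp add: mult_left_mono)
    finally have k2: "(\<Sum>r. epow \<gamma> (k2 (Suc r))) \<le> ennreal (real m powr (-3) * c3)"
      using pos by (simp add: ennreal_mult)
    have "ennreal D * ((\<Sum>r. epow \<gamma> (k2 (Suc r))) * frac_moment \<gamma> (\<lambda>e. e 0)) \<le>
        ennreal D * (ennreal (real m powr (-3) * c3) * ennreal w0)"
      by (intro mult_left_mono mult_mono k2 w0) auto
    also have "\<dots> = ennreal (D * (real m powr (-3) * c3 * w0))"
      using D0 pos by (simp add: ennreal_mult)
    also have "\<dots> \<le> ennreal (1 / 2)"
    proof (rule ennreal_leI)
      have m3: "(real m)\<^sup>2 * real m powr (-3) = 1 / real m"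
        using m(1) by (simp add: powr_minus_divide powr_numeral power2_eq_square power3_eq_cube)
      have "D * (real m powr (-3) * c3 * w0) = ((real m)\<^sup>2 * real m powr (-3)) * (level_constant \<gamma> u Cb * c3 * w0)"
        by (simp add: D_def mult_ac)
      also have "\<dots> \<le> 1 / 2" unfolding m3 using m by (simp add: field_simps)
      finally show "D * (real m powr (-3) * c3 * w0) \<le> 1 / 2" .
    qed
    also have "ennreal (1 / 2) = 1 / 2" by (metis divide_ennreal ennreal_1 ennreal_numeral zero_le_numeral zero_le_one zero_less_numeral)
    finally have half: "ennreal D * ((\<Sum>r. epow \<gamma> (k2 (Suc r))) * frac_moment \<gamma> (\<lambda>e. e 0)) \<le> 1 / 2" .
    have "frac_moment \<gamma> (contact_sum (\<lambda>r. k1 r + k2 r) k) \<le> 2 * ennreal D"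
    proof (rule frac_moment_renewal_bound[OF \<gamma> _ _ B _ half])
      show "k1 r = 0" if "m < r" for r using that by (simp add: k1_def)
      show "k1 r \<le> ennreal (exp (- u)) * \<kappa> r" for r using short[of r] by (simp add: k1_def)
      show "(\<Sum>k. epow \<gamma> (ennreal (exp (- u))) ^ k * (\<Sum>n\<le>k * m. ennreal (Cb * (real n + 1)))) \<le> ennreal D"
        unfolding D_def by (rule short_jump_series_le) (use \<gamma> pos m in auto)
    qed
    then show ?thesis using D0 by (simp add: eq ennreal_mult)
  qed
qed measurable


lemma long_jump_moment_finite:
  fixes K :: "nat \<Rightarrow> real" and x \<gamma> p :: real
  assumes "0 < \<gamma>" "\<And>r. 0 \<le> K r" and up: "\<forall>\<^sub>F r in sequentially. K r \<le> real r powr x"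
    and p: "(x - p) * \<gamma> < - 1"
  shows "(\<Sum>r. epow \<gamma> (ennreal (K (Suc r)) * ennreal (exp (- p * ln (real (Suc r)))))) < \<infinity>"
proof -
  have e: "epow \<gamma> (ennreal (K r) * ennreal (exp (- p * ln (real r)))) = ennreal ((K r * real r powr (- p)) powr \<gamma>)"
    if "0 < r" for r
    using assms(2)[of r] that by (simp add: ennreal_mult[symmetric] epow_ennreal powr_def)
  have "summable (\<lambda>r. (K r * real r powr (- p)) powr \<gamma>)"
  proof (rule summable_comparison_test_ev)
    show "summable (\<lambda>r. real r powr ((x - p) * \<gamma>))"
      using p by (simp add: summable_real_powr_iff)
    show "\<forall>\<^sub>F r in sequentially. norm ((K r * real r powr (- p)) powr \<gamma>) \<le> real r powr ((x - p) * \<gamma>)"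
      using up
    proof eventually_elim
      case (elim r)
      have "K r * real r powr (- p) \<le> real r powr x * real r powr (- p)"
        using elim by (intro mult_right_mono) auto
      then have "(K r * real r powr (- p)) powr \<gamma> \<le> (real r powr x * real r powr (- p)) powr \<gamma>"
        using assms by (intro powr_mono2) auto
      also have "\<dots> = real r powr ((x - p) * \<gamma>)" by (simp add: powr_add[symmetric] powr_powr)
      finally show ?case by simp
    qed
  qed
  then have "summable (\<lambda>r. (K (Suc r) * real (Suc r) powr (- p)) powr \<gamma>)"
    by (subst summable_Suc_iff)
  then have "(\<Sum>r. ennreal ((K (Suc r) * real (Suc r) powr (- p)) powr \<gamma>)) < \<infinity>"
    by (simp only: suminf_ennreal2 powr_ge_zero infinity_ennreal_def ennreal_less_top)
  moreover have "(\<Sum>r. epow \<gamma> (ennreal (K (Suc r)) * ennreal (exp (- p * ln (real (Suc r)))))) =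
      (\<Sum>r. ennreal ((K (Suc r) * real (Suc r) powr (- p)) powr \<gamma>))"
    by (intro suminf_cong e) simp
  ultimately show ?thesis by (simp only:)
qed

text \<open>A first moment computation: the mean of the sum over \<open>k\<close> contacts is a \<open>k\<close>-th power.\<close>

lemma annealed_series_finite:
  assumes c: "(\<Sum>r. \<kappa> (Suc r)) * (\<integral>\<^sup>+e. e 0 \<partial>S) \<le> ennreal q" and q: "0 \<le> q" "q < 1"
  shows "AE e in S. (\<Sum>k. contact_sum \<kappa> k e) < \<infinity>"
proof -
  have pw: "(\<integral>\<^sup>+e. contact_sum \<kappa> k e \<partial>S) \<le> ennreal (q ^ k)" for k
  proof (induction k)
    case 0
    then show ?case by (simp add: P.emeasure_space_1[simplified])
  next
    case (Suc k)
    have "(\<integral>\<^sup>+e. contact_sum \<kappa> (Suc k) e \<partial>S) =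
      ((\<Sum>r. \<kappa> (Suc r)) * (\<integral>\<^sup>+e. e 0 \<partial>S)) * (\<integral>\<^sup>+e. contact_sum \<kappa> k e \<partial>S)"
      using nn_integral_step_op[of "contact_sum \<kappa> k" \<kappa>] by simp
    also have "\<dots> \<le> ennreal q * ennreal (q ^ k)" by (intro mult_mono c Suc) auto
    finally show ?case using q by (simp add: ennreal_mult)
  qed
  have "(\<integral>\<^sup>+e. (\<Sum>k. contact_sum \<kappa> k e) \<partial>S) = (\<Sum>k. \<integral>\<^sup>+e. contact_sum \<kappa> k e \<partial>S)"
    by (rule nn_integral_suminf) auto
  also have "\<dots> \<le> (\<Sum>k. ennreal (q ^ k))" by (intro suminf_le pw) auto
  also have "\<dots> = ennreal (1 / (1 - q))"
    using q by (intro suminf_ennreal_eq geometric_sums) auto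
  finally have "(\<integral>\<^sup>+e. (\<Sum>k. contact_sum \<kappa> k e) \<partial>S) \<noteq> \<infinity>"
    by (auto simp: top_unique)
  then have "AE e in S. (\<Sum>k. contact_sum \<kappa> k e) \<noteq> \<infinity>"
    by (intro nn_integral_noteq_infinite) auto
  then show ?thesis by (simp add: less_top)
qed

text \<open>The gain \<open>exp (- u)\<close> per contact is spent in four equal parts: two pay for the penalties on the
  jumps, one for the polynomial moments of the stretches, and one makes the series converge. The choice of
  \<open>\<gamma>\<close> lies between the requirements that \<open>\<gamma> < 1 / a\<close> with \<open>a > 1 + \<alpha>\<close> and that the \<open>\<gamma>\<close>-th powers of the
  jump probabilities, helped by half of the penalty \<open>\<theta>'\<close>, are summable.\<close>

theorem delocalised_series_finite:
  fixes K :: "nat \<Rightarrow> real" and \<alpha> u \<eta> mu w1 :: real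
  assumes K0: "\<And>r. 0 \<le> K r" and alpha: "0 \<le> \<alpha>"
    and K: "\<And>s. 0 < s \<Longrightarrow> \<forall>\<^sub>F r in sequentially. real r powr (- (1 + \<alpha>) - s) \<le> K r \<and> K r \<le> real r powr (- (1 + \<alpha>) + s)"
    and mean: "(\<Sum>r. ennreal (K (Suc r) * real (Suc r))) \<le> ennreal mu" "0 \<le> mu"
    and w1: "(\<integral>\<^sup>+e. e 0 \<partial>S) \<le> ennreal w1" "0 \<le> w1"
    and \<eta>: "0 < \<eta>" "0 < measure S {e. ennreal \<eta> \<le> e 0}"
    and sub: "\<And>\<delta>. 0 < \<delta> \<Longrightarrow> AE e in S. \<forall>\<^sub>F n in sequentially. pinned_pf (\<lambda>r. ennreal (K r)) n e \<le> ennreal (exp (\<delta> * real n))"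
    and "0 < u"
  shows "AE e in S. (\<Sum>k. ennreal (exp (- u * real k)) * contact_sum (\<lambda>r. ennreal (K r)) k e) < \<infinity>"
proof -
  \<comment> \<open>the annealed weight of a jump tilted by \<open>exp (- C) * r\<close> is at most \<open>1 / 2\<close>\<close>
  define C where "C = ln (2 * (mu * w1 + 1))"
  have "0 \<le> mu * w1" using mean w1 by simp
  then have C0: "0 < C" unfolding C_def by (intro ln_gt_zero) simp
  define \<theta>' where "\<theta>' = u / (4 * C)"
  have \<theta>': "0 < \<theta>'" "\<theta>' * C = u / 4" using C0 \<open>0 < u\<close> by (auto simp: \<theta>'_def)
  define a where "a = 1 + \<alpha> + \<theta>' / 8"
  define \<gamma> where "\<gamma> = 1 / (1 + \<alpha> + \<theta>' / 4)"
  have \<gamma>: "0 < \<gamma>" "\<gamma> \<le> 1" "\<gamma> < 1 / a"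
    using alpha \<theta>' by (auto simp: \<gamma>_def a_def field_simps add_pos_pos add_nonneg_pos)
  \<comment> \<open>the part \<open>3 / \<gamma>\<close> beats the stretches below the band, the part \<open>\<theta>' / 2\<close> makes long jumps summable\<close>
  define \<theta> where "\<theta> = 3 / \<gamma> + \<theta>' / 2"
  have \<theta>: "0 < \<theta>" using \<gamma> \<theta>' by (simp add: \<theta>_def add_pos_pos)
  obtain r0 where r0: "0 < r0" "\<And>r. r0 \<le> r \<Longrightarrow> real r powr (- a) \<le> K r"
  proof -
    have "\<forall>\<^sub>F r in sequentially. real r powr (- a) \<le> K r"
      using K[of "\<theta>' / 8"] \<theta>' by (simp add: a_def eventually_conj_iff algebra_simps)
    then obtain r1 where "\<And>r. r1 \<le> r \<Longrightarrow> real r powr (- a) \<le> K r" by (auto simp: eventually_sequentially)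
    then show ?thesis by (intro that[of "Suc r1"]) auto
  qed
  have a0: "0 < a" using alpha \<theta>' by (simp add: a_def add_pos_pos add_nonneg_pos)
  obtain Cb where Cb: "0 < Cb" "\<And>n. frac_moment \<gamma> (pinned_pf (\<lambda>r. ennreal (K r)) n) \<le> ennreal (Cb * (real n + 1))"
    using frac_moment_pinned_pf_bound[of r0 1 a "\<lambda>r. ennreal (K r)" \<eta> \<gamma>] r0 a0 \<eta> sub \<gamma> by (auto intro!: ennreal_leI)
  have w0: "frac_moment \<gamma> (\<lambda>e. e 0) \<le> ennreal (1 + w1)"
  proof -
    have "epow \<gamma> x \<le> 1 + x" for x
    proof (cases x)
      case (real r)
      have "r powr \<gamma> \<le> 1 + r"
      proof (cases "r \<le> 1")
        case True
        then show ?thesis using real \<gamma> powr_mono2[of \<gamma> r 1] by simp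
      next
        case False
        then show ?thesis using real \<gamma> powr_mono[of \<gamma> 1 r] by simp
      qed
      then show ?thesis using real by (simp add: epow_ennreal ennreal_plus[symmetric] ennreal_leI flip: ennreal_1 del: ennreal_plus)
    qed simp
    then have "frac_moment \<gamma> (\<lambda>e. e 0) \<le> (\<integral>\<^sup>+e. 1 + e 0 \<partial>S)"
      unfolding frac_moment_def by (intro nn_integral_mono) auto
    also have "\<dots> = 1 + (\<integral>\<^sup>+e. e 0 \<partial>S)"
      by (subst nn_integral_add) (auto simp: P.emeasure_space_1[simplified])
    also have "\<dots> \<le> 1 + ennreal w1" using w1 by (intro add_left_mono) auto
    finally show ?thesis using w1 by simp
  qed
  define k3 where "k3 r = ennreal (K r) * ennreal (exp (- (\<theta>' / 2) * ln (real r)))" for r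
  have "(\<Sum>r. epow \<gamma> (k3 (Suc r))) < \<infinity>"
    unfolding k3_def
  proof (rule long_jump_moment_finite[OF \<gamma>(1) K0])
    show "\<forall>\<^sub>F r in sequentially. K r \<le> real r powr (- (1 + \<alpha>) + \<theta>' / 8)"
      using K[of "\<theta>' / 8"] \<theta>' by (simp add: eventually_conj_iff)
    show "(- (1 + \<alpha>) + \<theta>' / 8 - \<theta>' / 2) * \<gamma> < - 1"
      using alpha \<theta>' by (simp add: \<gamma>_def field_simps add_pos_pos add_nonneg_pos)
  qed
  then obtain c3 where c3: "0 \<le> c3" "(\<Sum>r. epow \<gamma> (k3 (Suc r))) \<le> ennreal c3"
    by (metis ennreal_cases infinity_ennreal_def less_irrefl order_refl)
  define N0 where "N0 = max 1 (nat \<lceil>2 * level_constant \<gamma> (u / 4) Cb * c3 * (1 + w1)\<rceil>)"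
  \<comment> \<open>half of the small penalty turns a jump above \<open>R j powr q\<close> into a factor of at most \<open>R j powr (- 3 / \<gamma>)\<close>\<close>
  define q where "q = 6 / (\<gamma> * \<theta>')"
  define R where "R = rec_nat N0 (\<lambda>_ m. m + nat \<lceil>real m powr q\<rceil>)"
  have R0: "R 0 = N0" and RS: "R (Suc j) = R j + nat \<lceil>real (R j) powr q\<rceil>" for j
    by (auto simp: R_def)
  have R_mono: "mono R" by (rule incseq_SucI[unfolded]) (simp add: RS)
  have R_ge: "1 \<le> R j" "2 * level_constant \<gamma> (u / 4) Cb * c3 * (1 + w1) \<le> real (R j)" for j
  proof -
    have "N0 \<le> R j" using monoD[OF R_mono, of 0 j] by (simp add: R0)
    then show "1 \<le> R j" by (simp add: N0_def)
    have "2 * level_constant \<gamma> (u / 4) Cb * c3 * (1 + w1) \<le> real N0"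
      unfolding N0_def by (meson max.cobounded2 of_nat_ceiling of_nat_le_iff order_trans)
    then show "2 * level_constant \<gamma> (u / 4) Cb * c3 * (1 + w1) \<le> real (R j)"
      using \<open>N0 \<le> R j\<close> by (meson of_nat_le_iff order_trans)
  qed
  have R_pow: "real (R j) powr q \<le> real (R (Suc j))" for j
  proof -
    have "real (R j) powr q \<le> real (nat \<lceil>real (R j) powr q\<rceil>)" by (rule of_nat_ceiling)
    then show ?thesis unfolding RS of_nat_add by linarith
  qed
  \<comment> \<open>so many bands that the share of one of them makes the large penalty cost at most \<open>u / 4\<close> per jump\<close>
  define J where "J = Suc (nat \<lceil>4 * \<theta> * C / u\<rceil>)"
  have J: "0 < J" "\<theta> * C / real J + \<theta>' * C \<le> u / 2"
  proof -
    have "4 * \<theta> * C / u \<le> real J" unfolding J_def using of_nat_ceiling[of "4 * \<theta> * C / u"] by linarith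
    then have "4 * (\<theta> * C) \<le> real J * u" using \<open>0 < u\<close> by (simp add: field_simps)
    then have "\<theta> * C / real J \<le> u / 4" by (simp add: J_def field_simps)
    then show "\<theta> * C / real J + \<theta>' * C \<le> u / 2" unfolding \<theta>'(2) by linarith
  qed (simp add: J_def)
  let ?k0 = "\<lambda>r. ennreal (K r) * ennreal (exp (- C + ln (real r)))"
  let ?t = "scale_exponent R \<theta> \<theta>'"
  let ?kj = "\<lambda>j r. ennreal (K r) * ennreal (exp (u / 2 - ?t j r * ln (real r)))"
  have first: "AE e in S. (\<Sum>k. contact_sum ?k0 k e) < \<infinity>"
  proof (rule annealed_series_finite)
    have "(\<Sum>r. ?k0 (Suc r)) = (\<Sum>r. ennreal (exp (- C)) * ennreal (K (Suc r) * real (Suc r)))"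
    proof (rule suminf_cong)
      fix r
      have "exp (- C + ln (real (Suc r))) = exp (- C) * real (Suc r)" unfolding exp_add by simp
      then show "?k0 (Suc r) = ennreal (exp (- C)) * ennreal (K (Suc r) * real (Suc r))"
        using K0[of "Suc r"] by (simp only: ennreal_mult[symmetric] exp_ge_zero mult_nonneg_nonneg of_nat_0_le_iff) (simp only: mult_ac)
    qed
    also have "\<dots> = ennreal (exp (- C)) * (\<Sum>r. ennreal (K (Suc r) * real (Suc r)))"
      by (rule ennreal_suminf_cmult)
    also have "\<dots> \<le> ennreal (exp (- C)) * ennreal mu" using mean by (intro mult_left_mono) auto
    finally have "(\<Sum>r. ?k0 (Suc r)) * (\<integral>\<^sup>+e. e 0 \<partial>S) \<le> ennreal (exp (- C)) * ennreal mu * ennreal w1"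
      using w1 by (intro mult_mono) auto
    also have "\<dots> = ennreal (exp (- C) * (mu * w1))"
      using mean w1 by (simp add: ennreal_mult mult.assoc)
    also have "\<dots> \<le> ennreal (1 / 2)"
    proof (rule ennreal_leI)
      have "0 \<le> mu * w1" using mean w1 by simp
      moreover have "exp (- C) = 1 / (2 * (mu * w1 + 1))"
        using \<open>0 \<le> mu * w1\<close> by (simp add: C_def exp_minus inverse_eq_divide add_nonneg_pos)
      moreover have "1 / (2 * (x + 1)) * x \<le> 1 / 2" if "0 \<le> x" for x :: real
        using that by (simp add: field_simps)
      ultimately show "exp (- C) * (mu * w1) \<le> 1 / 2" by metis
    qed
    finally show "(\<Sum>r. ?k0 (Suc r)) * (\<integral>\<^sup>+e. e 0 \<partial>S) \<le> ennreal (1 / 2)" .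
  qed auto
  have band: "AE e in S. (\<Sum>k. ennreal (exp (- (u / 4) * real k)) *
      contact_sum (\<lambda>r. ennreal (exp (- (3 * u / 4))) * ?kj j r) k e) < \<infinity>" for j
  proof (rule band_series_finite[OF \<gamma>(1,2) _ _ Cb(1) _ c3(1) Cb(2) w0 _ _ c3(2) R_ge(1) R_ge(2)[of j]])
    show "0 < u / 4" "0 < u / 4" "0 \<le> 1 + w1" using \<open>0 < u\<close> w1 by auto
    fix r
    have eq: "ennreal (exp (- (3 * u / 4))) * ?kj j r = ennreal (exp (- (u / 4)) * exp (- ?t j r * ln (real r))) * ennreal (K r)"
      using K0[of r] by (simp add: ennreal_mult[symmetric] exp_add[symmetric] mult_ac)
    show "ennreal (exp (- (3 * u / 4))) * ?kj j r \<le> ennreal (exp (- (u / 4))) * ennreal (K r)" if "r \<le> R j"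
      unfolding eq using that by (simp add: scale_exponent_def)
    show "ennreal (exp (- (3 * u / 4))) * ?kj j r \<le> ennreal (real (R j) powr (- (3 / \<gamma>))) * k3 r" if r: "R j < r"
    proof -
      have Rj: "0 < real (R j)" using R_ge(1)[of j] by simp
      have r0: "0 < real r" using r by simp
      have "exp (- ?t j r * ln (real r)) \<le> real (R j) powr (- (3 / \<gamma>)) * exp (- (\<theta>' / 2) * ln (real r))"
      proof (cases "r \<le> R (Suc j)")
        case True
        have "exp (- ?t j r * ln (real r)) = real r powr (- (3 / \<gamma>)) * exp (- (\<theta>' / 2) * ln (real r))"
          using True r r0 by (simp add: scale_exponent_def \<theta>_def powr_def exp_add[symmetric] algebra_simps)
        also have "\<dots> \<le> real (R j) powr (- (3 / \<gamma>)) * exp (- (\<theta>' / 2) * ln (real r))"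
          using r Rj \<gamma> by (intro mult_right_mono powr_mono2') auto
        finally show ?thesis .
      next
        case False
        have "exp (- ?t j r * ln (real r)) = real r powr (- (\<theta>' / 2)) * exp (- (\<theta>' / 2) * ln (real r))"
          using False r r0 by (simp add: scale_exponent_def powr_def exp_add[symmetric] algebra_simps)
        also have "\<dots> \<le> (real (R j) powr q) powr (- (\<theta>' / 2)) * exp (- (\<theta>' / 2) * ln (real r))"
          using False R_pow[of j] Rj \<theta>' by (intro mult_right_mono powr_mono2') auto
        also have "(real (R j) powr q) powr (- (\<theta>' / 2)) = real (R j) powr (- (3 / \<gamma>))"
          using \<theta>' \<gamma> by (simp add: powr_powr q_def)
        finally show ?thesis .
      qed
      moreover have "exp (- (u / 4)) \<le> 1" using \<open>0 < u\<close> by simp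
      ultimately have "exp (- (u / 4)) * exp (- ?t j r * ln (real r)) \<le> 1 * (real (R j) powr (- (3 / \<gamma>)) * exp (- (\<theta>' / 2) * ln (real r)))"
        by (intro mult_mono) auto
      then have "exp (- (u / 4)) * exp (- ?t j r * ln (real r)) * K r \<le> real (R j) powr (- (3 / \<gamma>)) * (K r * exp (- (\<theta>' / 2) * ln (real r)))"
        using mult_right_mono[OF _ K0[of r]] by (metis mult.assoc mult.commute mult_1)
      then show ?thesis unfolding eq k3_def using K0[of r]
        by (simp only: ennreal_mult[symmetric] ennreal_leI exp_ge_zero powr_ge_zero mult_nonneg_nonneg)
    qed
  qed
  have "AE e in S. \<forall>j<J. (\<Sum>k. ennreal (exp (- (u / 4) * real k)) *
      contact_sum (\<lambda>r. ennreal (exp (- (3 * u / 4))) * ?kj j r) k e) < \<infinity>"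
    by (intro AE_all_countable[THEN iffD2] allI) (use band in \<open>auto elim: eventually_mono\<close>)
  with first show ?thesis
  proof eventually_elim
    case (elim e)
    have sc: "ennreal (exp (- u * real k)) * contact_sum (?kj j) k e = ennreal (exp (- (u / 4) * real k)) *
      contact_sum (\<lambda>r. ennreal (exp (- (3 * u / 4))) * ?kj j r) k e" for j k
    proof -
      have "exp (- u * real k) = exp (- (u / 4) * real k) * exp (- (3 * u / 4)) ^ k"
        by (simp add: exp_of_nat_mult[symmetric] exp_add[symmetric] algebra_simps)
      then have "ennreal (exp (- u * real k)) = ennreal (exp (- (u / 4) * real k)) * ennreal (exp (- (3 * u / 4))) ^ k"
        by (simp add: ennreal_mult ennreal_power)
      then show ?thesis unfolding step_op_scale_power by (simp add: mult.assoc)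
    qed
    have "(\<Sum>k. ennreal (exp (- u * real k)) * contact_sum (\<lambda>r. ennreal (K r)) k e) \<le>
        (\<Sum>k. contact_sum ?k0 k e + (\<Sum>j<J. ennreal (exp (- u * real k)) * contact_sum (?kj j) k e))"
    proof (intro suminf_le)
      fix k
      have le1: "ennreal (exp (- u * real k)) \<le> 1" using \<open>0 < u\<close> by simp
      have "ennreal (exp (- u * real k)) * contact_sum (\<lambda>r. ennreal (K r)) k e \<le>
          ennreal (exp (- u * real k)) * (contact_sum ?k0 k e + (\<Sum>j<J. contact_sum (?kj j) k e))"
        by (intro mult_left_mono step_op_scale_decomposition C0 J R_mono) (use \<theta> \<theta>' in auto)
      also have "\<dots> = ennreal (exp (- u * real k)) * contact_sum ?k0 k e +
          (\<Sum>j<J. ennreal (exp (- u * real k)) * contact_sum (?kj j) k e)"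
        by (simp add: distrib_left sum_distrib_left)
      also have "\<dots> \<le> 1 * contact_sum ?k0 k e +
          (\<Sum>j<J. ennreal (exp (- u * real k)) * contact_sum (?kj j) k e)"
        by (intro add_right_mono mult_right_mono le1) auto
      finally show "ennreal (exp (- u * real k)) * contact_sum (\<lambda>r. ennreal (K r)) k e \<le>
        contact_sum ?k0 k e + (\<Sum>j<J. ennreal (exp (- u * real k)) * contact_sum (?kj j) k e)"
        by simp
    qed auto
    also have "\<dots> = (\<Sum>k. contact_sum ?k0 k e) +
        (\<Sum>j<J. \<Sum>k. ennreal (exp (- u * real k)) * contact_sum (?kj j) k e)"
      by (subst suminf_add[symmetric]) (auto intro!: arg_cong2[where f=plus] suminf_sum)
    also have "\<dots> < \<infinity>"
      unfolding sc using elim by (auto simp: less_top[symmetric])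
    finally show ?case .
  qed
qed

end

section \<open>The partition function as a renewal path sum\<close>

text \<open>The partition function, in which \<open>n\<close> may or may not be a contact, by the first jump; the last series is the
  probability that the first jump overshoots \<open>n\<close>.\<close>

fun free_pf :: "(nat \<Rightarrow> ennreal) \<Rightarrow> nat \<Rightarrow> (nat \<Rightarrow> ennreal) \<Rightarrow> ennreal" where
  "free_pf \<kappa> 0 e = 1"
| "free_pf \<kappa> (Suc n) e = (\<Sum>r\<le>n. \<kappa> (Suc r) * e r * free_pf \<kappa> (n - r) (env_shift (Suc r) e)) + (\<Sum>r. \<kappa> (r + Suc (Suc n)))"

lemma pinned_pf_le_free_pf: "pinned_pf \<kappa> n e \<le> free_pf \<kappa> n e"
proof (induction n arbitrary: e rule: less_induct)
  case (less n)
  show ?case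
  proof (cases n)
    case (Suc k)
    have "(\<Sum>r\<le>k. \<kappa> (Suc r) * e r * pinned_pf \<kappa> (k - r) (env_shift (Suc r) e)) \<le>
        (\<Sum>r\<le>k. \<kappa> (Suc r) * e r * free_pf \<kappa> (k - r) (env_shift (Suc r) e))"
      using Suc by (intro sum_mono mult_left_mono less) auto
    also have "\<dots> \<le> free_pf \<kappa> n e" using Suc by simp
    finally show ?thesis using Suc by simp
  qed simp
qed

lemma free_pf_const_le_1:
  assumes "(\<Sum>r. \<kappa> (Suc r)) \<le> 1" "w \<le> 1"
  shows "free_pf \<kappa> n (\<lambda>_. w) \<le> 1"
proof (induction n rule: less_induct)
  case (less n)
  show ?case
  proof (cases n)
    case (Suc k)
    have "free_pf \<kappa> n (\<lambda>_. w) \<le> (\<Sum>r\<le>k. \<kappa> (Suc r) * 1 * 1) + (\<Sum>r. \<kappa> (r + Suc (Suc k)))"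
      unfolding Suc free_pf.simps env_shift_def
      using Suc assms by (intro add_right_mono sum_mono mult_mono less) auto
    also have "\<dots> = (\<Sum>r. \<kappa> (Suc r))"
      using suminf_offset[of "\<lambda>r. \<kappa> (Suc r)" "Suc k"] by (simp add: lessThan_Suc_atMost add.commute)
    finally show ?thesis using assms by simp
  qed simp
qed

lemma sum_triangle_le:
  fixes h :: "nat \<Rightarrow> nat \<Rightarrow> ennreal"
  shows "(\<Sum>n<N. \<Sum>r\<le>n. h r (n - r)) \<le> (\<Sum>r<N. \<Sum>n<N. h r n)"
proof -
  have "(\<Sum>n<N. \<Sum>r\<le>n. h r (n - r)) = (\<Sum>n<N. \<Sum>r<N. if r \<le> n then h r (n - r) else 0)"
  proof (rule sum.cong[OF refl])
    fix n assume n: "n \<in> {..<N}"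
    have "(\<Sum>r\<le>n. h r (n - r)) = (\<Sum>r\<in>{..<N} \<inter> {r. r \<le> n}. h r (n - r))"
      using n by (intro sum.cong) auto
    then show "(\<Sum>r\<le>n. h r (n - r)) = (\<Sum>r<N. if r \<le> n then h r (n - r) else 0)"
      by (simp add: sum.inter_restrict)
  qed
  also have "\<dots> = (\<Sum>r<N. \<Sum>n<N. if r \<le> n then h r (n - r) else 0)" by (rule sum.swap)
  also have "\<dots> \<le> (\<Sum>r<N. \<Sum>n<N. h r n)"
  proof (rule sum_mono)
    fix r
    have "(\<Sum>n<N. if r \<le> n then h r (n - r) else 0) = (\<Sum>n\<in>{r..<N}. h r (n - r))"
      by (rule sum.mono_neutral_cong_right) auto
    also have "\<dots> = (\<Sum>n\<in>{0..<N - r}. h r n)"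
      by (subst sum.atLeastLessThan_shift_0) simp
    also have "\<dots> \<le> (\<Sum>n<N. h r n)" by (intro sum_mono2) auto
    finally show "(\<Sum>n<N. if r \<le> n then h r (n - r) else 0) \<le> (\<Sum>n<N. h r n)" .
  qed
  finally show ?thesis .
qed

lemma sum_tails_le: "(\<Sum>n. \<Sum>r. \<kappa> (r + Suc n)) \<le> (\<Sum>s. \<kappa> (Suc s) * of_nat (Suc s) :: ennreal)"
proof -
  have "(\<Sum>r. \<kappa> (r + Suc n)) \<le> (\<Sum>s. if n \<le> s then \<kappa> (Suc s) else 0)" for n
    using suminf_offset[of "\<lambda>s. if n \<le> s then \<kappa> (Suc s) else 0" n] by simp
  then have "(\<Sum>n. \<Sum>r. \<kappa> (r + Suc n)) \<le> (\<Sum>n. \<Sum>s. if n \<le> s then \<kappa> (Suc s) else 0)"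
    by (rule suminf_le) auto
  also have "\<dots> = (\<Sum>s. \<Sum>n. if n \<le> s then \<kappa> (Suc s) else 0)" by (rule suminf_commute_ennreal)
  also have "\<dots> = (\<Sum>s. \<kappa> (Suc s) * of_nat (Suc s))"
  proof (rule suminf_cong)
    fix s
    have "(\<Sum>n. if n \<le> s then \<kappa> (Suc s) else 0) = (\<Sum>n\<le>s. if n \<le> s then \<kappa> (Suc s) else 0)"
      by (rule suminf_finite) auto
    also have "\<dots> = of_nat (Suc s) * \<kappa> (Suc s)" by simp
    finally show "(\<Sum>n. if n \<le> s then \<kappa> (Suc s) else 0) = \<kappa> (Suc s) * of_nat (Suc s)" by (simp only: mult.commute)
  qed
  finally show ?thesis .
qed

text \<open>Every path is counted once for each position of \<open>n\<close> before its next contact, so the last jump contributes its mean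
  length. In the inductive form the constant \<open>m\<close> bounds the sum of all jump tails.\<close>

lemma sum_free_pf_le:
  assumes m: "1 + (\<Sum>n. \<Sum>r. \<kappa> (r + Suc (Suc n))) \<le> m"
  shows "(\<Sum>n<N. free_pf \<kappa> n e) \<le> m * (\<Sum>k<N. contact_sum \<kappa> k e)"
proof (induction N arbitrary: e)
  case (Suc N)
  let ?P = "\<lambda>e. \<Sum>k<N. contact_sum \<kappa> k e"
  have "(\<Sum>n<N. \<Sum>r\<le>n. \<kappa> (Suc r) * e r * free_pf \<kappa> (n - r) (env_shift (Suc r) e)) \<le>
      (\<Sum>r<N. \<Sum>n<N. \<kappa> (Suc r) * e r * free_pf \<kappa> n (env_shift (Suc r) e))"
    by (rule sum_triangle_le)
  also have "\<dots> = (\<Sum>r<N. \<kappa> (Suc r) * e r * (\<Sum>n<N. free_pf \<kappa> n (env_shift (Suc r) e)))"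
    by (simp add: sum_distrib_left)
  also have "\<dots> \<le> (\<Sum>r<N. \<kappa> (Suc r) * e r * (m * ?P (env_shift (Suc r) e)))"
    by (intro sum_mono mult_left_mono Suc.IH) auto
  also have "\<dots> \<le> (\<Sum>r. \<kappa> (Suc r) * e r * (m * ?P (env_shift (Suc r) e)))"
    by (rule sum_le_suminf) auto
  also have "\<dots> = (\<Sum>r. m * (\<kappa> (Suc r) * e r * ?P (env_shift (Suc r) e)))"
    by (intro suminf_cong) (simp only: mult_ac)
  also have "\<dots> = m * step_op \<kappa> ?P e"
    unfolding step_op_def by (rule ennreal_suminf_cmult)
  also have "\<dots> = m * (\<Sum>k<N. contact_sum \<kappa> (Suc k) e)" by (simp add: step_op_sum)
  finally have le: "(\<Sum>n<N. \<Sum>r\<le>n. \<kappa> (Suc r) * e r * free_pf \<kappa> (n - r) (env_shift (Suc r) e)) \<le>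
      m * (\<Sum>k<N. contact_sum \<kappa> (Suc k) e)" .
  have "1 + (\<Sum>n<N. \<Sum>r. \<kappa> (r + Suc (Suc n))) \<le> m"
    using m by (meson add_left_mono order_trans sum_le_suminf summableI finite_lessThan zero_le)
  with le have "1 + (\<Sum>n<N. \<Sum>r. \<kappa> (r + Suc (Suc n))) + (\<Sum>n<N. \<Sum>r\<le>n. \<kappa> (Suc r) * e r * free_pf \<kappa> (n - r) (env_shift (Suc r) e)) \<le>
      m + m * (\<Sum>k<N. contact_sum \<kappa> (Suc k) e)" by (intro add_mono)
  then show ?case
    by (simp add: sum.lessThan_Suc_shift sum.distrib distrib_left add_ac del: sum.lessThan_Suc)
qed simp

lemma suminf_free_pf_le:
  assumes "1 + (\<Sum>n. \<Sum>r. \<kappa> (r + Suc (Suc n))) \<le> m"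
  shows "(\<Sum>n. free_pf \<kappa> n e) \<le> m * (\<Sum>k. contact_sum \<kappa> k e)"
  unfolding suminf_eq_SUP[of "\<lambda>n. free_pf \<kappa> n e"]
proof (rule SUP_least)
  fix N
  have "(\<Sum>n<N. free_pf \<kappa> n e) \<le> m * (\<Sum>k<N. contact_sum \<kappa> k e)" by (rule sum_free_pf_le[OF assms])
  also have "\<dots> \<le> m * (\<Sum>k. contact_sum \<kappa> k e)"
    by (intro mult_left_mono sum_le_suminf) auto
  finally show "(\<Sum>n<N. free_pf \<kappa> n e) \<le> m * (\<Sum>k. contact_sum \<kappa> k e)" .
qed

lemma step_op_power_scale_env: "contact_sum \<kappa> k (\<lambda>i. c * e i) = c ^ k * contact_sum \<kappa> k e"
proof (induction k arbitrary: e)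
  case (Suc k)
  have sh: "env_shift n (\<lambda>i. c * e i) = (\<lambda>i. c * env_shift n e i)" for n by (simp add: env_shift_def)
  have "(\<Sum>r. \<kappa> (Suc r) * (c * e r) * (c ^ k * contact_sum \<kappa> k (env_shift (Suc r) e)))
      = (\<Sum>r. c * c ^ k * (\<kappa> (Suc r) * e r * contact_sum \<kappa> k (env_shift (Suc r) e)))"
    by (simp only: mult_ac)
  then show ?case by (simp add: step_op_def[of _ "(step_op _ ^^ k) _"] sh Suc.IH)
qed simp

context iid_weights
begin

lemma measurable_free_pf [measurable]: "free_pf \<kappa> n \<in> borel_measurable S"
proof (induction n rule: less_induct)
  case (less n)
  show ?case
  proof (cases n)
    case 0
    then show ?thesis by (simp add: free_pf.simps(1)[abs_def])
  next
    case (Suc k)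
    have [measurable]: "free_pf \<kappa> (k - r) \<in> borel_measurable S" if "r \<in> {..k}" for r
      by (rule less) (use Suc that in auto)
    show ?thesis unfolding Suc free_pf.simps[abs_def] by measurable
  qed
qed

text \<open>Distinct contacts see independent weights, so averaging the disorder replaces every weight by its mean.\<close>

lemma nn_integral_free_pf: "(\<integral>\<^sup>+e. free_pf \<kappa> n e \<partial>S) = free_pf \<kappa> n (\<lambda>_. \<integral>\<^sup>+e. e 0 \<partial>S)"
proof (induction n rule: less_induct)
  case (less n)
  show ?case
  proof (cases n)
    case 0
    then show ?thesis by (simp add: P.emeasure_space_1[simplified])
  next
    case (Suc k)
    have [measurable]: "(\<lambda>e. free_pf \<kappa> n (env_shift r e)) \<in> borel_measurable S" for n r
      by measurable
    have summand: "(\<integral>\<^sup>+e. \<kappa> (Suc r) * e r * free_pf \<kappa> (k - r) (env_shift (Suc r) e) \<partial>S) =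
        \<kappa> (Suc r) * (\<integral>\<^sup>+e. e 0 \<partial>S) * free_pf \<kappa> (k - r) (\<lambda>_. \<integral>\<^sup>+e. e 0 \<partial>S)" if "r \<le> k" for r
    proof -
      have "(\<integral>\<^sup>+e. (\<kappa> (Suc r) * e r) * free_pf \<kappa> (k - r) (env_shift (Suc r) e) \<partial>S) =
          (\<integral>\<^sup>+e. \<kappa> (Suc r) * e r \<partial>S) * (\<integral>\<^sup>+e. free_pf \<kappa> (k - r) e \<partial>S)"
        by (rule nn_integral_split) auto
      also have "(\<integral>\<^sup>+e. \<kappa> (Suc r) * e r \<partial>S) = \<kappa> (Suc r) * (\<integral>\<^sup>+e. e r \<partial>S)"
        by (rule nn_integral_cmult) auto
      also have "(\<integral>\<^sup>+e. e r \<partial>S) = (\<integral>\<^sup>+e. e 0 \<partial>S)"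
        by (rule nn_integral_coordinate[of "\<lambda>x. x"]) auto
      also have "(\<integral>\<^sup>+e. free_pf \<kappa> (k - r) e \<partial>S) = free_pf \<kappa> (k - r) (\<lambda>_. \<integral>\<^sup>+e. e 0 \<partial>S)"
        by (rule less) (use Suc that in auto)
      finally show ?thesis .
    qed
    have "(\<integral>\<^sup>+e. free_pf \<kappa> n e \<partial>S) = (\<Sum>r\<le>k. \<integral>\<^sup>+e. \<kappa> (Suc r) * e r * free_pf \<kappa> (k - r) (env_shift (Suc r) e) \<partial>S) + (\<Sum>r. \<kappa> (r + Suc (Suc k)))"
      unfolding Suc free_pf.simps
      by (subst nn_integral_add) (auto simp: nn_integral_sum P.emeasure_space_1[simplified])
    also have "\<dots> = free_pf \<kappa> n (\<lambda>_. \<integral>\<^sup>+e. e 0 \<partial>S)"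
    proof -
      have c: "env_shift r (\<lambda>_. x) = (\<lambda>_. x)" for r and x :: ennreal by (simp add: env_shift_def)
      show ?thesis unfolding Suc free_pf.simps c by (intro arg_cong2[where f=plus] sum.cong refl summand) auto
    qed
    finally show ?thesis .
  qed
qed

end

section \<open>Averaging the walk over the renewal process\<close>

definition contact_prod :: "nat set \<Rightarrow> nat \<Rightarrow> (nat \<Rightarrow> ennreal) \<Rightarrow> ennreal" where
  "contact_prod A n e = (\<Prod>j<n. if Suc j \<in> A then e j else 1)"

definition site_weight :: "real \<Rightarrow> real \<Rightarrow> (nat \<Rightarrow> real) \<Rightarrow> nat \<Rightarrow> ennreal" where
  "site_weight \<beta> h x j = ennreal (exp (\<beta> * x (Suc j) + h))"

lemma contact_prod_site_weight:
  "contact_prod A n (site_weight \<beta> h x) = ennreal (exp (\<Sum>i = 1..n. (\<beta> * x i + h) * indicator A i))"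
proof (induction n)
  case (Suc n)
  have "contact_prod A (Suc n) (site_weight \<beta> h x) =
      contact_prod A n (site_weight \<beta> h x) * ennreal (exp ((\<beta> * x (Suc n) + h) * indicator A (Suc n)))"
    by (simp add: contact_prod_def site_weight_def indicator_def)
  then show ?case by (simp add: Suc.IH ennreal_mult[symmetric] exp_add)
qed (simp add: contact_prod_def)

text \<open>The potential at \<open>n\<close> is the pinning Hamiltonian of the renewal set up to \<open>n\<close> minus \<open>\<epsilon> * n\<close>.\<close>

lemma mean_visits_eq:
  "mean_visits \<beta> h \<epsilon> x A = (\<Sum>n. ennreal (exp (- \<epsilon> * real n)) * contact_prod A n (site_weight \<beta> h x))"
proof -
  have "sym_potential (\<lambda>i. (h + \<beta> * x i) * indicator A i - \<epsilon>) (int n) =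
      - \<epsilon> * real n + (\<Sum>i = 1..n. (\<beta> * x i + h) * indicator A i)" for n
    by (simp add: sym_potential_def sum_subtractf add.commute)
  then show ?thesis
    unfolding mean_visits_def rwsre_law_def mean_visits_rw_law contact_prod_site_weight
    by (simp only: exp_add ennreal_mult exp_ge_zero)
qed

definition renewal_set :: "(nat \<Rightarrow> nat) \<Rightarrow> nat set" where
  "renewal_set \<rho> = range (\<lambda>k. \<Sum>i<k. \<rho> i)"

lemma zero_in_renewal_set: "0 \<in> renewal_set \<rho>"
  unfolding renewal_set_def by (rule range_eqI[of _ _ 0]) simp

lemma renewal_set_case_nat: "m \<in> renewal_set (case_nat r \<rho>) \<longleftrightarrow> m = 0 \<or> (\<exists>m'\<in>renewal_set \<rho>. m = r + m')"
proof -
  have "(\<Sum>i<Suc k. case_nat r \<rho> i) = r + (\<Sum>i<k. \<rho> i)" for k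
    by (simp add: sum.lessThan_Suc_shift del: sum.lessThan_Suc)
  then show ?thesis unfolding renewal_set_def image_iff
    by (metis (no_types, lifting) UNIV_I lessThan_0 not0_implies_Suc rangeE rangeI sum.empty)
qed

lemma contact_prod_first_jump:
  "contact_prod (renewal_set (case_nat (Suc r) \<rho>)) n e =
    (if r < n then e r * contact_prod (renewal_set \<rho>) (n - Suc r) (env_shift (Suc r) e) else 1)"
proof -
  let ?f = "\<lambda>j. if Suc j \<in> renewal_set (case_nat (Suc r) \<rho>) then e j else 1"
  have small: "?f j = 1" if "j < r" for j
    using that by (auto simp: renewal_set_case_nat)
  have at: "?f r = e r" using zero_in_renewal_set[of \<rho>] by (auto simp: renewal_set_case_nat)
  have big: "?f (Suc r + j) = (if Suc j \<in> renewal_set \<rho> then e (Suc r + j) else 1)" for j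
    by (auto simp: renewal_set_case_nat)
  show ?thesis
  proof (cases "r < n")
    case True
    have "(\<Prod>j<Suc r + k. ?f j) = e r * (\<Prod>j<k. if Suc j \<in> renewal_set \<rho> then e (Suc r + j) else 1)" for k
    proof (induction k)
      case 0
      have "(\<Prod>j<r. ?f j) = 1" by (intro prod.neutral) (use small in auto)
      then show ?case using at by simp
    next
      case (Suc k)
      have "(\<Prod>j<Suc r + Suc k. ?f j) = (\<Prod>j<Suc r + k. ?f j) * ?f (Suc r + k)" by simp
      also have "\<dots> = e r * (\<Prod>j<k. if Suc j \<in> renewal_set \<rho> then e (Suc r + j) else 1) *
          (if Suc k \<in> renewal_set \<rho> then e (Suc r + k) else 1)" unfolding Suc.IH big ..
      finally show ?case by (simp only: prod.lessThan_Suc mult.assoc)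
    qed
    moreover have "e (Suc r + j) = env_shift (Suc r) e j" for j by (simp add: env_shift_def add.commute)
    ultimately show ?thesis using True by (metis (no_types, lifting) contact_prod_def Suc_leI le_add_diff_inverse prod.cong)
  next
    case False
    have "(\<Prod>j<n. ?f j) = 1" by (intro prod.neutral) (use small False in auto)
    then show ?thesis using False by (simp add: contact_prod_def)
  qed
qed

locale renewal_increments = sequence_space M for M :: "nat measure" +
  assumes sets_M [measurable_cong]: "sets M = sets (count_space UNIV)"
    and no_zero: "emeasure M {0} = 0"
begin

lemma space_M [simp]: "space M = UNIV"
  using sets_eq_imp_space_eq[OF sets_M] by simp

lemma space_S [simp]: "space S = UNIV"
  by (simp add: space_PiM)

definition mass :: "nat \<Rightarrow> ennreal" where "mass r = emeasure M {r}"

lemma measurable_increment [measurable]: "(\<lambda>\<rho>. \<rho> i) \<in> S \<rightarrow>\<^sub>M count_space UNIV"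
proof -
  have "(\<lambda>\<rho>. \<rho> i) \<in> S \<rightarrow>\<^sub>M M" by (rule measurable_component_singleton) simp
  then show ?thesis by (simp add: measurable_cong_sets[OF refl sets_M])
qed

lemma measurable_renewal_time [measurable]: "(\<lambda>\<rho>. \<Sum>i<k. \<rho> i) \<in> S \<rightarrow>\<^sub>M count_space (UNIV :: nat set)"
  by (induction k) auto

lemma measurable_contact_prod [measurable]: "(\<lambda>\<rho>. contact_prod (renewal_set \<rho>) n e) \<in> borel_measurable S"
proof -
  have [measurable]: "Measurable.pred S (\<lambda>\<rho>. m \<in> renewal_set \<rho>)" for m
    unfolding renewal_set_def image_iff by measurable
  show ?thesis unfolding contact_prod_def by measurable
qed

lemma nn_integral_M: "(\<integral>\<^sup>+r. f r \<partial>M) = (\<Sum>r. mass (Suc r) * f (Suc r))"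
proof -
  have "(\<integral>\<^sup>+r. f r \<partial>M) = (\<integral>\<^sup>+r. (\<Sum>i. f i * indicator {i} r) \<partial>M)"
  proof (rule nn_integral_cong)
    fix r
    have "(\<Sum>i. f i * indicator {i} r) = (\<Sum>i\<in>{r}. f i * indicator {i} r)"
      by (rule suminf_finite) auto
    then show "f r = (\<Sum>i. f i * indicator {i} r)" by simp
  qed
  also have "\<dots> = (\<Sum>i. f i * mass i)"
    by (subst nn_integral_suminf) (auto simp: nn_integral_cmult_indicator mass_def sets_M)
  also have "\<dots> = (\<Sum>r. mass (Suc r) * f (Suc r))"
    using suminf_offset[of "\<lambda>i. f i * mass i" 1] no_zero by (simp add: mass_def mult.commute)
  finally show ?thesis .
qed

lemma sum_mass: "(\<Sum>r. mass (Suc r)) = 1"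
  using nn_integral_M[of "\<lambda>_. 1"] M.emeasure_space_1 by simp

lemma nn_integral_first_jump:
  assumes [measurable]: "H \<in> borel_measurable S"
  shows "(\<integral>\<^sup>+\<rho>. H \<rho> \<partial>S) = (\<Sum>r. mass (Suc r) * (\<integral>\<^sup>+\<rho>. H (case_nat (Suc r) \<rho>) \<partial>S))"
proof -
  have "(\<integral>\<^sup>+\<rho>. H \<rho> \<partial>S) = (\<integral>\<^sup>+\<rho>. H \<rho> \<partial>distr (M \<Otimes>\<^sub>M S) S (\<lambda>(s, \<omega>). case_nat s \<omega>))"
    by (simp add: PiM_iter)
  also have "\<dots> = (\<integral>\<^sup>+p. H (case_nat (fst p) (snd p)) \<partial>(M \<Otimes>\<^sub>M S))"
    by (subst nn_integral_distr) (auto simp: split_beta')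
  also have "\<dots> = (\<integral>\<^sup>+r. \<integral>\<^sup>+\<rho>. H (case_nat r \<rho>) \<partial>S \<partial>M)"
    by (subst P.nn_integral_fst[symmetric]) auto
  also have "\<dots> = (\<Sum>r. mass (Suc r) * (\<integral>\<^sup>+\<rho>. H (case_nat (Suc r) \<rho>) \<partial>S))"
    by (rule nn_integral_M)
  finally show ?thesis .
qed

text \<open>Both sides satisfy the same recursion in the first jump.\<close>

theorem nn_integral_contact_prod: "(\<integral>\<^sup>+\<rho>. contact_prod (renewal_set \<rho>) n e \<partial>S) = free_pf mass n e"
proof (induction n arbitrary: e rule: less_induct)
  case (less n)
  show ?case
  proof (cases n)
    case 0
    then show ?thesis by (simp add: contact_prod_def P.emeasure_space_1[simplified])
  next
    case (Suc k)
    let ?g = "\<lambda>r. mass (Suc r) * (\<integral>\<^sup>+\<rho>. contact_prod (renewal_set (case_nat (Suc r) \<rho>)) n e \<partial>S)"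
    have lo: "?g r = mass (Suc r) * e r * free_pf mass (k - r) (env_shift (Suc r) e)" if "r \<le> k" for r
    proof -
      have "(\<integral>\<^sup>+\<rho>. contact_prod (renewal_set (case_nat (Suc r) \<rho>)) n e \<partial>S) =
          e r * (\<integral>\<^sup>+\<rho>. contact_prod (renewal_set \<rho>) (k - r) (env_shift (Suc r) e) \<partial>S)"
        unfolding contact_prod_first_jump using that Suc by (simp add: nn_integral_cmult)
      then show ?thesis using less[of "k - r"] Suc that by (simp add: mult.assoc)
    qed
    have hi: "?g (r + Suc k) = mass (r + Suc (Suc k))" for r
      unfolding contact_prod_first_jump using Suc by (simp add: P.emeasure_space_1[simplified])
    have "(\<integral>\<^sup>+\<rho>. contact_prod (renewal_set \<rho>) n e \<partial>S) = (\<Sum>r. ?g r)"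
      by (rule nn_integral_first_jump) measurable
    also have "\<dots> = (\<Sum>r. ?g (r + Suc k)) + (\<Sum>r<Suc k. ?g r)"
      by (rule suminf_offset) simp
    also have "\<dots> = (\<Sum>r. mass (r + Suc (Suc k))) + (\<Sum>r\<le>k. mass (Suc r) * e r * free_pf mass (k - r) (env_shift (Suc r) e))"
      unfolding hi lessThan_Suc_atMost using lo by (intro arg_cong2[where f=plus] sum.cong refl) auto
    finally show ?thesis by (simp add: Suc add.commute)
  qed
qed

end

context renewal_process
begin

definition jump_law :: "nat measure" where "jump_law = distr T (count_space UNIV) (\<tau> 1)"

definition increments :: "'t \<Rightarrow> nat \<Rightarrow> nat" where "increments t i = \<tau> (Suc i) t - \<tau> i t"

lemma measurable_increments_component [measurable]: "(\<lambda>t. increments t i) \<in> T \<rightarrow>\<^sub>M count_space UNIV"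
  using indep_increments unfolding indep_vars_def increments_def by auto

text \<open>The renewal times as sums of increments; this passes from \<open>\<tau>\<close> to a sequence of independent jumps.\<close>

lemma tau_eq_sum: "t \<in> space T \<Longrightarrow> \<tau> k t = (\<Sum>i<k. increments t i)"
proof (induction k)
  case (Suc k)
  then show ?case using increasing[of t k] by (simp add: increments_def)
qed (simp add: start)

lemma range_tau: "t \<in> space T \<Longrightarrow> range (\<lambda>k. \<tau> k t) = renewal_set (increments t)"
  by (simp add: renewal_set_def tau_eq_sum)

lemma measurable_tau_1 [measurable]: "\<tau> 1 \<in> T \<rightarrow>\<^sub>M count_space UNIV"
  by (rule measurable_cong[THEN iffD1, OF _ measurable_increments_component[of 0]])
    (simp add: tau_eq_sum)

lemma jump_law_increment: "distr T (count_space UNIV) (\<lambda>t. increments t i) = jump_law"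
  using stationary_increments[of i] by (simp add: increments_def jump_law_def)

sublocale increments: renewal_increments jump_law
proof -
  have prob: "prob_space jump_law" unfolding jump_law_def by (rule prob_space_distr) measurable
  interpret J: prob_space jump_law by (rule prob)
  show "renewal_increments jump_law"
  proof
    show "sets jump_law = sets (count_space UNIV)" by (simp add: jump_law_def)
    have "\<tau> 1 -` {0} \<inter> space T = {}" using increasing[of _ 0] by fastforce
    then show "emeasure jump_law {0} = 0"
      unfolding jump_law_def using emeasure_distr[OF measurable_tau_1, of "{0}"] by (simp del: One_nat_def)
  qed
qed

lemma measurable_increments [measurable]: "increments \<in> T \<rightarrow>\<^sub>M increments.S"
  by (rule measurable_PiM_single') (auto simp: measurable_cong_sets[OF refl increments.sets_M])

lemma distr_increments: "distr T increments.S increments = increments.S"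
proof -
  have rv: "random_variable (count_space UNIV) (\<lambda>t. increments t i)" for i by measurable
  have "indep_vars (\<lambda>_. count_space UNIV) (\<lambda>i t. increments t i) UNIV"
    using indep_increments by (simp add: increments_def)
  then have "distr T (\<Pi>\<^sub>M i\<in>UNIV. count_space UNIV) (\<lambda>t. \<lambda>i\<in>UNIV. increments t i) = (\<Pi>\<^sub>M i\<in>UNIV. jump_law)"
    using indep_vars_iff_distr_eq_PiM[where I=UNIV and M'="\<lambda>_. count_space UNIV" and X="\<lambda>i t. increments t i"] rv
    by (simp add: jump_law_increment)
  moreover have "sets (\<Pi>\<^sub>M i\<in>UNIV. count_space UNIV) = sets increments.S"
    by (intro sets_PiM_cong) (auto simp: increments.sets_M)
  ultimately show ?thesis by (simp add: restrict_def cong: distr_cong)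
qed

lemma nn_integral_increments:
  "H \<in> borel_measurable increments.S \<Longrightarrow> (\<integral>\<^sup>+t. H (increments t) \<partial>T) = (\<integral>\<^sup>+\<rho>. H \<rho> \<partial>increments.S)"
  by (subst distr_increments[symmetric], subst nn_integral_distr) auto

abbreviation K :: "nat \<Rightarrow> ennreal" where "K \<equiv> increments.mass"

lemma K_eq: "K r = ennreal (prob {t \<in> space T. \<tau> 1 t = r})"
proof -
  have "\<tau> 1 -` {r} \<inter> space T = {t \<in> space T. \<tau> 1 t = r}" by auto
  moreover have "emeasure jump_law {r} = emeasure T (\<tau> 1 -` {r} \<inter> space T)"
    unfolding jump_law_def using emeasure_distr[OF measurable_tau_1, of "{r}"] by (simp del: One_nat_def)
  ultimately show ?thesis by (simp add: increments.mass_def emeasure_eq_measure)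
qed

theorem nn_integral_contact_prod_tau:
  "(\<integral>\<^sup>+t. contact_prod (range (\<lambda>k. \<tau> k t)) n e \<partial>T) = free_pf K n e"
proof -
  have "(\<integral>\<^sup>+t. contact_prod (range (\<lambda>k. \<tau> k t)) n e \<partial>T) = (\<integral>\<^sup>+t. contact_prod (renewal_set (increments t)) n e \<partial>T)"
    by (intro nn_integral_cong) (simp add: range_tau)
  also have "\<dots> = free_pf K n e"
    using nn_integral_increments[of "\<lambda>\<rho>. contact_prod (renewal_set \<rho>) n e"] by (simp add: increments.nn_integral_contact_prod)
  finally show ?thesis .
qed

lemma measurable_contact_prod_tau [measurable]:
  "(\<lambda>t. contact_prod (range (\<lambda>k. \<tau> k t)) n e) \<in> borel_measurable T"
proof -
  have "(\<lambda>t. contact_prod (renewal_set (increments t)) n e) \<in> borel_measurable T"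
    by (rule measurable_compose[OF measurable_increments increments.measurable_contact_prod])
  then show ?thesis by (rule measurable_cong[THEN iffD1, rotated]) (simp add: range_tau)
qed

text \<open>The averaged mean number of visits is a generating function of pinning partition functions.\<close>

theorem renewal_mean_visits_eq:
  "renewal_mean_visits T \<tau> \<beta> h \<epsilon> x = (\<Sum>n. ennreal (exp (- \<epsilon> * real n)) * free_pf K n (site_weight \<beta> h x))"
  unfolding renewal_mean_visits_def mean_visits_eq
  by (subst nn_integral_suminf) (auto simp: nn_integral_cmult nn_integral_contact_prod_tau)

theorem partition_function_eq:
  "ennreal (partition_function T \<tau> \<beta> h n x) = free_pf K n (site_weight \<beta> h x)"
proof -
  let ?f = "\<lambda>t. exp (\<Sum>i = 1..n. (\<beta> * x i + h) * indicator (range (\<lambda>k. \<tau> k t)) i) :: real"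
  have eq: "?f t = enn2real (contact_prod (range (\<lambda>k. \<tau> k t)) n (site_weight \<beta> h x))" for t
    by (simp add: contact_prod_site_weight)
  have "integrable T ?f"
  proof (rule integrable_const_bound)
    show "?f \<in> borel_measurable T" unfolding eq by measurable
    show "AE t in T. norm (?f t) \<le> exp (\<Sum>i = 1..n. \<bar>\<beta> * x i + h\<bar>)"
    proof (rule AE_I2)
      fix t
      have "(\<Sum>i = 1..n. (\<beta> * x i + h) * indicator (range (\<lambda>k. \<tau> k t)) i) \<le> (\<Sum>i = 1..n. \<bar>\<beta> * x i + h\<bar>)"
        by (intro sum_mono) (auto simp: indicator_def)
      then show "norm (?f t) \<le> exp (\<Sum>i = 1..n. \<bar>\<beta> * x i + h\<bar>)" by (simp only: real_norm_def abs_exp_cancel exp_le_cancel_iff)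
    qed
  qed
  then have "ennreal (partition_function T \<tau> \<beta> h n x) = (\<integral>\<^sup>+t. ennreal (?f t) \<partial>T)"
    unfolding partition_function_def by (intro nn_integral_eq_integral[symmetric]) auto
  also have "\<dots> = (\<integral>\<^sup>+t. contact_prod (range (\<lambda>k. \<tau> k t)) n (site_weight \<beta> h x) \<partial>T)"
    by (simp add: contact_prod_site_weight)
  finally show ?thesis by (simp add: nn_integral_contact_prod_tau)
qed

lemma partition_function_nonneg: "0 \<le> partition_function T \<tau> \<beta> h n x"
  unfolding partition_function_def by (intro integral_nonneg_AE) auto

end

section \<open>Transience along a fixed renewal set\<close>

context iid_disorder
begin

definition weight_law :: "real \<Rightarrow> real \<Rightarrow> ennreal measure" where
  "weight_law \<beta> h = distr W borel (\<lambda>w. ennreal (exp (\<beta> * \<omega> 1 w + h)))"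

abbreviation env_law :: "real \<Rightarrow> real \<Rightarrow> (nat \<Rightarrow> ennreal) measure" where
  "env_law \<beta> h \<equiv> Pi\<^sub>M UNIV (\<lambda>_. weight_law \<beta> h)"

definition weights :: "real \<Rightarrow> real \<Rightarrow> 'w \<Rightarrow> nat \<Rightarrow> ennreal" where
  "weights \<beta> h w = site_weight \<beta> h (\<lambda>i. \<omega> i w)"

lemma measurable_disorder: "1 \<le> i \<Longrightarrow> \<omega> i \<in> borel_measurable W"
  using indep unfolding indep_vars_def by auto

lemma measurable_disorder_Suc [measurable]: "\<omega> (Suc i) \<in> borel_measurable W"
  by (rule measurable_disorder) simp

lemma measurable_disorder_1 [measurable]: "\<omega> 1 \<in> borel_measurable W"
  by (rule measurable_disorder) simp

lemma iid_weights_weight_law: "iid_weights (weight_law \<beta> h)"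
proof -
  have "prob_space (weight_law \<beta> h)" unfolding weight_law_def by (rule prob_space_distr) measurable
  then interpret L: prob_space "weight_law \<beta> h" .
  show ?thesis by standard (simp add: weight_law_def)
qed

lemma distr_weights:
  "distr W (env_law \<beta> h) (weights \<beta> h) = env_law \<beta> h"
proof -
  let ?X = "\<lambda>i w. ennreal (exp (\<beta> * \<omega> (Suc i) w + h))"
  have "indep_vars (\<lambda>_. borel) (\<lambda>i. \<omega> (Suc i)) UNIV"
  proof -
    have D: "distr W (\<Pi>\<^sub>M i\<in>{1..}. borel) (\<lambda>w. \<lambda>i\<in>{1..}. \<omega> i w) = (\<Pi>\<^sub>M i\<in>{1..}. distr W borel (\<omega> i))"
      using indep measurable_disorder by (subst (asm) indep_vars_iff_distr_eq_PiM') auto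
    have m: "(\<lambda>w. \<lambda>i\<in>{1..}. \<omega> i w) \<in> W \<rightarrow>\<^sub>M (\<Pi>\<^sub>M i\<in>{1..}. borel)"
      by (intro measurable_restrict measurable_disorder) auto
    have "distr W (\<Pi>\<^sub>M i\<in>UNIV. borel) (\<lambda>w. \<lambda>i\<in>UNIV. \<omega> (Suc i) w) =
        distr (distr W (\<Pi>\<^sub>M i\<in>{1..}. borel) (\<lambda>w. \<lambda>i\<in>{1..}. \<omega> i w)) (\<Pi>\<^sub>M i\<in>UNIV. borel) (\<lambda>x. \<lambda>n\<in>UNIV. x (Suc n))"
    proof (subst distr_distr[OF _ m])
      show "(\<lambda>x. \<lambda>n\<in>UNIV. x (Suc n)) \<in> (\<Pi>\<^sub>M i\<in>{1..}. borel) \<rightarrow>\<^sub>M (\<Pi>\<^sub>M i\<in>UNIV. borel)"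
        by (intro measurable_restrict measurable_component_singleton) auto
    qed (auto simp: comp_def intro!: arg_cong[where f="distr W _"])
    also have "\<dots> = distr (\<Pi>\<^sub>M i\<in>{1..}. distr W borel (\<omega> i)) (\<Pi>\<^sub>M i\<in>UNIV. distr W borel (\<omega> (Suc i))) (\<lambda>x. \<lambda>n\<in>UNIV. x (Suc n))"
      unfolding D by (intro distr_cong refl sets_PiM_cong) auto
    also have "\<dots> = (\<Pi>\<^sub>M i\<in>UNIV. distr W borel (\<omega> (Suc i)))"
      by (rule distr_PiM_reindex) (auto intro!: prob_space_distr measurable_disorder simp: inj_on_def)
    finally show ?thesis
      by (subst indep_vars_iff_distr_eq_PiM) auto
  qed
  then have ind: "indep_vars (\<lambda>_. borel) ?X UNIV"
    by (rule indep_vars_compose2[where Y="\<lambda>_ x. ennreal (exp (\<beta> * x + h))"]) measurable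
  have law: "distr W borel (?X i) = weight_law \<beta> h" for i
  proof -
    have "distr W borel (?X i) = distr (distr W borel (\<omega> (Suc i))) borel (\<lambda>x. ennreal (exp (\<beta> * x + h)))"
      by (subst distr_distr) (auto simp: comp_def)
    also have "\<dots> = distr (distr W borel (\<omega> 1)) borel (\<lambda>x. ennreal (exp (\<beta> * x + h)))"
      using identically_distributed[of "Suc i"] by simp
    also have "\<dots> = weight_law \<beta> h"
      unfolding weight_law_def by (subst distr_distr) (auto simp: comp_def simp del: One_nat_def)
    finally show ?thesis .
  qed
  have "distr W (\<Pi>\<^sub>M i\<in>UNIV. borel) (\<lambda>w. \<lambda>i\<in>UNIV. ?X i w) = (\<Pi>\<^sub>M i\<in>UNIV. weight_law \<beta> h)"
    using ind indep_vars_iff_distr_eq_PiM[where I=UNIV and M'="\<lambda>_. borel" and X="?X"] by (simp add: law)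
  moreover have "sets (\<Pi>\<^sub>M i\<in>UNIV. borel) = sets (env_law \<beta> h)"
    by (intro sets_PiM_cong) (auto simp: weight_law_def)
  then have "distr W (env_law \<beta> h) f = distr W (\<Pi>\<^sub>M i\<in>UNIV. borel) f" for f
    by (intro distr_cong) auto
  moreover have eq: "(\<lambda>w. \<lambda>i\<in>UNIV. ?X i w) = weights \<beta> h" by (simp add: weights_def site_weight_def fun_eq_iff)
  ultimately show ?thesis unfolding eq by simp
qed

lemma measurable_weights [measurable]: "weights \<beta> h \<in> W \<rightarrow>\<^sub>M env_law \<beta> h"
  by (rule measurable_PiM_single')
    (auto simp: weights_def site_weight_def weight_law_def measurable_cong_sets[OF refl sets_distr])

lemma AE_weights:
  assumes "AE e in env_law \<beta> h. Q e" shows "AE w in W. Q (weights \<beta> h w)"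
  using assms by (subst (asm) distr_weights[symmetric]) (rule AE_distrD[OF measurable_weights])

lemma nn_integral_weights:
  "H \<in> borel_measurable (env_law \<beta> h) \<Longrightarrow>
    (\<integral>\<^sup>+w. H (weights \<beta> h w) \<partial>W) = (\<integral>\<^sup>+e. H e \<partial>env_law \<beta> h)"
  by (subst distr_weights[symmetric], subst nn_integral_distr) auto

lemma weights_0: "weights \<beta> h w 0 = ennreal (exp (\<beta> * \<omega> 1 w + h))"
  by (simp add: weights_def site_weight_def)

lemma mean_weight:
  assumes "0 \<le> \<beta>"
  shows "(\<integral>\<^sup>+e. e 0 \<partial>env_law \<beta> h) = ennreal (exp (log_mgf W \<omega> \<beta> + h))"
proof -
  interpret E: iid_weights "weight_law \<beta> h" by (rule iid_weights_weight_law)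
  let ?I = "LINT w|W. exp (\<beta> * \<omega> 1 w)"
  have int: "integrable W (\<lambda>w. exp (\<beta> * \<omega> 1 w))" by (rule exp_moments[OF assms])
  have "0 < ?I"
  proof -
    have "exp (\<beta> * expectation (\<omega> 1)) \<le> ?I"
    proof -
      have "(LINT w|W. 1 + \<beta> * \<omega> 1 w) \<le> ?I"
        using integrable_disorder int by (intro integral_mono) (auto simp: add.commute exp_ge_add_one_self simp del: One_nat_def)
      moreover have "(LINT w|W. 1 + \<beta> * \<omega> 1 w) = 1"
        using integrable_disorder centred by (simp add: prob_space del: One_nat_def)
      ultimately show ?thesis using centred by simp
    qed
    then show ?thesis by (meson exp_gt_zero less_le_trans)
  qed
  have "(\<integral>\<^sup>+e. e 0 \<partial>E.S) = (\<integral>\<^sup>+w. weights \<beta> h w 0 \<partial>W)"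
    by (rule nn_integral_weights[symmetric]) (rule E.measurable_coordinate)
  also have "\<dots> = (\<integral>\<^sup>+w. ennreal (exp h * exp (\<beta> * \<omega> 1 w)) \<partial>W)"
    unfolding weights_0 by (simp add: exp_add mult.commute)
  also have "\<dots> = ennreal (LINT w|W. exp h * exp (\<beta> * \<omega> 1 w))"
    using int by (intro nn_integral_eq_integral integrable_mult_right) auto
  also have "(LINT w|W. exp h * exp (\<beta> * \<omega> 1 w)) = exp h * ?I" by simp
  also have "\<dots> = exp (log_mgf W \<omega> \<beta> + h)"
    unfolding log_mgf_def using \<open>0 < ?I\<close> by (simp add: exp_add mult.commute)
  finally show ?thesis .
qed

text \<open>Centred disorder cannot stay below \<open>- 1\<close> almost surely.\<close>

lemma weight_not_small:
  assumes "0 \<le> \<beta>"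
  shows "0 < measure (env_law \<beta> h) {e. ennreal (exp (h - \<beta>)) \<le> e 0}"
proof -
  interpret E: iid_weights "weight_law \<beta> h" by (rule iid_weights_weight_law)
  let ?A = "{e. ennreal (exp (h - \<beta>)) \<le> e 0}"
  have A: "?A \<in> sets E.S"
  proof -
    have "{e \<in> space E.S. ennreal (exp (h - \<beta>)) \<le> e 0} \<in> sets E.S" by measurable
    then show ?thesis by simp
  qed
  have "measure E.S ?A \<noteq> 0"
  proof
    assume "measure E.S ?A = 0"
    then have "AE e in E.S. e \<notin> ?A"
      using A by (intro AE_not_in) (auto simp: null_sets_def E.P.emeasure_eq_measure)
    then have "AE w in W. weights \<beta> h w \<notin> ?A" by (rule AE_weights)
    then have "AE w in W. \<omega> 1 w \<le> - 1"
    proof eventually_elim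
      case (elim w)
      then have "\<beta> * \<omega> 1 w + h < h - \<beta>" by (simp add: weights_0 not_le ennreal_less_iff)
      then have "\<beta> * \<omega> 1 w < \<beta> * (- 1)" by simp
      then have "0 < \<beta>" using assms by (cases "\<beta> = 0") auto
      then show ?case using \<open>\<beta> * \<omega> 1 w < \<beta> * (- 1)\<close> mult_less_cancel_left_pos[of \<beta> "\<omega> 1 w" "- 1"] by linarith
    qed
    then have "expectation (\<omega> 1) \<le> (LINT w|W. - 1)"
      using integrable_disorder by (intro integral_mono_AE) auto
    then show False using centred by (simp add: prob_space)
  qed
  then show ?thesis by (simp add: zero_less_measure_iff)
qed

text \<open>Since \<open>(exp (s * x) - 1) / s\<close> lies between \<open>x\<close> and \<open>exp x - 1\<close> for \<open>0 < s \<le> 1\<close> and tends to \<open>x\<close>, dominated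
  convergence gives \<open>1 + o(s)\<close> for the exponential moment of order \<open>s\<close> of the centred disorder. For small \<open>s\<close> the factor
  \<open>exp (\<sigma> * h)\<close> with \<open>h < 0\<close> and \<open>\<sigma> = s / \<beta>\<close> wins.\<close>

lemma small_power_contracts:
  assumes "0 < \<beta>" "h < 0"
  shows "\<exists>\<sigma>>0. \<sigma> \<le> 1 \<and> (\<integral>\<^sup>+w. epow \<sigma> (weights \<beta> h w 0) \<partial>W) < 1"
proof -
  \<comment> \<open>the exponents \<open>s = \<sigma> * \<beta>\<close> that are applied to the disorder\<close>
  define s where "s n = 1 / (real n + 1)" for n
  have s: "0 < s n" "s n \<le> 1" for n by (auto simp: s_def)
  have s0: "s \<longlonglongrightarrow> 0"
    unfolding s_def using LIMSEQ_inverse_real_of_nat by (simp add: inverse_eq_divide add.commute)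
  let ?f = "\<lambda>n w. (exp (s n * \<omega> 1 w) - 1) / s n"
  have int: "integrable W (\<lambda>w. exp (x * \<omega> 1 w))" if "0 \<le> x" for x by (rule exp_moments[OF that])
  have bounds: "x \<le> (exp (s n * x) - 1) / s n" "(exp (s n * x) - 1) / s n \<le> exp x - 1" for n x
  proof -
    have "s n * x \<le> exp (s n * x) - 1" using exp_ge_add_one_self[of "s n * x"] by linarith
    then show "x \<le> (exp (s n * x) - 1) / s n" using s[of n] by (simp add: field_simps)
    have "exp ((1 - s n) *\<^sub>R 0 + s n *\<^sub>R x) \<le> (1 - s n) * exp 0 + s n * exp x"
      using s[of n] by (intro convex_onD[OF exp_convex]) auto
    then show "(exp (s n * x) - 1) / s n \<le> exp x - 1" using s[of n] by (simp add: field_simps)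
  qed
  have "(\<lambda>n. LINT w|W. ?f n w) \<longlonglongrightarrow> (LINT w|W. \<omega> 1 w)"
  proof (rule integral_dominated_convergence[where w="\<lambda>w. \<bar>\<omega> 1 w\<bar> + exp (1 * \<omega> 1 w)"])
    show "integrable W (\<lambda>w. \<bar>\<omega> 1 w\<bar> + exp (1 * \<omega> 1 w))"
      using integrable_disorder int[of 1] by (intro Bochner_Integration.integrable_add) auto
    show "AE w in W. (\<lambda>n. ?f n w) \<longlonglongrightarrow> \<omega> 1 w"
    proof (rule AE_I2)
      fix w
      have "((\<lambda>t. exp (t * \<omega> 1 w)) has_real_derivative \<omega> 1 w) (at 0)"
        by (auto intro!: derivative_eq_intros)
      then have "((\<lambda>t. (exp (t * \<omega> 1 w) - 1) / t) \<longlongrightarrow> \<omega> 1 w) (at 0)"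
        by (simp add: has_field_derivative_iff)
      moreover have "filterlim s (at 0) sequentially"
        unfolding filterlim_at using s0 s by (auto intro!: always_eventually simp: less_imp_neq[symmetric])
      ultimately show "(\<lambda>n. ?f n w) \<longlonglongrightarrow> \<omega> 1 w" by (rule filterlim_compose)
    qed
    show "AE w in W. norm (?f n w) \<le> \<bar>\<omega> 1 w\<bar> + exp (1 * \<omega> 1 w)" for n
    proof (rule AE_I2)
      fix w
      have "0 < exp (\<omega> 1 w)" by simp
      then show "norm (?f n w) \<le> \<bar>\<omega> 1 w\<bar> + exp (1 * \<omega> 1 w)"
        using bounds(1)[of "\<omega> 1 w" n] bounds(2)[of n "\<omega> 1 w"] unfolding real_norm_def mult_1 by linarith
    qed
  qed measurable
  then have lim: "(\<lambda>n. LINT w|W. ?f n w) \<longlonglongrightarrow> 0" using centred by simp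
  have "\<forall>\<^sub>F n in sequentially. (LINT w|W. ?f n w) < - h / \<beta>"
  proof (rule order_tendstoD(2)[OF lim])
    show "0 < - h / \<beta>" using assms by (intro divide_pos_pos) auto
  qed
  moreover have "\<forall>\<^sub>F n in sequentially. s n < \<beta>"
    using s0 assms by (intro order_tendstoD(2)) auto
  ultimately have "\<forall>\<^sub>F n in sequentially. (LINT w|W. ?f n w) < - h / \<beta> \<and> s n < \<beta>"
    by eventually_elim simp
  then obtain n where n: "(LINT w|W. ?f n w) < - h / \<beta>" "s n < \<beta>"
    by (auto dest: eventually_happens)
  define \<sigma> where "\<sigma> = s n / \<beta>"
  have \<sigma>: "0 < \<sigma>" "\<sigma> \<le> 1" using n s[of n] assms by (auto simp: \<sigma>_def)
  have I: "integrable W (\<lambda>w. exp (s n * \<omega> 1 w))" using int[of "s n"] s[of n] by simp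
  have "(LINT w|W. exp (s n * \<omega> 1 w)) = 1 + s n * (LINT w|W. ?f n w)"
    using s[of n] I by (simp add: prob_space del: One_nat_def)
  also have "\<dots> \<le> exp (s n * (LINT w|W. ?f n w))" by (rule exp_ge_add_one_self)
  also have "\<dots> < exp (s n * (- h / \<beta>))"
    unfolding exp_less_cancel_iff by (rule mult_strict_left_mono[OF n(1) s(1)])
  finally have lt: "(LINT w|W. exp (s n * \<omega> 1 w)) < exp (- (\<sigma> * h))" by (simp add: \<sigma>_def)
  have "(\<integral>\<^sup>+w. epow \<sigma> (weights \<beta> h w 0) \<partial>W) = (\<integral>\<^sup>+w. ennreal (exp (\<sigma> * h) * exp (s n * \<omega> 1 w)) \<partial>W)"
    unfolding weights_0 using assms
    by (simp add: epow_ennreal exp_powr_real exp_add[symmetric] \<sigma>_def algebra_simps add_divide_distrib del: One_nat_def)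
  also have "\<dots> = ennreal (LINT w|W. exp (\<sigma> * h) * exp (s n * \<omega> 1 w))"
    using I by (intro nn_integral_eq_integral integrable_mult_right) auto
  also have "(LINT w|W. exp (\<sigma> * h) * exp (s n * \<omega> 1 w)) = exp (\<sigma> * h) * (LINT w|W. exp (s n * \<omega> 1 w))" by simp
  also have "ennreal \<dots> < ennreal (exp (\<sigma> * h) * exp (- (\<sigma> * h)))"
    using lt by (intro ennreal_lessI mult_strict_left_mono) auto
  also have "\<dots> = 1" by (simp add: exp_add[symmetric])
  finally show ?thesis using \<sigma> by blast
qed

end

text \<open>The product of the weights of the first \<open>k\<close> contacts when the jumps are \<open>\<rho> 0, \<rho> 1, \<dots>\<close>.\<close>

primrec contact_weight :: "nat \<Rightarrow> (nat \<Rightarrow> nat) \<Rightarrow> (nat \<Rightarrow> ennreal) \<Rightarrow> ennreal" where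
  "contact_weight 0 \<rho> e = 1"
| "contact_weight (Suc k) \<rho> e = e (\<rho> 0 - 1) * contact_weight k (\<lambda>i. \<rho> (Suc i)) (env_shift (\<rho> 0) e)"

text \<open>Between two contacts the product of weights is constant, so the sum over sites is a sum over contacts
  weighted by the following jumps.\<close>

lemma sum_contact_prod_le:
  assumes "\<And>i. 1 \<le> \<rho> i"
  shows "(\<Sum>n<N. contact_prod (renewal_set \<rho>) n e) \<le> (\<Sum>k<N. of_nat (\<rho> k) * contact_weight k \<rho> e)"
  using assms
proof (induction N arbitrary: \<rho> e)
  case (Suc N)
  obtain r where r: "\<rho> 0 = Suc r" using Suc.prems[of 0] by (cases "\<rho> 0") auto
  let ?\<rho> = "\<lambda>i. \<rho> (Suc i)" let ?e = "env_shift (Suc r) e"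
  have \<rho>: "\<rho> = case_nat (Suc r) ?\<rho>" by (rule ext) (simp add: r split: nat.split)
  let ?h = "\<lambda>n. contact_prod (renewal_set \<rho>) n e"
  have h: "?h n = (if r < n then e r * contact_prod (renewal_set ?\<rho>) (n - Suc r) ?e else 1)" for n
    by (subst \<rho>) (rule contact_prod_first_jump)
  have "(\<Sum>n<Suc N. ?h n) \<le> (\<Sum>n<Suc r + N. ?h n)" by (intro sum_mono2) auto
  also have "\<dots> = (\<Sum>n<Suc r. ?h n) + (\<Sum>n<N. ?h (Suc r + n))"
    by (induction N) (auto simp: add.assoc)
  also have "\<dots> = of_nat (Suc r) + e r * (\<Sum>n<N. contact_prod (renewal_set ?\<rho>) n ?e)"
    by (simp add: h sum_distrib_left)
  also have "\<dots> \<le> of_nat (Suc r) + e r * (\<Sum>k<N. of_nat (?\<rho> k) * contact_weight k ?\<rho> ?e)"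
    using Suc.prems by (intro add_left_mono mult_left_mono Suc.IH) auto
  also have "\<dots> = (\<Sum>k<Suc N. of_nat (\<rho> k) * contact_weight k \<rho> e)"
    by (simp add: sum.lessThan_Suc_shift r sum_distrib_left mult_ac del: sum.lessThan_Suc of_nat_Suc)
  finally show ?case .
qed simp

lemma suminf_contact_prod_le:
  assumes "\<And>i. 1 \<le> \<rho> i"
  shows "(\<Sum>n. contact_prod (renewal_set \<rho>) n e) \<le> (\<Sum>k. of_nat (\<rho> k) * contact_weight k \<rho> e)"
  unfolding suminf_eq_SUP[of "\<lambda>n. contact_prod (renewal_set \<rho>) n e"]
  by (intro SUP_least order_trans[OF sum_contact_prod_le[OF assms]] sum_le_suminf) auto

context iid_weights
begin

lemma measurable_contact_weight [measurable]: "contact_weight k \<rho> \<in> borel_measurable S"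
proof (induction k arbitrary: \<rho>)
  case 0
  then show ?case by (simp add: contact_weight.simps(1)[abs_def])
next
  case (Suc k)
  note [measurable] = Suc
  show ?case unfolding contact_weight.simps[abs_def] by measurable
qed

lemma frac_moment_contact_weight:
  assumes "\<And>i. 1 \<le> \<rho> i"
  shows "frac_moment \<gamma> (contact_weight k \<rho>) = frac_moment \<gamma> (\<lambda>e. e 0) ^ k"
  using assms
proof (induction k arbitrary: \<rho>)
  case 0
  then show ?case by (simp add: frac_moment_def P.emeasure_space_1[simplified])
next
  case (Suc k)
  have "frac_moment \<gamma> (contact_weight (Suc k) \<rho>) =
      (\<integral>\<^sup>+e. epow \<gamma> (e (\<rho> 0 - 1)) * epow \<gamma> (contact_weight k (\<lambda>i. \<rho> (Suc i)) (env_shift (\<rho> 0) e)) \<partial>S)"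
    by (simp add: frac_moment_def epow_mult)
  also have "\<dots> = (\<integral>\<^sup>+e. epow \<gamma> (e (\<rho> 0 - 1)) \<partial>S) * (\<integral>\<^sup>+e. epow \<gamma> (contact_weight k (\<lambda>i. \<rho> (Suc i)) e) \<partial>S)"
    by (rule nn_integral_split) (use Suc.prems[of 0] in auto)
  also have "(\<integral>\<^sup>+e. epow \<gamma> (e (\<rho> 0 - 1)) \<partial>S) = frac_moment \<gamma> (\<lambda>e. e 0)"
    unfolding frac_moment_def by (rule nn_integral_coordinate) auto
  also have "(\<integral>\<^sup>+e. epow \<gamma> (contact_weight k (\<lambda>i. \<rho> (Suc i)) e) \<partial>S) = frac_moment \<gamma> (\<lambda>e. e 0) ^ k"
    using Suc.IH[of "\<lambda>i. \<rho> (Suc i)"] Suc.prems by (simp add: frac_moment_def)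
  finally show ?case by simp
qed

text \<open>The rate \<open>\<delta>\<close> is half of the exponential rate at which the contact weights decay, so it leaves room for jumps
  that grow like \<open>exp (\<delta> * k)\<close>. It does not depend on the jumps.\<close>

lemma contracting_weights:
  assumes \<sigma>: "0 < \<sigma>" "\<sigma> \<le> 1" and q: "frac_moment \<sigma> (\<lambda>e. e 0) < 1"
  obtains \<delta> where "0 < \<delta>"
    "\<And>\<rho>. (\<And>i. 1 \<le> \<rho> i) \<Longrightarrow> \<forall>\<^sub>F k in sequentially. real (\<rho> k) \<le> exp (\<delta> * real k) \<Longrightarrow>
      AE e in S. (\<Sum>n. contact_prod (renewal_set \<rho>) n e) < \<infinity>"
proof -
  obtain q0 where q0: "0 \<le> q0" "frac_moment \<sigma> (\<lambda>e. e 0) = ennreal q0" "q0 < 1"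
    using q by (cases "frac_moment \<sigma> (\<lambda>e. e 0)") (auto simp: ennreal_less_one_iff)
  define q1 where "q1 = (1 + q0) / 2"
  have q1: "0 < q1" "q0 \<le> q1" "q1 < 1" using q0 by (auto simp: q1_def)
  define \<delta> where "\<delta> = - ln q1 / (2 * \<sigma>)"
  have \<delta>: "0 < \<delta>" using q1 \<sigma> by (simp add: \<delta>_def divide_neg_pos)
  have "AE e in S. (\<Sum>n. contact_prod (renewal_set \<rho>) n e) < \<infinity>"
    if \<rho>: "\<And>i. 1 \<le> \<rho> i" and growth: "\<forall>\<^sub>F k in sequentially. real (\<rho> k) \<le> exp (\<delta> * real k)" for \<rho>
  proof -
    obtain k0 where k0: "\<And>k. k0 \<le> k \<Longrightarrow> real (\<rho> k) \<le> exp (\<delta> * real k)"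
      using growth by (auto simp: eventually_sequentially)
    \<comment> \<open>absorbs the finitely many jumps before the growth bound holds\<close>
    define C where "C = 1 + (\<Sum>k<k0. real (\<rho> k))"
    have C: "real (\<rho> k) \<le> C * exp (\<delta> * real k)" for k
    proof (cases "k0 \<le> k")
      case True
      have "1 * exp (\<delta> * real k) \<le> C * exp (\<delta> * real k)"
        by (intro mult_right_mono) (auto simp: C_def sum_nonneg)
      then show ?thesis using k0[OF True] by linarith
    next
      case False
      then have "real (\<rho> k) \<le> (\<Sum>k<k0. real (\<rho> k))" by (intro member_le_sum) auto
      then have "real (\<rho> k) \<le> C * 1" by (simp add: C_def)
      also have "\<dots> \<le> C * exp (\<delta> * real k)" using \<delta> by (intro mult_left_mono) (auto simp: C_def sum_nonneg add_nonneg_nonneg)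
      finally show ?thesis .
    qed
    have C0: "0 \<le> C" by (simp add: C_def sum_nonneg add_nonneg_nonneg)
    let ?F = "\<lambda>k e. ennreal (exp (2 * \<delta> * real k)) * contact_weight k \<rho> e"
    have "AE e in S. (\<Sum>k. ennreal (exp (- \<delta> * real k)) * ?F k e) < \<infinity>"
    proof (rule AE_finite_of_frac_moment[OF \<sigma> \<delta>])
      fix k
      have "epow \<sigma> (ennreal (exp (2 * \<delta> * real k))) = ennreal ((1 / q1) ^ k)"
      proof -
        have "exp (2 * \<delta> * real k) powr \<sigma> = exp (real k * - ln q1)"
          using \<sigma> by (simp add: exp_powr_real \<delta>_def)
        also have "\<dots> = (1 / q1) ^ k"
          using q1 unfolding exp_of_nat_mult by (simp add: exp_minus inverse_eq_divide)
        finally show ?thesis by (simp add: epow_ennreal)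
      qed
      then have "frac_moment \<sigma> (?F k) = ennreal ((1 / q1) ^ k) * frac_moment \<sigma> (contact_weight k \<rho>)"
        by (simp add: frac_moment_def epow_mult nn_integral_cmult)
      also have "\<dots> = ennreal ((1 / q1) ^ k * q0 ^ k)"
        using q0 q1 by (simp add: frac_moment_contact_weight[OF \<rho>] ennreal_power ennreal_mult)
      also have "\<dots> \<le> ennreal 1"
      proof (rule ennreal_leI)
        have "(1 / q1) ^ k * q0 ^ k = (q0 / q1) ^ k" by (simp add: power_divide)
        also have "\<dots> \<le> 1" using q0 q1 by (intro power_le_one) auto
        finally show "(1 / q1) ^ k * q0 ^ k \<le> 1" .
      qed
      finally show "frac_moment \<sigma> (?F k) \<le> ennreal 1" .
    qed measurable
    then show ?thesis
    proof eventually_elim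
      case (elim e)
      have "(\<Sum>n. contact_prod (renewal_set \<rho>) n e) \<le> (\<Sum>k. of_nat (\<rho> k) * contact_weight k \<rho> e)"
        by (rule suminf_contact_prod_le[OF \<rho>])
      also have "\<dots> \<le> (\<Sum>k. ennreal C * (ennreal (exp (- \<delta> * real k)) * ?F k e))"
      proof (intro suminf_le)
        fix k
        have "of_nat (\<rho> k) \<le> ennreal (C * exp (\<delta> * real k))"
          using C[of k] by (simp add: ennreal_of_nat_eq_real_of_nat ennreal_leI)
        then have "of_nat (\<rho> k) * contact_weight k \<rho> e \<le> ennreal (C * exp (\<delta> * real k)) * contact_weight k \<rho> e"
          by (rule mult_right_mono) simp
        also have "C * exp (\<delta> * real k) = C * (exp (- \<delta> * real k) * exp (2 * \<delta> * real k))"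
          by (simp add: exp_add[symmetric])
        finally show "of_nat (\<rho> k) * contact_weight k \<rho> e \<le> ennreal C * (ennreal (exp (- \<delta> * real k)) * ?F k e)"
          using C0 by (simp add: ennreal_mult mult.assoc)
      qed auto
      also have "\<dots> = ennreal C * (\<Sum>k. ennreal (exp (- \<delta> * real k)) * ?F k e)" by (rule ennreal_suminf_cmult)
      also have "\<dots> < \<infinity>" using elim by (simp add: ennreal_mult_less_top)
      finally show ?case .
    qed
  qed
  then show ?thesis using \<delta> that by blast
qed

end

context renewal_process
begin

lemma increments_pos: "t \<in> space T \<Longrightarrow> 1 \<le> increments t i"
  using increasing[of t i] by (simp add: increments_def)

text \<open>By the lemma of Borel and Cantelli: summing \<open>P (ln (\<tau> 1) > \<delta> * k)\<close> over \<open>k\<close> gives at most the mean of \<open>ln (\<tau> 1) / \<delta> + 1\<close>.\<close>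

lemma increments_subexponential:
  assumes int: "integrable T (\<lambda>t. ln (real (\<tau> 1 t)))" and "0 < \<delta>"
  shows "AE t in T. \<forall>\<^sub>F k in sequentially. real (increments t k) \<le> exp (\<delta> * real k)"
proof -
  let ?A = "\<lambda>k. {t \<in> space T. exp (\<delta> * real k) < real (increments t k)}"
  have law: "emeasure T (?A k) = emeasure T {t \<in> space T. \<delta> * real k < ln (real (\<tau> 1 t))}" for k
  proof -
    let ?B = "{r::nat. exp (\<delta> * real k) < real r}"
    have "emeasure T (?A k) = emeasure (distr T (count_space UNIV) (\<lambda>t. increments t k)) ?B"
      by (subst emeasure_distr) (auto intro!: arg_cong[where f="emeasure T"])
    also have "\<dots> = emeasure (distr T (count_space UNIV) (\<tau> 1)) ?B"
      by (simp add: jump_law_increment jump_law_def)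
    also have "\<dots> = emeasure T (\<tau> 1 -` ?B \<inter> space T)"
      by (rule emeasure_distr[OF measurable_tau_1]) auto
    also have "\<tau> 1 -` ?B \<inter> space T = {t \<in> space T. \<delta> * real k < ln (real (\<tau> 1 t))}"
    proof -
      have "exp (\<delta> * real k) < real (\<tau> 1 t) \<longleftrightarrow> \<delta> * real k < ln (real (\<tau> 1 t))" if "t \<in> space T" for t
      proof -
        have "0 < real (\<tau> 1 t)" using increasing[OF that, of 0] by simp
        then show ?thesis by (metis exp_less_cancel_iff exp_ln)
      qed
      then show ?thesis by auto
    qed
    finally show ?thesis .
  qed
  have [measurable]: "(\<lambda>t. ln (real (\<tau> 1 t))) \<in> borel_measurable T" using int by simp
  have "(\<Sum>k. emeasure T (?A k)) = (\<Sum>k. \<integral>\<^sup>+t. indicator {t \<in> space T. \<delta> * real k < ln (real (\<tau> 1 t))} t \<partial>T)"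
    unfolding law by (intro suminf_cong nn_integral_indicator[symmetric]) measurable
  also have "\<dots> = (\<integral>\<^sup>+t. (\<Sum>k. indicator {t \<in> space T. \<delta> * real k < ln (real (\<tau> 1 t))} t) \<partial>T)"
    by (intro nn_integral_suminf[symmetric]) measurable
  also have "\<dots> \<le> (\<integral>\<^sup>+t. ennreal (norm (ln (real (\<tau> 1 t))) / \<delta> + 1) \<partial>T)"
  proof (rule nn_integral_mono)
    fix t assume t: "t \<in> space T"
    let ?X = "ln (real (\<tau> 1 t)) / \<delta>"
    have X0: "0 \<le> ?X" using increasing[OF t, of 0] \<open>0 < \<delta>\<close> by simp
    have eq: "indicator {t \<in> space T. \<delta> * real k < ln (real (\<tau> 1 t))} t = (if real k < ?X then 1 else 0 :: ennreal)" for k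
      using t \<open>0 < \<delta>\<close> by (auto simp: indicator_def field_simps)
    have "(\<Sum>k. if real k < ?X then 1 else 0 :: ennreal) = (\<Sum>k<nat \<lceil>?X\<rceil>. if real k < ?X then 1 else 0)"
    proof (rule suminf_finite)
      fix k assume "k \<notin> {..<nat \<lceil>?X\<rceil>}"
      then have "nat \<lceil>?X\<rceil> \<le> k" unfolding lessThan_iff not_less .
      then have "?X \<le> real k" by (meson of_nat_ceiling of_nat_le_iff order_trans)
      then show "(if real k < ?X then 1 else 0 :: ennreal) = 0" by simp
    qed simp
    also have "\<dots> \<le> (\<Sum>k<nat \<lceil>?X\<rceil>. 1)" by (intro sum_mono) auto
    also have "\<dots> = ennreal (real (nat \<lceil>?X\<rceil>))" by (simp add: ennreal_of_nat_eq_real_of_nat)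
    also have "\<dots> \<le> ennreal (?X + 1)" using X0 by (intro ennreal_leI) linarith
    also have "\<dots> \<le> ennreal (norm (ln (real (\<tau> 1 t))) / \<delta> + 1)"
      using \<open>0 < \<delta>\<close> by (intro ennreal_leI add_right_mono divide_right_mono) auto
    finally show "(\<Sum>k. indicator {t \<in> space T. \<delta> * real k < ln (real (\<tau> 1 t))} t) \<le> ennreal (norm (ln (real (\<tau> 1 t))) / \<delta> + 1)"
      by (simp only: eq)
  qed
  also have "\<dots> < \<infinity>"
  proof -
    have "integrable T (\<lambda>t. norm (ln (real (\<tau> 1 t))) / \<delta> + 1)"
      using int by (intro Bochner_Integration.integrable_add integrable_divide integrable_norm) auto
    then have "(\<integral>\<^sup>+t. ennreal (norm (norm (ln (real (\<tau> 1 t))) / \<delta> + 1)) \<partial>T) < \<infinity>"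
      by (simp add: integrable_iff_bounded)
    moreover have "norm (norm (ln (real (\<tau> 1 t))) / \<delta> + 1) = norm (ln (real (\<tau> 1 t))) / \<delta> + 1" for t
      using \<open>0 < \<delta>\<close> by (simp add: add_nonneg_nonneg del: One_nat_def)
    ultimately show ?thesis by (simp only:)
  qed
  finally have fin: "(\<Sum>k. ennreal (measure T (?A k))) \<noteq> \<top>" by (simp add: emeasure_eq_measure)
  have A: "?A k \<in> sets T" for k by measurable
  have "AE t in T. \<forall>\<^sub>F k in sequentially. t \<in> space T - ?A k"
  proof (rule borel_cantelli_AE1[OF A])
    show "summable (\<lambda>k. measure T (?A k))" using fin by (intro summable_suminf_not_top) auto
  qed (simp add: less_top[symmetric])
  then show ?thesis
    by eventually_elim (auto elim!: eventually_mono simp: not_less)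
qed

end

section \<open>The quenched and the annealed mean number of visits\<close>

lemma suminf_eq_top:
  fixes g :: "nat \<Rightarrow> ennreal"
  assumes "\<forall>\<^sub>F n in sequentially. 1 \<le> g n" shows "(\<Sum>n. g n) = \<infinity>"
proof -
  obtain N where N: "\<And>n. N \<le> n \<Longrightarrow> 1 \<le> g n" using assms by (auto simp: eventually_sequentially)
  have "(\<Sum>n. 1 :: ennreal) = \<top>" using nn_integral_count_space_nat[of "\<lambda>_. 1"] by simp
  moreover have "(\<Sum>n. 1 :: ennreal) \<le> (\<Sum>n. g (n + N))" using N by (intro suminf_le) auto
  moreover have "(\<Sum>n. g (n + N)) \<le> (\<Sum>n. g n)" using suminf_offset[of g N] by simp
  ultimately show ?thesis by (simp add: top_unique)
qed

text \<open>The root test, in the form needed for the comparison of \<open>\<epsilon>\<close> with a vanishing free energy.\<close>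

lemma exponential_series_finite:
  fixes a :: "nat \<Rightarrow> real"
  assumes "0 < \<epsilon>" "\<And>n. 0 \<le> a n" "\<forall>\<^sub>F n in sequentially. a n \<le> exp (\<epsilon> / 2 * real n)"
  shows "(\<Sum>n. ennreal (exp (- \<epsilon> * real n)) * ennreal (a n)) < \<infinity>"
proof -
  have "summable (\<lambda>n. exp (- \<epsilon> * real n) * a n)"
  proof (rule summable_comparison_test_ev)
    have "exp (- \<epsilon> / 2) < 1" using assms by simp
    then show "summable (\<lambda>n. exp (- \<epsilon> / 2) ^ n)" by (intro summable_geometric) auto
    show "\<forall>\<^sub>F n in sequentially. norm (exp (- \<epsilon> * real n) * a n) \<le> exp (- \<epsilon> / 2) ^ n"
      using assms(3)
    proof eventually_elim
      case (elim n)
      have "exp (- \<epsilon> * real n) * a n \<le> exp (- \<epsilon> * real n) * exp (\<epsilon> / 2 * real n)"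
        using elim by (intro mult_left_mono) auto
      also have "\<dots> = exp (- \<epsilon> / 2) ^ n"
        by (simp add: exp_add[symmetric] exp_of_nat_mult[symmetric] algebra_simps)
      finally show ?case using assms(2)[of n] by simp
    qed
  qed
  then have "(\<Sum>n. ennreal (exp (- \<epsilon> * real n) * a n)) < \<infinity>"
    using assms(2) by (simp add: suminf_ennreal2)
  then show ?thesis using assms(2) by (simp add: ennreal_mult)
qed

locale pinning_model = R: renewal_process T \<tau> \<alpha> L + D: iid_disorder W \<omega>
  for T :: "'t measure" and \<tau> :: "nat \<Rightarrow> 't \<Rightarrow> nat" and \<alpha> :: real and L :: "real \<Rightarrow> real"
    and W :: "'w measure" and \<omega> :: "nat \<Rightarrow> 'w \<Rightarrow> real" +
  fixes f :: "real \<Rightarrow> real \<Rightarrow> real"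
  assumes free_energy: "is_free_energy T \<tau> W \<omega> f"
begin

lemma free_pf_weights: "free_pf R.K n (D.weights \<beta> h w) = ennreal (partition_function T \<tau> \<beta> h n (\<lambda>i. \<omega> i w))"
  by (simp add: R.partition_function_eq D.weights_def)

lemma renewal_mean_visits_weights:
  "renewal_mean_visits T \<tau> \<beta> h \<epsilon> (\<lambda>i. \<omega> i w) = (\<Sum>n. ennreal (exp (- \<epsilon> * real n)) * free_pf R.K n (D.weights \<beta> h w))"
  by (simp add: R.renewal_mean_visits_eq D.weights_def)

lemma AE_free_energy:
  assumes "0 \<le> \<beta>"
  shows "AE w in W. (\<lambda>n. ln (partition_function T \<tau> \<beta> h n (\<lambda>i. \<omega> i w)) / real n) \<longlonglongrightarrow> f \<beta> h"
  using free_energy assms unfolding is_free_energy_def by blast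

lemma renewal_mean_visits_infinite:
  assumes "0 \<le> \<beta>" "0 \<le> \<epsilon>" "\<epsilon> < f \<beta> h"
  shows "AE w in W. renewal_mean_visits T \<tau> \<beta> h \<epsilon> (\<lambda>i. \<omega> i w) = \<infinity>"
  using AE_free_energy[OF assms(1), of h]
proof eventually_elim
  case (elim w)
  let ?Z = "\<lambda>n. partition_function T \<tau> \<beta> h n (\<lambda>i. \<omega> i w)"
  have "\<forall>\<^sub>F n in sequentially. \<epsilon> < ln (?Z n) / real n" using elim assms(3) by (rule order_tendstoD)
  then have "\<forall>\<^sub>F n in sequentially. 1 \<le> ennreal (exp (- \<epsilon> * real n)) * ennreal (?Z n)"
    using eventually_gt_at_top[of 0]
  proof eventually_elim
    case (elim n)
    then have "\<epsilon> * real n < ln (?Z n)" by (simp add: field_simps)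
    moreover have "0 \<le> \<epsilon> * real n" using assms by simp
    ultimately have "?Z n \<noteq> 0" by auto
    then have "0 < ?Z n" using R.partition_function_nonneg[of \<beta> h n "\<lambda>i. \<omega> i w"] by linarith
    then have "exp (\<epsilon> * real n) \<le> ?Z n"
      using \<open>\<epsilon> * real n < ln (?Z n)\<close> by (metis exp_le_cancel_iff exp_ln less_imp_le)
    then have "exp (- \<epsilon> * real n) * exp (\<epsilon> * real n) \<le> exp (- \<epsilon> * real n) * ?Z n" by (intro mult_left_mono) auto
    then have "1 \<le> exp (- \<epsilon> * real n) * ?Z n" by (simp add: exp_add[symmetric])
    then have "ennreal 1 \<le> ennreal (exp (- \<epsilon> * real n) * ?Z n)" by (rule ennreal_leI)
    then show ?case by (simp add: ennreal_mult')
  qed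
  then show ?case unfolding renewal_mean_visits_weights free_pf_weights by (rule suminf_eq_top)
qed

lemma subexponential_partition_function:
  assumes "0 \<le> \<beta>" "f \<beta> h = 0" "0 < \<delta>"
  shows "AE w in W. \<forall>\<^sub>F n in sequentially. partition_function T \<tau> \<beta> h n (\<lambda>i. \<omega> i w) \<le> exp (\<delta> * real n)"
  using AE_free_energy[OF assms(1), of h]
proof eventually_elim
  case (elim w)
  let ?Z = "\<lambda>n. partition_function T \<tau> \<beta> h n (\<lambda>i. \<omega> i w)"
  have "\<forall>\<^sub>F n in sequentially. ln (?Z n) / real n < \<delta>"
    using elim assms by (intro order_tendstoD(2)) auto
  then show ?case
    using eventually_gt_at_top[of 0]
  proof eventually_elim
    case (elim n)
    then have l: "ln (?Z n) < \<delta> * real n" by (simp add: field_simps)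
    show ?case
    proof (cases "?Z n = 0")
      case False
      then have "0 < ?Z n" using R.partition_function_nonneg[of \<beta> h n "\<lambda>i. \<omega> i w"] by linarith
      then show ?thesis using l by (metis exp_le_cancel_iff exp_ln less_imp_le)
    qed simp
  qed
qed

lemma renewal_mean_visits_finite:
  assumes "0 \<le> \<beta>" "f \<beta> h = 0" "0 < \<epsilon>"
  shows "AE w in W. renewal_mean_visits T \<tau> \<beta> h \<epsilon> (\<lambda>i. \<omega> i w) < \<infinity>"
proof -
  have "0 < \<epsilon> / 2" using assms(3) by simp
  from subexponential_partition_function[OF assms(1,2) this] show ?thesis
    unfolding renewal_mean_visits_weights free_pf_weights
    by eventually_elim (rule exponential_series_finite[OF assms(3) R.partition_function_nonneg])
qed

definition jump_mass :: "nat \<Rightarrow> real" where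
  "jump_mass r = R.prob {t \<in> space T. \<tau> 1 t = r}"

lemma K_jump_mass: "R.K = (\<lambda>r. ennreal (jump_mass r))"
  by (simp add: R.K_eq jump_mass_def fun_eq_iff)

lemma jump_mass_bounds:
  assumes "0 < s"
  shows "\<forall>\<^sub>F r in sequentially. real r powr (- (1 + \<alpha>) - s) \<le> jump_mass r \<and> jump_mass r \<le> real r powr (- (1 + \<alpha>) + s)"
proof -
  have "\<forall>\<^sub>F r in sequentially. real r powr (- s) \<le> L (real r) \<and> L (real r) \<le> real r powr s"
    by (rule eventually_compose_filterlim[OF slowly_varying_bounds[OF R.slowly_varying assms] filterlim_real_sequentially])
  then show ?thesis
    using eventually_ge_at_top[of 1]
  proof eventually_elim
    case (elim r)
    have m: "jump_mass r = L (real r) * real r powr (- (1 + \<alpha>))"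
      unfolding jump_mass_def by (rule R.inter_arrival_law[OF elim(2)])
    have "real r powr (- s) * real r powr (- (1 + \<alpha>)) \<le> jump_mass r" "jump_mass r \<le> real r powr s * real r powr (- (1 + \<alpha>))"
      unfolding m using elim by (auto intro!: mult_right_mono)
    then show ?case by (simp add: powr_add[symmetric] add.commute)
  qed
qed

lemma mean_jump:
  assumes "integrable T (\<lambda>t. real (\<tau> 1 t))"
  obtains mu where "0 \<le> mu" "(\<Sum>r. R.K (Suc r) * of_nat (Suc r)) = ennreal mu"
proof -
  have "(\<Sum>r. R.K (Suc r) * of_nat (Suc r)) = (\<integral>\<^sup>+r. of_nat r \<partial>R.jump_law)"
    by (rule R.increments.nn_integral_M[symmetric])
  also have "\<dots> = (\<integral>\<^sup>+t. of_nat (\<tau> 1 t) \<partial>T)"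
    unfolding R.jump_law_def by (rule nn_integral_distr[OF R.measurable_tau_1]) auto
  also have "\<dots> = (\<integral>\<^sup>+t. ennreal (norm (real (\<tau> 1 t))) \<partial>T)"
    by (simp add: ennreal_of_nat_eq_real_of_nat)
  also have "\<dots> < \<infinity>" using assms by (simp add: integrable_iff_bounded)
  finally show ?thesis using that by (metis ennreal_cases infinity_ennreal_def less_irrefl)
qed

lemma tails_le_mean: "1 + (\<Sum>n. \<Sum>r. R.K (r + Suc (Suc n))) \<le> (\<Sum>r. R.K (Suc r) * of_nat (Suc r))"
proof -
  have "(\<Sum>n. \<Sum>r. R.K (r + Suc n)) = (\<Sum>n. \<Sum>r. R.K (r + Suc (n + 1))) + (\<Sum>n<1. \<Sum>r. R.K (r + Suc n))"
    by (rule suminf_offset) simp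
  then show ?thesis using sum_tails_le[of R.K] R.increments.sum_mass by (simp add: add.commute)
qed

text \<open>The environment at \<open>h\<close> is the environment at the critical parameter \<open>h0\<close> with every weight
  multiplied by \<open>exp (- (h0 - h))\<close>, which produces the geometric factor in the number of contacts.\<close>

lemma quenched_finite_below_critical:
  assumes "0 \<le> \<beta>" "f \<beta> h0 = 0" "h < h0" and int: "integrable T (\<lambda>t. real (\<tau> 1 t))"
  shows "AE w in W. renewal_mean_visits T \<tau> \<beta> h 0 (\<lambda>i. \<omega> i w) < \<infinity>"
proof -
  interpret E: iid_weights "D.weight_law \<beta> h0" by (rule D.iid_weights_weight_law)
  obtain mu where mu: "0 \<le> mu" "(\<Sum>r. R.K (Suc r) * of_nat (Suc r)) = ennreal mu" by (rule mean_jump[OF int])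
  have "AE e in E.S. (\<Sum>k. ennreal (exp (- (h0 - h) * real k)) * contact_sum (\<lambda>r. ennreal (jump_mass r)) k e) < \<infinity>"
  proof (rule E.delocalised_series_finite[where K=jump_mass and \<eta>="exp (h0 - \<beta>)"])
    show "0 \<le> jump_mass r" for r by (simp add: jump_mass_def)
    show "0 \<le> \<alpha>" by (rule R.alpha_nonneg)
    show "\<forall>\<^sub>F r in sequentially. real r powr (- (1 + \<alpha>) - s) \<le> jump_mass r \<and> jump_mass r \<le> real r powr (- (1 + \<alpha>) + s)"
      if "0 < s" for s by (rule jump_mass_bounds[OF that])
    have "(\<Sum>r. ennreal (jump_mass (Suc r) * real (Suc r))) = (\<Sum>r. R.K (Suc r) * of_nat (Suc r))"
      by (intro suminf_cong) (simp add: K_jump_mass ennreal_mult ennreal_of_nat_eq_real_of_nat jump_mass_def del: of_nat_Suc)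
    then show "(\<Sum>r. ennreal (jump_mass (Suc r) * real (Suc r))) \<le> ennreal mu" by (simp only: mu order_refl)
    show "(\<integral>\<^sup>+e. e 0 \<partial>E.S) \<le> ennreal (exp (log_mgf W \<omega> \<beta> + h0))" using D.mean_weight[OF assms(1), of h0] by simp
    show "0 < measure E.S {e. ennreal (exp (h0 - \<beta>)) \<le> e 0}" by (rule D.weight_not_small[OF assms(1)])
    fix \<delta> :: real assume \<delta>: "0 < \<delta>"
    have "AE w in W. \<forall>\<^sub>F n in sequentially. pinned_pf R.K n (D.weights \<beta> h0 w) \<le> ennreal (exp (\<delta> * real n))"
      using subexponential_partition_function[OF assms(1,2) \<delta>]
    proof eventually_elim
      case (elim w)
      then show ?case
      proof eventually_elim
        case (elim n)
        have "pinned_pf R.K n (D.weights \<beta> h0 w) \<le> free_pf R.K n (D.weights \<beta> h0 w)" by (rule pinned_pf_le_free_pf)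
        also have "\<dots> \<le> ennreal (exp (\<delta> * real n))" unfolding free_pf_weights using elim by (rule ennreal_leI)
        finally show ?case .
      qed
    qed
    moreover have "{e \<in> space E.S. \<forall>\<^sub>F n in sequentially. pinned_pf R.K n e \<le> ennreal (exp (\<delta> * real n))} \<in> sets E.S"
      unfolding eventually_sequentially by measurable
    ultimately have "AE e in distr W E.S (D.weights \<beta> h0). \<forall>\<^sub>F n in sequentially. pinned_pf R.K n e \<le> ennreal (exp (\<delta> * real n))"
      by (subst AE_distr_iff) auto
    then show "AE e in E.S. \<forall>\<^sub>F n in sequentially. pinned_pf (\<lambda>r. ennreal (jump_mass r)) n e \<le> ennreal (exp (\<delta> * real n))"
      unfolding D.distr_weights K_jump_mass .
  qed (use mu assms in auto)
  then have "AE w in W. (\<Sum>k. ennreal (exp (- (h0 - h) * real k)) * contact_sum R.K k (D.weights \<beta> h0 w)) < \<infinity>"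
    unfolding K_jump_mass[symmetric] by (rule D.AE_weights)
  then show ?thesis
  proof eventually_elim
    case (elim w)
    have w: "D.weights \<beta> h w = (\<lambda>i. ennreal (exp (- (h0 - h))) * D.weights \<beta> h0 w i)"
      by (simp add: D.weights_def site_weight_def ennreal_mult[symmetric] exp_add[symmetric] fun_eq_iff)
    have "renewal_mean_visits T \<tau> \<beta> h 0 (\<lambda>i. \<omega> i w) = (\<Sum>n. free_pf R.K n (D.weights \<beta> h w))"
      by (simp add: renewal_mean_visits_weights)
    also have "\<dots> \<le> ennreal mu * (\<Sum>k. contact_sum R.K k (D.weights \<beta> h w))"
      using tails_le_mean unfolding mu(2) by (rule suminf_free_pf_le)
    also have "(\<Sum>k. contact_sum R.K k (D.weights \<beta> h w)) =
        (\<Sum>k. ennreal (exp (- (h0 - h) * real k)) * contact_sum R.K k (D.weights \<beta> h0 w))"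
    proof (rule suminf_cong)
      fix k
      have "ennreal (exp (- (h0 - h))) ^ k = ennreal (exp (- (h0 - h) * real k))"
        by (simp add: ennreal_power exp_of_nat_mult[symmetric] mult.commute)
      then show "contact_sum R.K k (D.weights \<beta> h w) =
          ennreal (exp (- (h0 - h) * real k)) * contact_sum R.K k (D.weights \<beta> h0 w)"
        unfolding w step_op_power_scale_env by simp
    qed
    also have "ennreal mu * \<dots> < \<infinity>" using elim by (simp add: ennreal_mult_less_top)
    finally show ?case .
  qed
qed

lemma annealed_mean_visits_eq:
  assumes "0 \<le> \<beta>"
  shows "annealed_mean_visits T \<tau> W \<omega> \<beta> h \<epsilon> =
    (\<Sum>n. ennreal (exp (- \<epsilon> * real n)) * free_pf R.K n (\<lambda>_. ennreal (exp (h - annealed_critical_point W \<omega> \<beta>))))"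
proof -
  interpret E: iid_weights "D.weight_law \<beta> h" by (rule D.iid_weights_weight_law)
  have [measurable]: "(\<lambda>w. free_pf R.K n (D.weights \<beta> h w)) \<in> borel_measurable W" for n
    by (rule measurable_compose[OF D.measurable_weights E.measurable_free_pf])
  have "annealed_mean_visits T \<tau> W \<omega> \<beta> h \<epsilon> =
      (\<Sum>n. \<integral>\<^sup>+w. ennreal (exp (- \<epsilon> * real n)) * free_pf R.K n (D.weights \<beta> h w) \<partial>W)"
    unfolding annealed_mean_visits_def renewal_mean_visits_weights by (rule nn_integral_suminf) measurable
  also have "\<dots> = (\<Sum>n. ennreal (exp (- \<epsilon> * real n)) * (\<integral>\<^sup>+e. free_pf R.K n e \<partial>E.S))"
    by (simp add: nn_integral_cmult D.nn_integral_weights[OF E.measurable_free_pf])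
  also have "\<dots> = (\<Sum>n. ennreal (exp (- \<epsilon> * real n)) * free_pf R.K n (\<lambda>_. ennreal (exp (h - annealed_critical_point W \<omega> \<beta>))))"
    using D.mean_weight[OF assms, of h] by (simp add: E.nn_integral_free_pf annealed_critical_point_def add.commute)
  finally show ?thesis .
qed

text \<open>The annealed series is the series of a homogeneous model, so the free energy at \<open>\<beta> = 0\<close> decides.\<close>

lemma annealed_mean_visits_infinite:
  assumes "0 \<le> \<beta>" "0 \<le> \<epsilon>" "\<epsilon> < f 0 (h - annealed_critical_point W \<omega> \<beta>)"
  shows "annealed_mean_visits T \<tau> W \<omega> \<beta> h \<epsilon> = \<infinity>"
proof -
  let ?h = "h - annealed_critical_point W \<omega> \<beta>"
  have "AE w in W. renewal_mean_visits T \<tau> 0 ?h \<epsilon> (\<lambda>i. \<omega> i w) = \<infinity>"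
    using assms by (intro renewal_mean_visits_infinite) auto
  moreover have "renewal_mean_visits T \<tau> 0 ?h \<epsilon> (\<lambda>i. \<omega> i w) = annealed_mean_visits T \<tau> W \<omega> \<beta> h \<epsilon>" for w
    unfolding annealed_mean_visits_eq[OF assms(1)] R.renewal_mean_visits_eq by (simp add: site_weight_def[abs_def])
  ultimately show ?thesis by simp
qed

lemma annealed_mean_visits_finite:
  assumes "0 \<le> \<beta>" "h \<le> annealed_critical_point W \<omega> \<beta>" "0 < \<epsilon>"
  shows "annealed_mean_visits T \<tau> W \<omega> \<beta> h \<epsilon> < \<infinity>"
proof -
  let ?w = "ennreal (exp (h - annealed_critical_point W \<omega> \<beta>))"
  have "free_pf R.K n (\<lambda>_. ?w) \<le> 1" for n
    using assms by (intro free_pf_const_le_1) (auto simp: R.increments.sum_mass)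
  then have "annealed_mean_visits T \<tau> W \<omega> \<beta> h \<epsilon> \<le> (\<Sum>n. ennreal (exp (- \<epsilon> * real n)) * ennreal 1)"
    unfolding annealed_mean_visits_eq[OF assms(1)] by (intro suminf_le mult_left_mono) auto
  also have "\<dots> < \<infinity>" using assms by (intro exponential_series_finite) auto
  finally show ?thesis .
qed

lemma annealed_mean_visits_finite_at_0:
  assumes "0 \<le> \<beta>" "h < annealed_critical_point W \<omega> \<beta>" "integrable T (\<lambda>t. real (\<tau> 1 t))"
  shows "annealed_mean_visits T \<tau> W \<omega> \<beta> h 0 < \<infinity>"
proof -
  define x where "x = exp (h - annealed_critical_point W \<omega> \<beta>)"
  have x: "0 \<le> x" "x < 1" using assms by (auto simp: x_def)
  obtain mu where mu: "0 \<le> mu" "(\<Sum>r. R.K (Suc r) * of_nat (Suc r)) = ennreal mu" by (rule mean_jump[OF assms(3)])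
  have one: "contact_sum R.K k (\<lambda>_. 1) = 1" for k
  proof (induction k)
    case (Suc k)
    have "env_shift r (\<lambda>_. 1) = (\<lambda>_. 1)" for r by (simp add: env_shift_def)
    then show ?case using Suc R.increments.sum_mass by (simp add: step_op_def[of _ "(step_op _ ^^ k) _"])
  qed simp
  have "annealed_mean_visits T \<tau> W \<omega> \<beta> h 0 = (\<Sum>n. free_pf R.K n (\<lambda>_. ennreal x))"
    by (simp add: annealed_mean_visits_eq[OF assms(1)] x_def)
  also have "\<dots> \<le> ennreal mu * (\<Sum>k. contact_sum R.K k (\<lambda>_. ennreal x))"
    using tails_le_mean unfolding mu(2) by (rule suminf_free_pf_le)
  also have "(\<Sum>k. contact_sum R.K k (\<lambda>_. ennreal x)) = (\<Sum>k. ennreal (x ^ k))"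
    using step_op_power_scale_env[where c="ennreal x" and e="\<lambda>_. 1" and \<kappa>=R.K] one x by (simp add: ennreal_power)
  also have "\<dots> = ennreal (1 / (1 - x))" using x by (intro suminf_ennreal_eq geometric_sums) auto
  also have "ennreal mu * ennreal (1 / (1 - x)) < \<infinity>" by (simp add: ennreal_mult_less_top)
  finally show ?thesis .
qed

text \<open>The renewal set is fixed first; its jumps are subexponential for almost every realisation.\<close>

lemma AE_mean_visits_finite:
  assumes "0 < \<beta>" "h < 0" and int: "integrable T (\<lambda>t. ln (real (\<tau> 1 t)))"
  shows "AE t in T. AE w in W. mean_visits \<beta> h 0 (\<lambda>i. \<omega> i w) (range (\<lambda>k. \<tau> k t)) < \<infinity>"
proof -
  interpret E: iid_weights "D.weight_law \<beta> h" by (rule D.iid_weights_weight_law)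
  obtain \<sigma> where \<sigma>: "0 < \<sigma>" "\<sigma> \<le> 1" "(\<integral>\<^sup>+w. epow \<sigma> (D.weights \<beta> h w 0) \<partial>W) < 1"
    using D.small_power_contracts[OF assms(1,2)] by blast
  have "(\<integral>\<^sup>+w. epow \<sigma> (D.weights \<beta> h w 0) \<partial>W) = E.frac_moment \<sigma> (\<lambda>e. e 0)"
    unfolding E.frac_moment_def by (rule D.nn_integral_weights) measurable
  then have "E.frac_moment \<sigma> (\<lambda>e. e 0) < 1" using \<sigma> by simp
  from E.contracting_weights[OF \<sigma>(1,2) this] obtain \<delta> where \<delta>: "0 < \<delta>"
    "\<And>\<rho>. (\<And>i. 1 \<le> \<rho> i) \<Longrightarrow> \<forall>\<^sub>F k in sequentially. real (\<rho> k) \<le> exp (\<delta> * real k) \<Longrightarrow>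
      AE e in E.S. (\<Sum>n. contact_prod (renewal_set \<rho>) n e) < \<infinity>" by blast
  have "AE t in T. t \<in> space T" by simp
  with R.increments_subexponential[OF int \<delta>(1)] show ?thesis
  proof eventually_elim
    case (elim t)
    have "AE e in E.S. (\<Sum>n. contact_prod (renewal_set (R.increments t)) n e) < \<infinity>"
      using elim by (intro \<delta>(2) R.increments_pos)
    then have "AE w in W. (\<Sum>n. contact_prod (renewal_set (R.increments t)) n (D.weights \<beta> h w)) < \<infinity>"
      by (rule D.AE_weights)
    then show ?case
      by eventually_elim (simp add: mean_visits_eq R.range_tau[OF elim(2)] D.weights_def)
  qed
qed

lemma measurable_mean_visits:
  "(\<lambda>(t, w). mean_visits \<beta> h \<epsilon> (\<lambda>i. \<omega> i w) (range (\<lambda>k. \<tau> k t))) \<in> borel_measurable (T \<Otimes>\<^sub>M W)"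
proof -
  have tau: "(\<lambda>t. \<tau> k t) \<in> T \<rightarrow>\<^sub>M count_space UNIV" for k
  proof -
    have "(\<lambda>t. \<Sum>i<k. R.increments t i) \<in> T \<rightarrow>\<^sub>M count_space UNIV" by (induction k) auto
    then show ?thesis by (rule measurable_cong[THEN iffD1, rotated]) (simp add: R.tau_eq_sum)
  qed
  note [measurable] = measurable_compose[OF measurable_fst tau]
  have [measurable]: "Measurable.pred (T \<Otimes>\<^sub>M W) (\<lambda>p. m \<in> range (\<lambda>k. \<tau> k (fst p)))" for m
    unfolding image_iff by measurable
  show ?thesis
    unfolding mean_visits_eq contact_prod_def site_weight_def split_beta' by measurable
qed

text \<open>A finite mean number of visits implies finitely many visits; Fubini's theorem exchanges the order
  of the two almost sure statements.\<close>

lemma transient: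
  assumes "0 < \<beta>" "h < 0" "integrable T (\<lambda>t. ln (real (\<tau> 1 t)))"
  shows "transience_probability T \<tau> W \<omega> \<beta> h = 1"
    and "AE (t, w) in T \<Otimes>\<^sub>M W. mean_visits \<beta> h 0 (\<lambda>i. \<omega> i w) (range (\<lambda>k. \<tau> k t)) < \<infinity>"
proof -
  interpret TW: pair_sigma_finite T W by standard
  let ?Q = "\<lambda>t w. mean_visits \<beta> h 0 (\<lambda>i. \<omega> i w) (range (\<lambda>k. \<tau> k t)) < \<infinity>"
  note [measurable] = measurable_mean_visits[unfolded split_beta']
  have meas: "{p \<in> space (T \<Otimes>\<^sub>M W). ?Q (fst p) (snd p)} \<in> sets (T \<Otimes>\<^sub>M W)" by measurable
  have AE: "AE t in T. AE w in W. ?Q t w" by (rule AE_mean_visits_finite[OF assms])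
  then have "AE p in T \<Otimes>\<^sub>M W. ?Q (fst p) (snd p)"
    by (intro TW.AE_pair_measure meas) auto
  then show "AE (t, w) in T \<Otimes>\<^sub>M W. ?Q t w" by (simp add: split_beta')
  have "AE w in W. AE t in T. ?Q t w"
    using AE TW.AE_commute[OF meas] by simp
  then have "AE w in W. (\<integral>\<^sup>+t. emeasure (rwsre_law \<beta> h 0 (\<lambda>i. \<omega> i w) (range (\<lambda>k. \<tau> k t))) {y. visits y < \<infinity>} \<partial>T) = 1"
  proof eventually_elim
    case (elim w)
    then have "AE t in T. emeasure (rwsre_law \<beta> h 0 (\<lambda>i. \<omega> i w) (range (\<lambda>k. \<tau> k t))) {y. visits y < \<infinity>} = 1"
      by eventually_elim (unfold mean_visits_def rwsre_law_def, rule visits_finite)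
    then have "(\<integral>\<^sup>+t. emeasure (rwsre_law \<beta> h 0 (\<lambda>i. \<omega> i w) (range (\<lambda>k. \<tau> k t))) {y. visits y < \<infinity>} \<partial>T) = (\<integral>\<^sup>+t. 1 \<partial>T)"
      by (rule nn_integral_cong_AE)
    then show ?case by (simp add: R.emeasure_space_1)
  qed
  then have "transience_probability T \<tau> W \<omega> \<beta> h = (\<integral>\<^sup>+w. 1 \<partial>W)"
    unfolding transience_probability_def by (rule nn_integral_cong_AE)
  then show "transience_probability T \<tau> W \<omega> \<beta> h = 1" by (simp add: D.emeasure_space_1)
qed

end

theorem theorem6:
  fixes T :: "'t measure" and \<tau> :: "nat \<Rightarrow> 't \<Rightarrow> nat" and \<alpha> :: real and L :: "real \<Rightarrow> real"
    and W :: "'w measure" and \<omega> :: "nat \<Rightarrow> 'w \<Rightarrow> real"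
    and f :: "real \<Rightarrow> real \<Rightarrow> real" and h\<^sub>c :: "real \<Rightarrow> real" and \<beta> h :: real
  assumes "renewal_process T \<tau> \<alpha> L"
    and "iid_disorder W \<omega>"
    and "is_free_energy T \<tau> W \<omega> f"
    and "is_critical_curve f h\<^sub>c"
    and "0 < \<beta>"
  shows
    "(h\<^sub>c \<beta> < h \<and> h < 0 \<and> integrable T (\<lambda>t. ln (real (\<tau> 1 t))) \<longrightarrow>
        transience_probability T \<tau> W \<omega> \<beta> h = 1 \<and>
        (AE (t, w) in T \<Otimes>\<^sub>M W. mean_visits \<beta> h 0 (\<lambda>i. \<omega> i w) (range (\<lambda>k. \<tau> k t)) < \<infinity>) \<and>
        (\<forall>\<epsilon>. 0 \<le> \<epsilon> \<and> \<epsilon> < f \<beta> h \<longrightarrow>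
          (AE w in W. renewal_mean_visits T \<tau> \<beta> h \<epsilon> (\<lambda>i. \<omega> i w) = \<infinity>)))
     \<and> (annealed_critical_point W \<omega> \<beta> < h \<and> h \<le> h\<^sub>c \<beta> \<longrightarrow>
        (\<forall>\<epsilon>>0. AE w in W. renewal_mean_visits T \<tau> \<beta> h \<epsilon> (\<lambda>i. \<omega> i w) < \<infinity>) \<and>
        (integrable T (\<lambda>t. real (\<tau> 1 t)) \<and> h < h\<^sub>c \<beta> \<longrightarrow>
          (AE w in W. renewal_mean_visits T \<tau> \<beta> h 0 (\<lambda>i. \<omega> i w) < \<infinity>)) \<and>
        (\<forall>\<epsilon>. 0 \<le> \<epsilon> \<and> \<epsilon> < f 0 (h - annealed_critical_point W \<omega> \<beta>) \<longrightarrow>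
          annealed_mean_visits T \<tau> W \<omega> \<beta> h \<epsilon> = \<infinity>))
     \<and> (h \<le> annealed_critical_point W \<omega> \<beta> \<longrightarrow>
        (\<forall>\<epsilon>>0. annealed_mean_visits T \<tau> W \<omega> \<beta> h \<epsilon> < \<infinity>) \<and>
        (integrable T (\<lambda>t. real (\<tau> 1 t)) \<and> h < annealed_critical_point W \<omega> \<beta> \<longrightarrow>
          annealed_mean_visits T \<tau> W \<omega> \<beta> h 0 < \<infinity>))"
proof -
  interpret pinning_model T \<tau> \<alpha> L W \<omega> f
    using assms(1-3) by (simp add: pinning_model_def pinning_model_axioms_def)
  have zero: "f \<beta> h = 0" if "h \<le> h\<^sub>c \<beta>" for h
    using assms(4,5) that unfolding is_critical_curve_def by auto
  have \<beta>: "0 \<le> \<beta>" using assms(5) by simp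
  show ?thesis
  proof (intro conjI impI allI)
    assume loc: "h\<^sub>c \<beta> < h \<and> h < 0 \<and> integrable T (\<lambda>t. ln (real (\<tau> 1 t)))"
    then show "transience_probability T \<tau> W \<omega> \<beta> h = 1"
      and "AE (t, w) in T \<Otimes>\<^sub>M W. mean_visits \<beta> h 0 (\<lambda>i. \<omega> i w) (range (\<lambda>k. \<tau> k t)) < \<infinity>"
      using transient[OF assms(5)] by blast+
    fix \<epsilon> assume "0 \<le> \<epsilon> \<and> \<epsilon> < f \<beta> h"
    then show "AE w in W. renewal_mean_visits T \<tau> \<beta> h \<epsilon> (\<lambda>i. \<omega> i w) = \<infinity>"
      by (intro renewal_mean_visits_infinite \<beta>) auto
  next
    fix \<epsilon> :: real assume "annealed_critical_point W \<omega> \<beta> < h \<and> h \<le> h\<^sub>c \<beta>" "0 < \<epsilon>"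
    then show "AE w in W. renewal_mean_visits T \<tau> \<beta> h \<epsilon> (\<lambda>i. \<omega> i w) < \<infinity>"
      by (intro renewal_mean_visits_finite \<beta> zero) auto
  next
    assume "integrable T (\<lambda>t. real (\<tau> 1 t)) \<and> h < h\<^sub>c \<beta>"
    then show "AE w in W. renewal_mean_visits T \<tau> \<beta> h 0 (\<lambda>i. \<omega> i w) < \<infinity>"
      using quenched_finite_below_critical[OF \<beta> zero[OF order_refl]] by blast
  next
    fix \<epsilon> assume "0 \<le> \<epsilon> \<and> \<epsilon> < f 0 (h - annealed_critical_point W \<omega> \<beta>)"
    then show "annealed_mean_visits T \<tau> W \<omega> \<beta> h \<epsilon> = \<infinity>"
      by (intro annealed_mean_visits_infinite \<beta>) auto
  next
    fix \<epsilon> :: real assume "h \<le> annealed_critical_point W \<omega> \<beta>" "0 < \<epsilon>"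
    then show "annealed_mean_visits T \<tau> W \<omega> \<beta> h \<epsilon> < \<infinity>"
      by (intro annealed_mean_visits_finite \<beta>)
  next
    assume "integrable T (\<lambda>t. real (\<tau> 1 t)) \<and> h < annealed_critical_point W \<omega> \<beta>"
    then show "annealed_mean_visits T \<tau> W \<omega> \<beta> h 0 < \<infinity>"
      by (intro annealed_mean_visits_finite_at_0 \<beta>) auto
  qed
qed

end
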